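(* Let $d\ge 2$ and $\gamma\in[-2,1]$. Let $f=f(x,v)\ge 0$ on $\mathbb{R}^d_x\times\mathbb{R}^d_v$ satisfy $f\in L^3\big(\mathbb{R}^d_x;\,W^{1,1}_{\gamma+2}(\mathbb{R}^d_v)\cap W^{1,\infty}(\mathbb{R}^d_v)\big)$. Let $Q^\varepsilon$ ($\varepsilon\in(0,1)$) be the rescaled four-wave collision operator and $Q_L$ the limiting (wave Landau) collision operator defined in the context. Then, as $\varepsilon\to0$, $$\langle Q^\varepsilon(f),\varphi\rangle\to\langle Q_L(f),\varphi\rangle\qquad\text{for all }\varphi\in C_c^\infty(\mathbb{R}^{2d}).$$
   Context: **Function spaces.** $\langle v\rangle=(1+|v|^2)^{1/2}$. $W^{1,1}_s(\mathbb{R}^d)$ is the space of functions $\xi=\xi(v)$ with $\langle v\rangle^s\xi\in W^{1,1}(\mathbb{R}^d)$. $\langle\cdot,\cdot\rangle$ denotes the $L^2$ pairing on $\mathbb{R}^{2d}=\mathbb{R}^d_x\times\mathbb{R}^d_v$. **Collision geometry.** For $v\neq v_*$ in $\mathbb{R}^d$ put $k=\frac{v-v_*}{|v-v_*|}\in S^{d-1}$. For $\sigma\in S^{d-1}$ set $$v'=\frac{v+v_*}{2}+\frac{|v-v_*|}{2}\sigma,\qquad v_*'=\frac{v+v_*}{2}-\frac{|v-v_*|}{2}\sigma ,$$ and $\theta=\arccos(k\cdot\sigma)$, so that $\sigma=k\cos\theta+p\sin\theta$ with $p\in S^{d-2}_{k^\perp}:=\{p\in S^{d-1}: p\cdot k=0\}$.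 For $d\ge3$, $\mathrm{d}p$ is the surface measure on $S^{d-2}_{k^\perp}$, with total mass $|S^{d-2}|$. For $d=2$, $S^0_{k^\perp}$ consists of the two unit vectors orthogonal to $k$, $\mathrm{d}p$ is the counting measure, and $|S^0|=2$. For a function $\phi=\phi(x,v)$ write $\phi_*=\phi(x,v_* )$, $\phi'=\phi(x,v')$, $\phi'_*=\phi(x,v'_* )$, and $$\overline\nabla\phi=\phi'+\phi'_*-\phi_*-\phi .$$ **Angular kernel.** $\beta\ge 0$ is a fixed function of the angle with $\operatorname{supp}\beta\subset[0,\pi/2]$, $\beta(\theta)\gtrsim\theta^{-2}$ on $(0,\pi/2]$ (i.e. $\beta(\theta)\ge c\,\theta^{-2}$ for some $c>0$), and $$\int_0^{\pi/2}\theta^2\beta(\theta)\,\mathrm{d}\theta=\frac{8(d-1)}{|S^{d-2}|}.$$ For $\varepsilon\in(0,1)$ set $\beta^\varepsilon(\theta)=\frac{\pi^3}{\varepsilon^3}\beta(\pi\theta/\varepsilon)$, which is supported in $[0,\varepsilon/2]$. **Operators.** The rescaled four-wave collision operator is $$Q^\varepsilon(f)=-4\pi\int_{\mathbb{R}^d}\int_0^{\varepsilon/2}|v-v_*|^\gamma\beta^\varepsilon(\theta)\,ff_*\Big(\int_{S^{d-2}_{k^\perp}}f'f'_*\,\overline\nabla f^{-1}\,\mathrm{d}p\Big)\mathrm{d}\theta\,\mathrm{d}v_*,$$ and the limiting operator is $$Q_L(f)=-4\pi\nabla_v\cdot\int_{\mathbb{R}^d}|v-v_*|^{\gamma+2}(ff_*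 )^2\,\Pi_{(v-v_* )^\perp}\big(\nabla_vf^{-1}-\nabla_{v_*}f_*^{-1}\big)\mathrm{d}v_*,\qquad \Pi_{w^\perp}=\operatorname{Id}-\frac{w\otimes w}{|w|^2}.$$ Here the products with $f^{-1}$ are read as the polynomial expressions $ff_*f'f'_*\overline\nabla f^{-1}=ff_*(f'+f'_* )-(f+f_* )f'f'_*$ and $(ff_* )^2(\nabla_vf^{-1}-\nabla_{v_*}f_*^{-1})=-f_*^2\nabla_vf+f^2\nabla_{v_*}f_*$. **Weak formulations.** For $\varphi\in C_c^\infty(\mathbb{R}^{2d})$ the pairings are understood through the weak formulations $$\langle Q^\varepsilon(f),\varphi\rangle=\pi\int_{\mathbb{R}^{3d}}\int_0^{\pi/2}|v-v_*|^\gamma\beta(\chi)\frac{\pi^2}{\varepsilon^2}\Big(ff_*\int_{S^{d-2}_{k^\perp}}(f'+f'_* )\overline\nabla\varphi\,\mathrm{d}p-(f+f_* )\int_{S^{d-2}_{k^\perp}}f'f'_*\overline\nabla\varphi\,\mathrm{d}p\Big)\mathrm{d}\chi\,\mathrm{d}v_*\,\mathrm{d}v\,\mathrm{d}x,$$ where $\chi=\pi\theta/\varepsilon$ (i.e. $v',v'_*$ are evaluated at the angle $\theta=\varepsilon\chi/\pi$), and $$\langle Q_L(f),\varphi\rangle=2\pi\int_{\mathbb{R}^{3d}}|v-v_*|^{\gamma+2}\big(-f_*^2\nabla_vf+f^2\nabla_{v_*}f_*\big)\cdot\Pi_{(v-v_* )^\perp}\big(\nabla_v\varphi-\nabla_{v_*}\varphi_*\big)\mathrm{d}v_*\,\mathrm{d}v\,\mathrm{d}x.$$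 *)

theory Defs
  imports "HOL-Analysis.Analysis" "HOL-Probability.Essential_Supremum"
begin

section \<open>Test functions and gradients\<close>

definition grad :: "('a::euclidean_space \<Rightarrow> real) \<Rightarrow> 'a \<Rightarrow> 'a" where
  "grad \<phi> z = (\<Sum>b\<in>Basis. frechet_derivative \<phi> (at z) b *\<^sub>R b)"

primrec C_k :: "nat \<Rightarrow> ('a::euclidean_space \<Rightarrow> real) \<Rightarrow> bool" where
  "C_k 0 \<phi> \<longleftrightarrow> continuous_on UNIV \<phi>"
| "C_k (Suc k) \<phi> \<longleftrightarrow>
     (\<forall>z. \<phi> differentiable at z) \<and>
     (\<forall>b\<in>Basis. C_k k (\<lambda>z. frechet_derivative \<phi> (at z) b))"

definition Cc_infty :: "('a::euclidean_space \<Rightarrow> real) set" where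
  "Cc_infty = {\<phi>. (\<forall>k. C_k k \<phi>) \<and> compact (closure {z. \<phi> z \<noteq> 0})}"

section \<open>Sobolev spaces\<close>

definition locally_integrable :: "('a::euclidean_space \<Rightarrow> 'b::euclidean_space) \<Rightarrow> bool" where
  "locally_integrable u \<longleftrightarrow> (\<forall>K. compact K \<longrightarrow> set_integrable lebesgue K u)"

definition has_weak_grad :: "('a::euclidean_space \<Rightarrow> real) \<Rightarrow> ('a \<Rightarrow> 'a) \<Rightarrow> bool" where
  "has_weak_grad u G \<longleftrightarrow>
     locally_integrable u \<and> locally_integrable G \<and>
     (\<forall>\<psi>\<in>Cc_infty. (LINT v|lebesgue. u v *\<^sub>R grad \<psi> v) = - (LINT v|lebesgue. \<psi> v *\<^sub>R G v))"

definition weak_grad :: "('a::euclidean_space \<Rightarrow> real) \<Rightarrow> 'a \<Rightarrow> 'a" where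
  "weak_grad u = (SOME G. has_weak_grad u G)"

definition W11_norm :: "('a::euclidean_space \<Rightarrow> real) \<Rightarrow> ennreal" where
  "W11_norm u = (\<integral>\<^sup>+v. ennreal \<bar>u v\<bar> \<partial>lebesgue) + (\<integral>\<^sup>+v. ennreal (norm (weak_grad u v)) \<partial>lebesgue)"

definition W11 :: "('a::euclidean_space \<Rightarrow> real) set" where
  "W11 = {u. (\<exists>G. has_weak_grad u G) \<and> W11_norm u < \<infinity>}"

definition W1inf_norm :: "('a::euclidean_space \<Rightarrow> real) \<Rightarrow> ennreal" where
  "W1inf_norm u =
     esssup lebesgue (\<lambda>v. ennreal \<bar>u v\<bar>) + esssup lebesgue (\<lambda>v. ennreal (norm (weak_grad u v)))"

definition W1inf :: "('a::euclidean_space \<Rightarrow> real) set" where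
  "W1inf = {u. (\<exists>G. has_weak_grad u G) \<and> W1inf_norm u < \<infinity>}"

definition jap :: "'a::real_normed_vector \<Rightarrow> real" where
  "jap v = sqrt (1 + (norm v)\<^sup>2)"

definition W11w_norm :: "real \<Rightarrow> ('a::euclidean_space \<Rightarrow> real) \<Rightarrow> ennreal" where
  "W11w_norm s \<xi> = W11_norm (\<lambda>v. jap v powr s * \<xi> v)"

definition W11w :: "real \<Rightarrow> ('a::euclidean_space \<Rightarrow> real) set" where
  "W11w s = {\<xi>. (\<lambda>v. jap v powr s * \<xi> v) \<in> W11}"

text \<open>Applying \<^const>\<open>weak_grad\<close> slice by slice would choose a representative separately for each
  \<open>x\<close>, with no measurability in \<open>(x, v)\<close>. The velocity gradient of \<open>f(x, v)\<close> is therefore a jointly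
  measurable function, which is unique up to null sets of the phase space.\<close>

definition has_grad_v :: "('a::euclidean_space \<times> 'a \<Rightarrow> real) \<Rightarrow> ('a \<times> 'a \<Rightarrow> 'a) \<Rightarrow> bool" where
  "has_grad_v f G \<longleftrightarrow>
     G \<in> borel_measurable lebesgue \<and>
     (AE x in lebesgue. has_weak_grad (\<lambda>v. f (x, v)) (\<lambda>v. G (x, v)))"

definition grad_v :: "('a::euclidean_space \<times> 'a \<Rightarrow> real) \<Rightarrow> 'a \<times> 'a \<Rightarrow> 'a" where
  "grad_v f = (SOME G. has_grad_v f G)"

text \<open>The space \<open>L\<^sup>3(\<real>\<^sup>d\<^sub>x; W\<^sup>1\<^sup>,\<^sup>1\<^sub>s(\<real>\<^sup>d\<^sub>v) \<inter> W\<^sup>1\<^sup>,\<^sup>\<infinity>(\<real>\<^sup>d\<^sub>v))\<close>, with the sum of the two norms on the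
  intersection. Its elements are functions measurable on the phase space with a measurable
  velocity gradient; strong measurability of \<open>x \<mapsto> f(x, \<cdot>)\<close> into the (nonseparable)
  intersection is not demanded, so the space contains the Bochner space.\<close>

definition L3_W :: "real \<Rightarrow> ('a::euclidean_space \<times> 'a \<Rightarrow> real) set" where
  "L3_W s = {f.
     f \<in> borel_measurable lebesgue \<and> (\<exists>G. has_grad_v f G) \<and>
     (AE x in lebesgue. (\<lambda>v. f (x, v)) \<in> W11w s \<inter> W1inf) \<and>
     (\<lambda>x. W11w_norm s (\<lambda>v. f (x, v)) + W1inf_norm (\<lambda>v. f (x, v))) \<in> borel_measurable lebesgue \<and>
     (\<integral>\<^sup>+x. (W11w_norm s (\<lambda>v. f (x, v)) + W1inf_norm (\<lambda>v. f (x, v))) ^ 3 \<partial>lebesgue) < \<infinity>}"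

section \<open>Integration over the sphere orthogonal to a direction\<close>

text \<open>\<open>|S\<^sup>d\<^sup>-\<^sup>2| = 2 \<pi>\<^bsup>(d-1)/2\<^esup> / \<Gamma>((d-1)/2)\<close>, written as \<open>(d-1)\<close> times the volume of the unit ball
  of dimension \<open>d-1\<close>.\<close>

definition sphere_area :: "nat \<Rightarrow> real" where
  "sphere_area d = real (d - 1) * unit_ball_vol (real (d - 1))"

text \<open>For a unit vector \<open>k\<close>, the surface measure of a subset \<open>A\<close> of the unit sphere of the
  hyperplane orthogonal to \<open>k\<close> is \<open>d-1\<close> times the \<open>(d-1)\<close>-dimensional Lebesgue measure of
  the cone \<open>{r p | p \<in> A, 0 < r \<le> 1}\<close>, i.e. \<open>d-1\<close> times the \<open>d\<close>-dimensional Lebesgue measure of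
  \<open>{r p + t k | p \<in> A, 0 < r \<le> 1, 0 \<le> t \<le> 1}\<close>. For \<open>d = 2\<close> it is the counting measure
  on the two unit vectors orthogonal to \<open>k\<close>.\<close>

definition proj_perp :: "'a::real_inner \<Rightarrow> 'a \<Rightarrow> 'a" where
  "proj_perp w y = y - ((w \<bullet> y) / (norm w)\<^sup>2) *\<^sub>R w"

definition sphere_perp_borel :: "'a::euclidean_space \<Rightarrow> 'a measure" where
  "sphere_perp_borel k =
     distr
       (density lborel
          (\<lambda>w. ennreal (real (DIM('a) - 1) *
             indicator {w. 0 \<le> w \<bullet> k \<and> w \<bullet> k \<le> 1 \<and> 0 < norm (proj_perp k w) \<and> norm (proj_perp k w) \<le> 1} w)))
       borel (\<lambda>w. proj_perp k w /\<^sub>R norm (proj_perp k w))"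

definition sphere_perp :: "'a::euclidean_space \<Rightarrow> 'a measure" where
  "sphere_perp k = completion (sphere_perp_borel k)"

lemma measurable_proj_perp [measurable]:
  "proj_perp (k :: 'a::euclidean_space) \<in> borel_measurable borel"
proof -
  have "proj_perp k = (\<lambda>y. y - ((k \<bullet> y) * inverse ((norm k)\<^sup>2)) *\<^sub>R k)"
    by (simp add: proj_perp_def fun_eq_iff divide_inverse)
  then show ?thesis
    by (simp only:) (intro borel_measurable_continuous_onI continuous_intros)
qed

text \<open>Total mass \<open>|S\<^sup>d\<^sup>-\<^sup>2|\<close>, and agreement with the counting measure for \<open>d = 2\<close>, are proved in
  \<open>sphere_perp_total_mass\<close> and \<open>sphere_perp_eq_counting\<close>.\<close>

definition cone_set :: "'a::euclidean_space \<Rightarrow> 'a set \<Rightarrow> 'a set" where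
  "cone_set k A = {w. 0 \<le> w \<bullet> k \<and> w \<bullet> k \<le> 1 \<and> 0 < norm (proj_perp k w) \<and> norm (proj_perp k w) \<le> 1
     \<and> proj_perp k w /\<^sub>R norm (proj_perp k w) \<in> A}"

lemma cone_set_measurable: "A \<in> sets borel \<Longrightarrow> cone_set k A \<in> sets borel"
proof -
  assume A: "A \<in> sets borel"
  have "(\<lambda>w. proj_perp k w /\<^sub>R norm (proj_perp k w)) -` A \<in> sets borel"
    by (rule measurable_sets_borel[OF _ A]) measurable
  moreover have "{w. 0 \<le> w \<bullet> k \<and> w \<bullet> k \<le> 1 \<and> 0 < norm (proj_perp k w) \<and> norm (proj_perp k w) \<le> 1} \<in> sets borel"
    by measurable
  ultimately have "{w. 0 \<le> w \<bullet> k \<and> w \<bullet> k \<le> 1 \<and> 0 < norm (proj_perp k w) \<and> norm (proj_perp k w) \<le> 1} \<inter>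
      (\<lambda>w. proj_perp k w /\<^sub>R norm (proj_perp k w)) -` A \<in> sets borel"
    by blast
  also have "{w. 0 \<le> w \<bullet> k \<and> w \<bullet> k \<le> 1 \<and> 0 < norm (proj_perp k w) \<and> norm (proj_perp k w) \<le> 1} \<inter>
      (\<lambda>w. proj_perp k w /\<^sub>R norm (proj_perp k w)) -` A = cone_set k A" by (auto simp: cone_set_def)
  finally show ?thesis .
qed

lemma emeasure_sphere_perp_borel:
  fixes k :: "'a::euclidean_space"
  assumes A[measurable]: "A \<in> sets borel"
  shows "emeasure (sphere_perp_borel k) A = ennreal (real (DIM('a) - 1)) * emeasure lborel (cone_set k A)"
proof -
  define C where "C = {w. 0 \<le> w \<bullet> k \<and> w \<bullet> k \<le> 1 \<and> 0 < norm (proj_perp k w) \<and> norm (proj_perp k w) \<le> 1}"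
  have C[measurable]: "C \<in> sets borel" unfolding C_def by measurable
  define h where "h = (\<lambda>w. proj_perp k w /\<^sub>R norm (proj_perp k w))"
  have h[measurable]: "h \<in> borel_measurable borel" unfolding h_def by measurable
  have eq: "cone_set k A = C \<inter> (h -` A)" by (auto simp: cone_set_def C_def h_def)
  have "emeasure (sphere_perp_borel k) A =
     emeasure (density lborel (\<lambda>w. ennreal (real (DIM('a) - 1) * indicator C w))) (h -` A)"
    unfolding sphere_perp_borel_def C_def[symmetric] h_def[symmetric]
    by (subst emeasure_distr) (auto simp: space_density)
  also have "\<dots> = (\<integral>\<^sup>+w. ennreal (real (DIM('a) - 1)) * indicator (cone_set k A) w \<partial>lborel)"
    by (subst emeasure_density)
       (auto intro!: nn_integral_cong simp: eq indicator_def ennreal_mult'' measurable_sets_borel[OF h A])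
  also have "\<dots> = ennreal (real (DIM('a) - 1)) * emeasure lborel (cone_set k A)"
    by (subst nn_integral_cmult_indicator) (auto simp: cone_set_measurable)
  finally show ?thesis .
qed

lemma emeasure_lborel_isometry_open_le:
  fixes T :: "'a::euclidean_space \<Rightarrow> 'a"
  assumes T: "orthogonal_transformation T" and U: "open U"
  shows "emeasure lborel U \<le> emeasure lborel (T ` U)"
proof -
  have inj: "inj T" and lin: "linear T"
    using T by (auto simp: orthogonal_transformation_inj orthogonal_transformation_linear)
  have oTU: "open (T ` U)"
    using T U lin by (intro open_surjective_linear_image) (auto simp: orthogonal_transformation_surj)
  define K where "K = {i :: 'a \<times> real. 0 < snd i \<and> cball (fst i) (snd i) \<subseteq> U}"
  have cov: "\<exists>i. i \<in> K \<and> x \<in> cball (fst i) (snd i) \<and> snd i < d" if "x \<in> U" "0 < d" for x d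
  proof -
    obtain e where e: "e > 0" "cball x e \<subseteq> U" using U \<open>x \<in> U\<close> open_contains_cball by blast
    have "cball x (min e (d/2)) \<subseteq> U" using e by auto
    then show ?thesis using e that by (intro exI[of _ "(x, min e (d/2))"]) (auto simp: K_def)
  qed
  have K0: "i \<in> K \<Longrightarrow> 0 < snd i" for i by (simp add: K_def)
  obtain C where C: "countable C" "C \<subseteq> K"
      "pairwise (\<lambda>i j. disjnt (cball (fst i) (snd i)) (cball (fst j) (snd j))) C"
      "negligible (U - (\<Union>i\<in>C. cball (fst i) (snd i)))"
    using Vitali_covering_theorem_cballs[of K snd U fst, OF K0 cov] by blast
  have disj: "disjoint_family_on (\<lambda>i. cball (fst i) (snd i)) C"
    using C(3) by (auto simp: disjoint_family_on_def pairwise_def disjnt_def)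
  have ball: "T ` cball a r = cball (T a) r" for a r
    using image_orthogonal_transformation_cball[OF T] .
  have disj': "disjoint_family_on (\<lambda>i. T ` cball (fst i) (snd i)) C"
    using disj inj by (fastforce simp: disjoint_family_on_def inj_def)
  have meas: "U - (\<Union>i\<in>C. cball (fst i) (snd i)) \<in> sets borel"
    using U C(1) by (intro sets.Diff sets.countable_UN'') auto
  have null: "U - (\<Union>i\<in>C. cball (fst i) (snd i)) \<in> null_sets lborel"
    using C(4) meas by (simp add: negligible_iff_null_sets null_sets_def)
  have "emeasure lborel U \<le> emeasure lborel ((\<Union>i\<in>C. cball (fst i) (snd i)) \<union> (U - (\<Union>i\<in>C. cball (fst i) (snd i))))"
    using C(1) meas U by (intro emeasure_mono) (auto intro!: sets.Un sets.countable_UN'')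
  also have "\<dots> = emeasure lborel (\<Union>i\<in>C. cball (fst i) (snd i))"
    using null C(1) by (intro emeasure_Un_null_set) (auto intro!: sets.countable_UN'')
  also have "\<dots> = (\<integral>\<^sup>+i. emeasure lborel (cball (fst i) (snd i)) \<partial>count_space C)"
    using C(1) disj by (intro emeasure_UN_countable) auto
  also have "\<dots> = (\<integral>\<^sup>+i. emeasure lborel (T ` cball (fst i) (snd i)) \<partial>count_space C)"
    using K0 C(2)
    by (intro nn_integral_cong) (metis ball emeasure_cball less_imp_le space_count_space subset_iff)
  also have "\<dots> = emeasure lborel (\<Union>i\<in>C. T ` cball (fst i) (snd i))"
    using C(1) disj' by (intro emeasure_UN_countable[symmetric]) (auto simp: ball)
  also have "\<dots> \<le> emeasure lborel (T ` U)"
    using oTU C(2) by (intro emeasure_mono) (auto simp: K_def)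
  finally show ?thesis .
qed

lemma lborel_distr_orthogonal:
  fixes T :: "'a::euclidean_space \<Rightarrow> 'a"
  assumes T: "orthogonal_transformation T"
  shows "distr lborel borel T = lborel"
proof (rule lborel_eqI[symmetric])
  have lin: "linear T" and bij: "bij T"
    using T by (auto simp: orthogonal_transformation_bij orthogonal_transformation_linear)
  have Tm[measurable]: "T \<in> borel_measurable borel"
    using lin by (intro borel_measurable_continuous_onI linear_continuous_on) (simp add: linear_conv_bounded_linear)
  have T': "orthogonal_transformation (inv T)"
    using T by (rule orthogonal_transformation_inv)
  fix l u :: 'a assume lu: "\<And>b. b \<in> Basis \<Longrightarrow> l \<bullet> b \<le> u \<bullet> b"
  have op: "open (inv T ` box l u)"
    using T' by (intro open_surjective_linear_image)
      (auto simp: orthogonal_transformation_surj orthogonal_transformation_linear)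
  have "emeasure lborel (inv T ` box l u) \<le> emeasure lborel (T ` inv T ` box l u)"
    by (rule emeasure_lborel_isometry_open_le[OF T op])
  moreover have "T ` inv T ` box l u = box l u"
    using bij by (simp add: bij_is_surj image_f_inv_f)
  moreover have "emeasure lborel (box l u) \<le> emeasure lborel (inv T ` box l u)"
    by (rule emeasure_lborel_isometry_open_le[OF T' open_box])
  ultimately have "emeasure lborel (inv T ` box l u) = emeasure lborel (box l u)"
    by (simp add: antisym)
  then show "emeasure (distr lborel borel T) (box l u) = (\<Prod>b\<in>Basis. (u - l) \<bullet> b)"
    using lu bij by (simp add: emeasure_distr bij_vimage_eq_inv_image emeasure_lborel_box)
qed simp

lemma emeasure_cone_set_transfer:
  fixes k :: "'a::euclidean_space" and T :: "'a \<Rightarrow> 'a"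
  assumes T: "orthogonal_transformation T" and A: "A \<in> sets borel"
  shows "emeasure lborel (cone_set (T k) A) = emeasure lborel (cone_set k (T -` A))"
proof -
  have lin: "linear T" and isom: "T v \<bullet> T w = v \<bullet> w" "norm (T v) = norm v" for v w
    using T by (auto simp: orthogonal_transformation_def orthogonal_transformation_norm)
  have Tm: "T \<in> borel_measurable borel"
    using lin by (intro borel_measurable_continuous_onI linear_continuous_on) (simp add: linear_conv_bounded_linear)
  have P: "proj_perp (T k) (T w) = T (proj_perp k w)" for w
    using lin by (simp add: proj_perp_def isom linear_diff linear_scale)
  have norm_T: "norm (T (proj_perp k w)) = norm (proj_perp k w)" for w by (rule isom)
  have "emeasure lborel (cone_set (T k) A) = emeasure (distr lborel borel T) (cone_set (T k) A)"
    by (simp add: lborel_distr_orthogonal[OF T])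
  also have "\<dots> = emeasure lborel (T -` cone_set (T k) A)"
    using Tm cone_set_measurable[OF A] by (simp add: emeasure_distr)
  also have "T -` cone_set (T k) A = cone_set k (T -` A)"
    unfolding cone_set_def vimage_def mem_Collect_eq P norm_T isom
    using lin by (simp add: linear_scale)
  finally show ?thesis .
qed

lemma norm_proj_perp_Basis:
  fixes w :: "'a::euclidean_space"
  assumes b: "b \<in> Basis"
  shows "norm (proj_perp b w) = sqrt (\<Sum>i\<in>Basis - {b}. (w \<bullet> i)\<^sup>2)"
proof -
  have "norm (proj_perp b w) = sqrt (\<Sum>i\<in>Basis. (proj_perp b w \<bullet> i)\<^sup>2)"
    by (simp add: norm_eq_sqrt_inner euclidean_inner[of "proj_perp b w" "proj_perp b w"] power2_eq_square)
  also have "(\<Sum>i\<in>Basis. (proj_perp b w \<bullet> i)\<^sup>2) = (\<Sum>i\<in>Basis - {b}. (proj_perp b w \<bullet> i)\<^sup>2)"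
    using b by (subst sum.remove[of _ b]) (auto simp: proj_perp_def inner_diff_left inner_commute[of b w])
  also have "\<dots> = (\<Sum>i\<in>Basis - {b}. (w \<bullet> i)\<^sup>2)"
    using b by (intro sum.cong refl) (auto simp: proj_perp_def inner_diff_left inner_Basis)
  finally show ?thesis .
qed

lemma emeasure_cone_set_UNIV_Basis:
  fixes b :: "'a::euclidean_space"
  assumes b: "b \<in> Basis" and dim: "DIM('a) \<ge> 2"
  shows "emeasure lborel (cone_set b UNIV) = ennreal (unit_ball_vol (real (DIM('a) - 1)))"
proof -
  interpret product_sigma_finite "\<lambda>_. lborel" by standard
  let ?B = "Basis - {b} :: 'a set"
  have card: "card ?B = DIM('a) - 1" using b by (simp add: card_Diff_subset)
  define D where "D = {w :: 'a. 0 \<le> w \<bullet> b \<and> w \<bullet> b \<le> 1 \<and> norm (proj_perp b w) \<le> 1}"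
  have D[measurable]: "D \<in> sets borel" unfolding D_def by measurable
  have ball: "{f. sqrt (\<Sum>i\<in>?B. (f i)\<^sup>2) \<le> 1} \<inter> space (Pi\<^sub>M ?B (\<lambda>_. lborel)) \<in> sets (Pi\<^sub>M ?B (\<lambda>_. lborel))"
  proof -
    have "{f \<in> space (Pi\<^sub>M ?B (\<lambda>_. lborel)). sqrt (\<Sum>i\<in>?B. (f i)\<^sup>2) \<le> 1} \<in> sets (Pi\<^sub>M ?B (\<lambda>_. lborel :: real measure))"
      by measurable
    then show ?thesis by (simp add: Collect_conj_eq Int_commute)
  qed
  have "emeasure lborel D = (\<integral>\<^sup>+ w. indicator D w \<partial>lborel)" by simp
  also have "\<dots> = (\<integral>\<^sup>+ f. indicator D (\<Sum>i\<in>Basis. f i *\<^sub>R i) \<partial>Pi\<^sub>M (insert b ?B) (\<lambda>_. lborel))"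
    using b by (subst lborel_eq, subst nn_integral_distr) (auto simp: insert_absorb)
  also have "\<dots> = (\<integral>\<^sup>+ y. \<integral>\<^sup>+ f. indicator D (\<Sum>i\<in>Basis. (f(b := y)) i *\<^sub>R i)
       \<partial>Pi\<^sub>M ?B (\<lambda>_. lborel) \<partial>lborel)"
    using b by (subst product_nn_integral_insert_rev) (auto simp: insert_absorb)
  also have "\<dots> = (\<integral>\<^sup>+ y. \<integral>\<^sup>+ f. indicator {0..1} (y :: real) *
       indicator ({f. sqrt (\<Sum>i\<in>?B. (f i)\<^sup>2) \<le> 1} \<inter> space (Pi\<^sub>M ?B (\<lambda>_. lborel))) f
       \<partial>Pi\<^sub>M ?B (\<lambda>_. lborel) \<partial>lborel)"
  proof (rule nn_integral_cong, rule nn_integral_cong, goal_cases)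
    case (1 y f)
    have *: "(\<Sum>i\<in>Basis. (f(b := y)) i *\<^sub>R i) \<bullet> j = (f(b := y)) j" if "j \<in> Basis" for j
      using that by simp
    have "sqrt (\<Sum>j\<in>?B. ((\<Sum>i\<in>Basis. (f(b := y)) i *\<^sub>R i) \<bullet> j)\<^sup>2) = sqrt (\<Sum>j\<in>?B. (f j)\<^sup>2)"
      by (intro arg_cong[where f = sqrt] sum.cong refl, subst *) auto
    then show ?case
      using 1 b by (simp add: D_def norm_proj_perp_Basis[OF b] * indicator_def del: fun_upd_apply) auto
  qed
  also have "\<dots> = (\<integral>\<^sup>+ y. ennreal (unit_ball_vol (real (DIM('a) - 1))) * indicator {0..1} (y :: real) \<partial>lborel)"
    using ball emeasure_cball_aux[of ?B 1]
    by (intro nn_integral_cong) (simp add: nn_integral_cmult card mult.commute)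
  also have "\<dots> = ennreal (unit_ball_vol (real (DIM('a) - 1)))"
    by (subst nn_integral_cmult_indicator) auto
  finally have D_eq: "emeasure lborel D = ennreal (unit_ball_vol (real (DIM('a) - 1)))" .
  have "emeasure lborel (cone_set b UNIV) = emeasure lborel D"
  proof (rule emeasure_eq_AE)
    have "card ?B > 0" using card dim by linarith
    then obtain j where j: "j \<in> ?B" by (metis card_gt_0_iff ex_in_conv)
    have "AE w in lborel. w \<bullet> j \<noteq> 0"
    proof -
      have "negligible {w. j \<bullet> w = 0}" using j by (intro negligible_hyperplane) auto
      moreover have "{w. j \<bullet> w = 0} \<in> sets borel" by measurable
      ultimately have "{w. j \<bullet> w = 0} \<in> null_sets lborel"
        by (simp add: negligible_iff_null_sets null_sets_def)
      from AE_not_in[OF this] show ?thesis by (simp add: inner_commute)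
    qed
    then show "AE w in lborel. w \<in> cone_set b UNIV \<longleftrightarrow> w \<in> D"
    proof eventually_elim
      case (elim w)
      have "proj_perp b w \<bullet> j = w \<bullet> j" using j b
        by (auto simp: proj_perp_def inner_diff_left inner_Basis)
      then have "proj_perp b w \<noteq> 0" using elim by auto
      then show ?case by (auto simp: cone_set_def D_def)
    qed
  qed (auto simp: cone_set_measurable)
  with D_eq show ?thesis by simp
qed

lemma Basis_orthogonal_transformation:
  fixes k :: "real ^ 'n"
  assumes "norm k = 1"
  obtains b and T :: "real ^ 'n \<Rightarrow> real ^ 'n"
    where "b \<in> Basis" "orthogonal_transformation T" "T b = k"
proof -
  obtain b :: "real ^ 'n" where b: "b \<in> Basis" by (meson nonempty_Basis all_not_in_conv)
  obtain T where "orthogonal_transformation T" "T b = k"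
    using orthogonal_transformation_exists_1[of b k] assms b by auto
  with b that show ?thesis by blast
qed

lemma emeasure_sphere_perp:
  "A \<in> sets borel \<Longrightarrow> emeasure (sphere_perp k) A = emeasure (sphere_perp_borel k) A"
  by (simp add: sphere_perp_def sphere_perp_borel_def)

lemma sphere_perp_total_mass:
  fixes k :: "real ^ 'n"
  assumes "CARD('n) \<ge> 2" "norm k = 1"
  shows "emeasure (sphere_perp k) UNIV = ennreal (sphere_area CARD('n))"
proof -
  obtain b and T :: "real ^ 'n \<Rightarrow> real ^ 'n" where T: "b \<in> Basis" "orthogonal_transformation T" "T b = k"
    using Basis_orthogonal_transformation[OF assms(2)] by metis
  have "emeasure lborel (cone_set k UNIV) = emeasure lborel (cone_set b UNIV)"
    using emeasure_cone_set_transfer[OF T(2), of UNIV b] T(3) by simp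
  also have "\<dots> = ennreal (unit_ball_vol (real (CARD('n) - 1)))"
    using emeasure_cone_set_UNIV_Basis[OF T(1)] assms(1) by simp
  finally show ?thesis
    by (simp add: emeasure_sphere_perp emeasure_sphere_perp_borel sphere_area_def ennreal_mult'
         del: of_nat_diff)
qed

lemma sphere_perp_eq_counting:
  fixes k :: "real ^ 'n"
  assumes d: "CARD('n) = 2" and k: "norm k = 1" and A: "A \<in> sets borel"
  shows "emeasure (sphere_perp k) A = of_nat (card (A \<inter> {p. norm p = 1 \<and> p \<bullet> k = 0}))"
proof -
  obtain b and T :: "real ^ 'n \<Rightarrow> real ^ 'n" where b: "b \<in> Basis" and T: "orthogonal_transformation T" "T b = k"
    using Basis_orthogonal_transformation[OF k] by metis
  have lin: "linear T" and isom: "T v \<bullet> T w = v \<bullet> w" "norm (T v) = norm v" for v w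
    using T by (auto simp: orthogonal_transformation_def orthogonal_transformation_norm)
  have bij: "bij T" using T(1) by (rule orthogonal_transformation_bij)
  have "card (Basis - {b}) = 1" using b d by (simp add: card_Diff_subset)
  then obtain j where j: "Basis - {b} = {j}" by (auto simp: card_1_singleton_iff)
  then have jB: "j \<in> Basis" "j \<noteq> b" and B: "Basis = {b, j}" using b by auto
  have on: "b \<bullet> j = 0" "j \<bullet> b = 0" "b \<bullet> b = 1" "j \<bullet> j = 1" "norm b = 1" "norm j = 1"
    using b jB by (auto simp: inner_Basis)
  have repr: "w = (w \<bullet> b) *\<^sub>R b + (w \<bullet> j) *\<^sub>R j" for w
    using euclidean_representation[of w] jB(2) by (simp add: B)
  have P: "proj_perp b w = (w \<bullet> j) *\<^sub>R j" for w
  proof -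
    have "proj_perp b w = w - (w \<bullet> b) *\<^sub>R b" by (simp add: proj_perp_def on inner_commute)
    also have "\<dots> = (w \<bullet> j) *\<^sub>R j" using repr[of w] by (metis add_diff_cancel_left')
    finally show ?thesis .
  qed
  define R where "R = {w. 0 \<le> w \<bullet> b \<and> w \<bullet> b \<le> 1 \<and> 0 < w \<bullet> j \<and> w \<bullet> j \<le> 1}"
  define R' where "R' = {w. 0 \<le> w \<bullet> b \<and> w \<bullet> b \<le> 1 \<and> 0 > w \<bullet> j \<and> w \<bullet> j \<ge> -1}"
  have Rm[measurable]: "R \<in> sets borel" "R' \<in> sets borel" unfolding R_def R'_def by measurable
  have le: "\<forall>i\<in>Basis. (0 :: real ^ 'n) \<bullet> i \<le> (b + j) \<bullet> i" "\<forall>i\<in>Basis. (- j) \<bullet> i \<le> b \<bullet> i"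
    unfolding B by (auto simp: on inner_add_left)
  have prod: "(\<Prod>i\<in>Basis. (b + j - 0) \<bullet> i) = 1" "(\<Prod>i\<in>Basis. (b - - j) \<bullet> i) = 1"
    unfolding B using jB(2) by (auto simp: on inner_add_left)
  have R1: "emeasure lborel (cbox 0 (b + j)) = 1" "emeasure lborel (box 0 (b + j)) = 1"
    "emeasure lborel (cbox (- j) b) = 1" "emeasure lborel (box (- j) b) = 1"
    unfolding emeasure_lborel_cbox_eq emeasure_lborel_box_eq prod if_P[OF le(1)] if_P[OF le(2)]
    by simp_all
  have "emeasure lborel R = 1"
  proof (rule antisym)
    have "emeasure lborel R \<le> emeasure lborel (cbox 0 (b + j))"
      by (intro emeasure_mono) (auto simp: R_def mem_box B on inner_add_left)
    then show "emeasure lborel R \<le> 1" by (simp only: R1)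
    have "emeasure lborel (box 0 (b + j)) \<le> emeasure lborel R"
      by (intro emeasure_mono) (auto simp: R_def mem_box B on inner_add_left)
    then show "1 \<le> emeasure lborel R" by (simp only: R1)
  qed
  moreover have "emeasure lborel R' = 1"
  proof (rule antisym)
    have "emeasure lborel R' \<le> emeasure lborel (cbox (- j) b)"
      by (intro emeasure_mono) (auto simp: R'_def mem_box B on)
    then show "emeasure lborel R' \<le> 1" by (simp only: R1)
    have "emeasure lborel (box (- j) b) \<le> emeasure lborel R'"
      by (intro emeasure_mono) (auto simp: R'_def mem_box B on)
    then show "1 \<le> emeasure lborel R'" by (simp only: R1)
  qed
  moreover have "cone_set b (T -` A) = (if T j \<in> A then R else {}) \<union> (if - T j \<in> A then R' else {})"
  proof -
    have "w \<in> cone_set b (T -` A) \<longleftrightarrow> w \<in> (if T j \<in> A then R else {}) \<union> (if - T j \<in> A then R' else {})" for w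
    proof (cases "w \<bullet> j" "0 :: real" rule: linorder_cases)
      case less
      then have "proj_perp b w /\<^sub>R norm (proj_perp b w) = - j" by (simp add: P on)
      then show ?thesis using less lin by (auto simp: cone_set_def R_def R'_def P on linear_neg)
    next
      case equal
      then show ?thesis by (auto simp: cone_set_def R_def R'_def P)
    next
      case greater
      then have "proj_perp b w /\<^sub>R norm (proj_perp b w) = j" by (simp add: P on)
      then show ?thesis using greater lin by (auto simp: cone_set_def R_def R'_def P on)
    qed
    then show ?thesis by blast
  qed
  moreover have "R \<inter> R' = {}" by (auto simp: R_def R'_def)
  ultimately have cone: "emeasure lborel (cone_set b (T -` A)) =
      (if T j \<in> A then 1 else 0) + (if - T j \<in> A then 1 else 0)"
    by (simp add: plus_emeasure[symmetric])
  have S: "{p. norm p = 1 \<and> p \<bullet> k = 0} = {T j, - T j}"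
  proof (intro set_eqI iffI)
    fix p assume p: "p \<in> {p. norm p = 1 \<and> p \<bullet> k = 0}"
    obtain q where q: "p = T q" using bij by (metis bij_pointE)
    then have "q \<bullet> b = 0" "norm q = 1" using p isom T(2) by auto
    then have "q = (q \<bullet> j) *\<^sub>R j" "\<bar>q \<bullet> j\<bar> = 1" using repr[of q] on by (auto, metis norm_scaleR mult.right_neutral)
    then have "q = j \<or> q = - j" by (metis abs_if minus_minus scaleR_minus1_left scaleR_one)
    then show "p \<in> {T j, - T j}" using q lin by (auto simp: linear_neg)
  next
    fix p assume "p \<in> {T j, - T j}"
    then show "p \<in> {p. norm p = 1 \<and> p \<bullet> k = 0}" using isom T(2) on by auto
  qed
  have "T j \<bullet> T j = 1" using isom(1)[of j j] on by simp
  then have ne: "T j \<noteq> - T j"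
    by (metis inner_minus_left one_neq_neg_one)
  have "emeasure (sphere_perp k) A = emeasure lborel (cone_set b (T -` A))"
    using emeasure_cone_set_transfer[OF T(1) A, of b] d A
    by (simp add: emeasure_sphere_perp emeasure_sphere_perp_borel T(2))
  also have "\<dots> = of_nat (card (A \<inter> {p. norm p = 1 \<and> p \<bullet> k = 0}))"
    unfolding cone S using ne by (auto simp: Int_insert_right)
  finally show ?thesis .
qed

section \<open>Collision geometry\<close>

definition rel_dir :: "'a::real_normed_vector \<Rightarrow> 'a \<Rightarrow> 'a" where
  "rel_dir v vs = (v - vs) /\<^sub>R norm (v - vs)"

definition scat :: "'a::real_normed_vector \<Rightarrow> 'a \<Rightarrow> real \<Rightarrow> 'a \<Rightarrow> 'a" where
  "scat v vs \<theta> p = cos \<theta> *\<^sub>R rel_dir v vs + sin \<theta> *\<^sub>R p"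

definition post :: "'a::real_normed_vector \<Rightarrow> 'a \<Rightarrow> real \<Rightarrow> 'a \<Rightarrow> 'a" where
  "post v vs \<theta> p = (v + vs) /\<^sub>R 2 + (norm (v - vs) / 2) *\<^sub>R scat v vs \<theta> p"

definition posts :: "'a::real_normed_vector \<Rightarrow> 'a \<Rightarrow> real \<Rightarrow> 'a \<Rightarrow> 'a" where
  "posts v vs \<theta> p = (v + vs) /\<^sub>R 2 - (norm (v - vs) / 2) *\<^sub>R scat v vs \<theta> p"

definition nabla_bar :: "('a::real_normed_vector \<times> 'a \<Rightarrow> real) \<Rightarrow> 'a \<Rightarrow> 'a \<Rightarrow> 'a \<Rightarrow> real \<Rightarrow> 'a \<Rightarrow> real" where
  "nabla_bar \<phi> x v vs \<theta> p =
     \<phi> (x, post v vs \<theta> p) + \<phi> (x, posts v vs \<theta> p) - \<phi> (x, vs) - \<phi> (x, v)"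

section \<open>Angular kernel\<close>

definition angular_kernel :: "nat \<Rightarrow> (real \<Rightarrow> real) \<Rightarrow> bool" where
  "angular_kernel d \<beta> \<longleftrightarrow>
     (\<forall>\<theta>. 0 \<le> \<beta> \<theta>) \<and>
     closure {\<theta>. \<beta> \<theta> \<noteq> 0} \<subseteq> {0..pi/2} \<and>
     (\<exists>c>0. \<forall>\<theta>\<in>{0<..pi/2}. \<beta> \<theta> \<ge> c / \<theta>\<^sup>2) \<and>
     has_bochner_integral (lebesgue_on {0..pi/2}) (\<lambda>\<theta>. \<theta>\<^sup>2 * \<beta> \<theta>)
       (8 * real (d - 1) / sphere_area d)"

section \<open>Weak formulations of the collision operators\<close>

text \<open>In the first pairing the angle is \<open>\<theta> = \<epsilon> t / \<pi>\<close>, so that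
  \<open>\<beta>\<^sup>\<epsilon>(\<theta>) d\<theta> = (\<pi>\<^sup>2/\<epsilon>\<^sup>2) \<beta>(t) dt\<close> for \<open>\<beta>\<^sup>\<epsilon>(\<theta>) = (\<pi>\<^sup>3/\<epsilon>\<^sup>3) \<beta>(\<pi>\<theta>/\<epsilon>)\<close>.\<close>

definition Q_eps_pairing ::
  "real \<Rightarrow> (real \<Rightarrow> real) \<Rightarrow> real \<Rightarrow> ('a::euclidean_space \<times> 'a \<Rightarrow> real) \<Rightarrow> ('a \<times> 'a \<Rightarrow> real) \<Rightarrow> real" where
  "Q_eps_pairing \<gamma> \<beta> \<epsilon> f \<phi> =
     pi * (\<integral>(x, v, vs).
       (LINT t:{0..pi/2}|lebesgue.
          (let \<theta> = \<epsilon> * t / pi; S = sphere_perp (rel_dir v vs) in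
           norm (v - vs) powr \<gamma> * \<beta> t * (pi\<^sup>2 / \<epsilon>\<^sup>2) *
           (f (x, v) * f (x, vs) *
              (LINT p|S. (f (x, post v vs \<theta> p) + f (x, posts v vs \<theta> p)) * nabla_bar \<phi> x v vs \<theta> p)
            - (f (x, v) + f (x, vs)) *
              (LINT p|S. f (x, post v vs \<theta> p) * f (x, posts v vs \<theta> p) * nabla_bar \<phi> x v vs \<theta> p))))
       \<partial>lebesgue)"

definition Q_L_pairing ::
  "real \<Rightarrow> ('a::euclidean_space \<times> 'a \<Rightarrow> real) \<Rightarrow> ('a \<times> 'a \<Rightarrow> real) \<Rightarrow> real" where
  "Q_L_pairing \<gamma> f \<phi> =
     2 * pi * (\<integral>(x, v, vs).
       norm (v - vs) powr (\<gamma> + 2) *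
       ((- ((f (x, vs))\<^sup>2 *\<^sub>R grad_v f (x, v)) + (f (x, v))\<^sup>2 *\<^sub>R grad_v f (x, vs)) \<bullet>
        proj_perp (v - vs) (grad (\<lambda>u. \<phi> (x, u)) v - grad (\<lambda>u. \<phi> (x, u)) vs))
       \<partial>lebesgue)"

end

theory Submission
  imports Defs "HOL-Probability.Probability_Measure"
begin

text \<open>In the weak formulation the gain and loss terms combine to
  \<open>f f\<^sub>* (f' + f'\<^sub>*) - (f + f\<^sub>*) f' f'\<^sub>* = - f\<^sub>* f'\<^sub>* (f' - f) - f f' (f'\<^sub>* - f\<^sub>*)\<close>,
  so that every term carries an increment of \<open>f\<close> besides the increment of the test function. Both
  increments are of the order of the velocity change \<open>h = v' - v\<close>, whose norm is at most
  \<open>\<theta> |v - v\<^sub>*|\<close>. Their product compensates the singularity \<open>\<theta>\<^sup>-\<^sup>2\<close> of the kernel and turns the power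
  \<open>\<gamma>\<close> of the relative velocity into \<open>\<gamma> + 2\<close>. The expression is symmetric under the exchange of the
  two particles, hence the total increment of \<open>\<phi>\<close> may be replaced by twice the increment
  \<open>\<phi>' - \<phi>\<close> of one particle.

  To pass to the limit with a density that has merely a weak velocity gradient \<open>G\<close>, the increment
  of \<open>f\<close> is written as the integral of \<open>h \<bullet> G\<close> along the segment from \<open>v\<close> to \<open>v + h\<close>
  (\<open>weak_grad_segment\<close>). A translation of the velocity, which preserves Lebesgue measure, then moves
  the argument of \<open>G\<close> to the fixed point \<open>(x, v)\<close>, at the cost of shifting the other factors. Those
  factors are values of \<open>f\<close>, which converge almost everywhere because \<open>f\<close> is Lipschitz in \<open>v\<close>, and
  a difference quotient of the smooth function \<open>\<phi>\<close>. So the integrand converges almost everywhere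
  (\<open>F1_lim\<close>, \<open>F2_lim\<close>).

  The integrands are dominated by weights \<open>\<kappa>(x, u) |w|\<^sup>\<gamma>\<^sup>+\<^sup>2 cut(u + w + c h)\<close>, where \<open>w\<close> is the
  relative velocity, \<open>\<kappa>\<close> is \<open>M(x)\<^sup>2 f\<close> or \<open>M(x)\<^sup>2 |G|\<close> with \<open>M(x)\<close> the norm of the slice \<open>f(x, \<cdot>)\<close>, and
  \<open>cut\<close> is a cutoff. These weights still move with \<open>\<epsilon>\<close>, and so the convergence theorem used is the
  version of dominated convergence in which the bounds converge together with their integrals
  (\<open>integral_dominated_convergence_converging_bounds\<close>). Their integrals over \<open>w\<close> grow no faster than
  \<open>\<langle>u\<rangle>\<^sup>\<gamma>\<^sup>+\<^sup>2\<close>: for small angles \<open>w \<mapsto> w + c h\<close> is, on each of two half spaces, a small Lipschitz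
  perturbation of the identity, which confines \<open>w\<close> to two sets of fixed size
  (\<open>nn_integral_dev_ball_le\<close>, \<open>weight_limit\<close>). The weight \<open>\<langle>v\<rangle>\<^sup>\<gamma>\<^sup>+\<^sup>2\<close> and the exponent three of the
  function space are what makes the remaining integral finite (\<open>L3_W_data\<close>).

  For the Lipschitz property the azimuth has to be transported from one direction to another in a
  Lipschitz way on each half space. This is achieved by reflections (\<open>frame\<close>), which also turn the
  integral over the sphere orthogonal to \<open>v - v\<^sub>*\<close> into an integral over a fixed sphere. In the limit
  the second moments of that sphere produce the projection orthogonal to \<open>v - v\<^sub>*\<close>, and the
  normalization of \<open>\<theta>\<^sup>2 \<beta>(\<theta>)\<close> produces the constant (\<open>integral_grazing_parameters\<close>).\<close>

section \<open>Smooth test functions\<close>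

lemma C_k_SucI:
  assumes "\<And>z. (\<phi> has_derivative D z) (at z)" "\<And>b. b \<in> Basis \<Longrightarrow> C_k k (\<lambda>z. D z b)"
  shows "C_k (Suc k) \<phi>"
proof -
  have "frechet_derivative \<phi> (at z) = D z" for z
    using frechet_derivative_at[OF assms(1)] by metis
  then show ?thesis
    using assms by (auto simp: differentiable_def)
qed

lemma C_k_SucD:
  assumes "C_k (Suc k) \<phi>"
  shows "(\<phi> has_derivative frechet_derivative \<phi> (at z)) (at z)"
    and "b \<in> Basis \<Longrightarrow> C_k k (\<lambda>z. frechet_derivative \<phi> (at z) b)"
  using assms by (auto simp: frechet_derivative_works)

lemma C_k_Suc_imp: "C_k (Suc k) \<phi> \<Longrightarrow> C_k k \<phi>"
proof (induction k arbitrary: \<phi>)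
  case 0
  then show ?case
    by (auto intro!: differentiable_imp_continuous_on simp: differentiable_on_def differentiable_at_withinI)
next
  case (Suc k)
  then show ?case by (metis C_k.simps(2))
qed

lemma C_k_mono: "C_k k \<phi> \<Longrightarrow> j \<le> k \<Longrightarrow> C_k j \<phi>"
proof (induction k)
  case (Suc k)
  then show ?case using C_k_Suc_imp le_Suc_eq by blast
qed auto

lemma C_k_continuous: "C_k k \<phi> \<Longrightarrow> continuous_on UNIV \<phi>"
  using C_k_mono[of k \<phi> 0] by simp

lemma C_k_const: "C_k k (\<lambda>z. c)"
proof (induction k arbitrary: c)
  case (Suc k)
  show ?case by (rule C_k_SucI[where D = "\<lambda>z b. 0"]) (auto intro: Suc)
qed auto

lemma C_k_inner: "C_k k (\<lambda>z. z \<bullet> a)"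
proof (cases k)
  case (Suc j)
  have "((\<lambda>z. z \<bullet> a) has_derivative (\<lambda>y. y \<bullet> a)) (at z)" for z :: 'a
    by (auto intro!: derivative_eq_intros)
  then show ?thesis unfolding Suc by (rule C_k_SucI) (rule C_k_const)
qed (auto intro!: continuous_intros)

lemma C_k_add: "C_k k \<phi> \<Longrightarrow> C_k k \<psi> \<Longrightarrow> C_k k (\<lambda>z. \<phi> z + \<psi> z)"
proof (induction k arbitrary: \<phi> \<psi>)
  case (Suc k)
  show ?case
    by (rule C_k_SucI[OF has_derivative_add[OF C_k_SucD(1)[OF Suc.prems(1)] C_k_SucD(1)[OF Suc.prems(2)]]])
       (intro Suc.IH C_k_SucD(2)[OF Suc.prems(1)] C_k_SucD(2)[OF Suc.prems(2)])
qed (auto intro: continuous_on_add)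

lemma C_k_mult: "C_k k \<phi> \<Longrightarrow> C_k k \<psi> \<Longrightarrow> C_k k (\<lambda>z. \<phi> z * \<psi> z)"
proof (induction k arbitrary: \<phi> \<psi>)
  case (Suc k)
  show ?case
    by (rule C_k_SucI[OF has_derivative_mult[OF C_k_SucD(1)[OF Suc.prems(1)] C_k_SucD(1)[OF Suc.prems(2)]]])
       (intro C_k_add Suc.IH C_k_SucD(2)[OF Suc.prems(1)] C_k_SucD(2)[OF Suc.prems(2)]
          C_k_Suc_imp[OF Suc.prems(1)] C_k_Suc_imp[OF Suc.prems(2)])
qed (auto intro: continuous_on_mult)

lemma C_k_minus: "C_k k \<phi> \<Longrightarrow> C_k k (\<lambda>z. - \<phi> z)"
  using C_k_mult[OF C_k_const[of k "- 1"]] by simp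

lemma C_k_diff: "C_k k \<phi> \<Longrightarrow> C_k k \<psi> \<Longrightarrow> C_k k (\<lambda>z. \<phi> z - \<psi> z)"
  using C_k_add[OF _ C_k_minus] by simp

lemma C_k_sum: "finite I \<Longrightarrow> (\<And>i. i \<in> I \<Longrightarrow> C_k k (\<phi> i)) \<Longrightarrow> C_k k (\<lambda>z. \<Sum>i\<in>I. \<phi> i z)"
  by (induction I rule: finite_induct) (auto intro: C_k_const C_k_add)

lemma C_k_prod: "finite I \<Longrightarrow> (\<And>i. i \<in> I \<Longrightarrow> C_k k (\<phi> i)) \<Longrightarrow> C_k k (\<lambda>z. \<Prod>i\<in>I. \<phi> i z)"
  by (induction I rule: finite_induct) (auto intro: C_k_const C_k_mult)

text \<open>Composition with a smooth function of one variable, given by its sequence of derivatives.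
  The derivatives are taken at values of the inner function, which covers functions of one variable
  that are smooth on a half line, such as real powers.\<close>

lemma C_k_compose:
  fixes \<phi> :: "'a::euclidean_space \<Rightarrow> real"
  assumes h: "\<And>n z. (h n has_real_derivative h (Suc n) (\<phi> z)) (at (\<phi> z))" and \<phi>: "\<And>k. C_k k \<phi>"
  shows "C_k k (\<lambda>z. h n (\<phi> z))"
proof (induction k arbitrary: n)
  case 0
  have "((\<lambda>z. h n (\<phi> z)) has_derivative (\<lambda>y. frechet_derivative \<phi> (at z) y * h (Suc n) (\<phi> z))) (at z)" for z
    by (rule DERIV_compose_FDERIV[OF h C_k_SucD(1)[OF \<phi>]])
  then show ?case
    by (auto intro!: has_derivative_continuous_on[OF has_derivative_at_withinI])
next
  case (Suc k)
  have "((\<lambda>z. h n (\<phi> z)) has_derivative (\<lambda>y. frechet_derivative \<phi> (at z) y * h (Suc n) (\<phi> z))) (at z)" for z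
    by (rule DERIV_compose_FDERIV[OF h C_k_SucD(1)[OF \<phi>]])
  then show ?case
    by (rule C_k_SucI) (intro C_k_mult C_k_SucD(2)[OF \<phi>] Suc)
qed

lemma C_k_translate:
  fixes \<phi> :: "'a::euclidean_space \<Rightarrow> real"
  shows "C_k k \<phi> \<Longrightarrow> C_k k (\<lambda>z. \<phi> (z - a))"
proof (induction k arbitrary: \<phi>)
  case 0
  then show ?case by (auto intro!: continuous_on_compose2[of UNIV \<phi>] continuous_intros)
next
  case (Suc k)
  have "((\<lambda>z. \<phi> (z - a)) has_derivative (\<lambda>y. frechet_derivative \<phi> (at (z - a)) y)) (at z)" for z
    by (rule has_derivative_compose[OF _ C_k_SucD(1)[OF Suc.prems]]) (auto intro!: derivative_eq_intros)
  then show ?case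
    by (rule C_k_SucI) (intro Suc.IH C_k_SucD(2)[OF Suc.prems])
qed

lemma jap_ge_1: "1 \<le> jap v"
  by (simp add: jap_def)

lemma jap_ge_norm: "norm v \<le> jap v"
  by (simp add: jap_def real_le_rsqrt)

lemma C_k_jap_powr: "C_k k (\<lambda>v :: 'a::euclidean_space. jap v powr s)"
proof -
  \<comment> \<open>The derivatives of \<open>t\<^sup>s\<^sup>/\<^sup>2\<close>, to be composed with \<open>1 + |v|\<^sup>2\<close>.\<close>
  define h where "h n t = (\<Prod>i<n. s/2 - real i) * t powr (s/2 - real n)" for n and t :: real
  have "C_k k (\<lambda>v :: 'a. h 0 (1 + (\<Sum>b\<in>Basis. (v \<bullet> b) * (v \<bullet> b))))"
  proof (rule C_k_compose[where h = h and n = 0 and \<phi> = "\<lambda>v. 1 + (\<Sum>b\<in>Basis. (v \<bullet> b) * (v \<bullet> b))"])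
    fix n and z :: 'a
    have "0 < 1 + (\<Sum>b\<in>Basis. (z \<bullet> b) * (z \<bullet> b))"
      by (rule add_pos_nonneg) (auto intro!: sum_nonneg)
    then show "(h n has_real_derivative h (Suc n) (1 + (\<Sum>b\<in>Basis. (z \<bullet> b) * (z \<bullet> b))))
        (at (1 + (\<Sum>b\<in>Basis. (z \<bullet> b) * (z \<bullet> b))))"
      unfolding h_def by (auto intro!: derivative_eq_intros simp: algebra_simps)
  qed (intro C_k_add C_k_const C_k_sum C_k_mult C_k_inner; simp)
  moreover have "h 0 (1 + (\<Sum>b\<in>Basis. (v \<bullet> b) * (v \<bullet> b))) = jap v powr s" for v :: 'a
    by (simp add: h_def jap_def euclidean_inner[of v v, symmetric] power2_norm_eq_inner
        powr_powr powr_half_sqrt[symmetric])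
  ultimately show ?thesis by (simp only:)
qed

text \<open>The standard flat function \<open>exp (- 1/t)\<close> on the positive half line; the factors \<open>t\<^sup>-\<^sup>n\<close>
  make the linear span of the family closed under differentiation.\<close>

definition flat_exp :: "nat \<Rightarrow> real \<Rightarrow> real" where
  "flat_exp n t = (if t > 0 then exp (- inverse t) * inverse t ^ n else 0)"

lemma flat_exp_has_derivative:
  "(flat_exp n has_real_derivative flat_exp (n + 2) t - real n * flat_exp (n + 1) t) (at t)"
proof (cases t "0 :: real" rule: linorder_cases)
  case less
  have "((\<lambda>t. 0) has_real_derivative 0) (at t)" by simp
  then have "(flat_exp n has_real_derivative 0) (at t)"
    by (rule has_field_derivative_transform_within_open[where S = "{..<0}"])
       (use less in \<open>auto simp: flat_exp_def\<close>)
  then show ?thesis using less by (simp add: flat_exp_def)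
next
  case greater
  have "((\<lambda>t. exp (- inverse t) * inverse t ^ n) has_real_derivative
      exp (- inverse t) * inverse t ^ (n + 2) - real n * (exp (- inverse t) * inverse t ^ (n + 1))) (at t)"
    using greater by (cases n) (auto intro!: derivative_eq_intros simp: field_simps power2_eq_square,
        metis Suc_pred neq0_conv power_Suc)
  then have "(flat_exp n has_real_derivative
      exp (- inverse t) * inverse t ^ (n + 2) - real n * (exp (- inverse t) * inverse t ^ (n + 1))) (at t)"
    by (rule has_field_derivative_transform_within_open[where S = "{0<..}"])
       (use greater in \<open>auto simp: flat_exp_def\<close>)
  then show ?thesis using greater by (simp add: flat_exp_def)
next
  case equal
  have "((\<lambda>t. flat_exp n t / t) \<longlongrightarrow> 0) (at_left 0)"
    by (rule tendsto_eventually) (auto simp: eventually_at_filter flat_exp_def)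
  moreover have "((\<lambda>t. flat_exp n t / t) \<longlongrightarrow> 0) (at_right 0)"
  proof (rule Lim_transform_eventually)
    show "((\<lambda>t :: real. inverse t ^ Suc n / exp (inverse t)) \<longlongrightarrow> 0) (at_right 0)"
      by (rule filterlim_compose[OF tendsto_power_div_exp_0 filterlim_inverse_at_top_right])
    show "\<forall>\<^sub>F t in at_right 0. inverse t ^ Suc n / exp (inverse t) = flat_exp n t / t"
      by (auto simp: eventually_at_filter flat_exp_def exp_minus field_simps)
  qed
  ultimately have "((\<lambda>t. flat_exp n t / t) \<longlongrightarrow> 0) (at 0)"
    by (simp add: filterlim_at_split)
  then show ?thesis
    using equal by (simp add: has_field_derivative_iff flat_exp_def)
qed

lemma C_k_flat_exp:
  fixes \<phi> :: "'a::euclidean_space \<Rightarrow> real"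
  assumes \<phi>: "\<And>k. C_k k \<phi>"
  shows "C_k k (\<lambda>z. flat_exp n (\<phi> z))"
proof (induction k arbitrary: n)
  case 0
  have "continuous_on UNIV (flat_exp n)"
    by (meson DERIV_isCont continuous_at_imp_continuous_on flat_exp_has_derivative)
  then show ?case
    using C_k_continuous[OF \<phi>] by (auto intro: continuous_on_compose2)
next
  case (Suc k)
  have "((\<lambda>z. flat_exp n (\<phi> z)) has_derivative (\<lambda>y. frechet_derivative \<phi> (at z) y *
     (flat_exp (n + 2) (\<phi> z) - real n * flat_exp (n + 1) (\<phi> z)))) (at z)" for z
    by (rule DERIV_compose_FDERIV[OF flat_exp_has_derivative C_k_SucD(1)[OF \<phi>]])
  then show ?case
    by (rule C_k_SucI) (intro C_k_mult C_k_diff C_k_const C_k_SucD(2)[OF \<phi>] Suc)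
qed

lemma C_k_exp:
  fixes \<phi> :: "'a::euclidean_space \<Rightarrow> real"
  assumes \<phi>: "\<And>k. C_k k \<phi>"
  shows "C_k k (\<lambda>z. exp (\<phi> z))"
  using C_k_compose[of "\<lambda>n. exp" \<phi> k 0] \<phi> by (simp add: DERIV_exp)

lemma Cc_inftyI:
  assumes "\<And>k. C_k k \<phi>" "bounded {z. \<phi> z \<noteq> 0}"
  shows "\<phi> \<in> Cc_infty"
  using assms by (simp add: Cc_infty_def compact_closure)

lemma Cc_inftyD:
  assumes "\<phi> \<in> Cc_infty"
  shows "C_k k \<phi>" "bounded {z. \<phi> z \<noteq> 0}" "continuous_on UNIV \<phi>"
  using assms C_k_continuous[of 0 \<phi>] bounded_subset[OF compact_imp_bounded closure_subset, of "{z. \<phi> z \<noteq> 0}"]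
  by (auto simp: Cc_infty_def)

lemma Cc_infty_mult:
  assumes "\<And>k. C_k k \<phi>" "\<psi> \<in> Cc_infty"
  shows "(\<lambda>z. \<phi> z * \<psi> z) \<in> Cc_infty"
  by (intro Cc_inftyI C_k_mult assms Cc_inftyD(1)[OF assms(2)] bounded_subset[OF Cc_inftyD(2)[OF assms(2)]]) auto

lemma Cc_infty_translate:
  fixes \<psi> :: "'a::euclidean_space \<Rightarrow> real"
  assumes "\<psi> \<in> Cc_infty"
  shows "(\<lambda>z. \<psi> (z - a)) \<in> Cc_infty"
proof (intro Cc_inftyI C_k_translate Cc_inftyD(1)[OF assms])
  have "{z. \<psi> (z - a) \<noteq> 0} = (\<lambda>z. a + z) ` {z. \<psi> z \<noteq> 0}"
    by (auto intro!: image_eqI[where x = "_ - a"])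
  then show "bounded {z. \<psi> (z - a) \<noteq> 0}"
    using bounded_translation[OF Cc_inftyD(2)[OF assms], of a] by simp
qed

text \<open>Open boxes are the positivity sets of test functions, so the indicator of a box is a bounded
  limit of the test functions \<open>1 - exp (- m \<eta>)\<close>.\<close>

lemma box_indicator_limit_test:
  fixes a b :: "'a::euclidean_space"
  obtains \<psi> :: "nat \<Rightarrow> 'a \<Rightarrow> real"
  where "\<And>m. \<psi> m \<in> Cc_infty" "\<And>m z. 0 \<le> \<psi> m z \<and> \<psi> m z \<le> indicator (box a b) z"
    "\<And>z. (\<lambda>m. \<psi> m z) \<longlonglongrightarrow> indicator (box a b) z"
proof -
  define \<eta> where "\<eta> z = (\<Prod>i\<in>Basis. flat_exp 0 (z \<bullet> i - a \<bullet> i) * flat_exp 0 (b \<bullet> i - z \<bullet> i))" for z :: 'a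
  have nn: "0 \<le> flat_exp 0 t" and pos: "0 < flat_exp 0 t \<longleftrightarrow> 0 < t" for t
    by (auto simp: flat_exp_def)
  have \<eta>_C: "C_k k \<eta>" for k
    unfolding \<eta>_def by (intro C_k_prod C_k_mult C_k_flat_exp C_k_diff C_k_inner C_k_const) auto
  have \<eta>_pos: "0 < \<eta> z" if "z \<in> box a b" for z
    using that unfolding \<eta>_def by (intro prod_pos mult_pos_pos) (auto simp: pos mem_box)
  have \<eta>_0: "\<eta> z = 0" if "z \<notin> box a b" for z
    using that unfolding \<eta>_def prod_zero_iff[OF finite_Basis]
    by (auto simp: mem_box flat_exp_def)
  show ?thesis
  proof (rule that[of "\<lambda>m z. 1 - exp (- (real m * \<eta> z))"])
    fix m show "(\<lambda>z. 1 - exp (- (real m * \<eta> z))) \<in> Cc_infty"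
      using \<eta>_0 by (intro Cc_inftyI C_k_diff C_k_exp C_k_minus C_k_mult C_k_const \<eta>_C
          bounded_subset[OF bounded_box[of a b]]) fastforce
    fix z show "0 \<le> 1 - exp (- (real m * \<eta> z)) \<and> 1 - exp (- (real m * \<eta> z)) \<le> indicator (box a b) z"
      using \<eta>_0[of z] \<eta>_pos[of z] by (auto simp: indicator_def)
  next
    fix z
    show "(\<lambda>m. 1 - exp (- (real m * \<eta> z))) \<longlonglongrightarrow> indicator (box a b) z"
    proof (cases "z \<in> box a b")
      case True
      have "filterlim (\<lambda>m. real m * \<eta> z) at_top sequentially"
        by (rule filterlim_at_top_mult_tendsto_pos[OF tendsto_const \<eta>_pos[OF True] filterlim_real_sequentially])
      then have "filterlim (\<lambda>m. - (real m * \<eta> z)) at_bot sequentially"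
        by (simp add: filterlim_uminus_at_top)
      then have "(\<lambda>m. exp (- (real m * \<eta> z))) \<longlonglongrightarrow> 0"
        by (rule filterlim_compose[OF exp_at_bot])
      from tendsto_diff[OF tendsto_const[of 1] this] show ?thesis using True by simp
    qed (simp add: \<eta>_0)
  qed
qed

lemma borel_measurable_lebesgueI: "u \<in> borel_measurable borel \<Longrightarrow> u \<in> borel_measurable lebesgue"
  by (simp add: measurable_completion)

lemma locally_integrable_measurable:
  fixes u :: "'a::euclidean_space \<Rightarrow> 'b::euclidean_space"
  assumes "locally_integrable u" shows "u \<in> borel_measurable lebesgue"
proof (rule borel_measurable_LIMSEQ_metric)
  fix n :: nat
  show "(\<lambda>z. indicator (cball 0 (real n)) z *\<^sub>R u z) \<in> borel_measurable lebesgue"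
    using assms unfolding locally_integrable_def set_integrable_def
    by (intro borel_measurable_integrable) auto
next
  fix z :: 'a
  obtain N where "norm z \<le> real N" using real_arch_simple by blast
  then have "\<forall>\<^sub>F n in sequentially. indicator (cball 0 (real n)) z *\<^sub>R u z = u z"
    unfolding eventually_sequentially by (intro exI[of _ N]) (auto simp: indicator_def)
  then show "(\<lambda>n. indicator (cball 0 (real n)) z *\<^sub>R u z) \<longlonglongrightarrow> u z"
    by (rule tendsto_eventually)
qed

lemma locally_integrable_test:
  fixes u :: "'a::euclidean_space \<Rightarrow> 'b::euclidean_space"
  assumes u: "locally_integrable u" and \<psi>: "continuous_on UNIV \<psi>" "bounded {z. \<psi> z \<noteq> 0}"
  shows "integrable lebesgue (\<lambda>v. \<psi> v *\<^sub>R u v)"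
proof -
  define K where "K = closure {z. \<psi> z \<noteq> 0}"
  have K: "compact K" using \<psi>(2) by (simp add: K_def compact_closure)
  have "compact (\<psi> ` K)" using K \<psi>(1) by (intro compact_continuous_image continuous_on_subset[OF \<psi>(1)]) auto
  then obtain B where B: "\<And>z. z \<in> K \<Longrightarrow> norm (\<psi> z) \<le> B"
    using compact_imp_bounded bounded_iff by (metis imageI)
  have \<psi>K: "z \<in> K" if "\<psi> z \<noteq> 0" for z using that closure_subset[of "{z. \<psi> z \<noteq> 0}"] by (auto simp: K_def)
  have [measurable]: "u \<in> borel_measurable lebesgue" by (rule locally_integrable_measurable[OF u])
  have [measurable]: "\<psi> \<in> borel_measurable lebesgue"
    by (rule borel_measurable_lebesgueI[OF borel_measurable_continuous_onI[OF \<psi>(1)]])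
  show ?thesis
  proof (rule Bochner_Integration.integrable_bound)
    show "integrable lebesgue (\<lambda>z. B *\<^sub>R (indicator K z *\<^sub>R u z))"
      using u K unfolding locally_integrable_def set_integrable_def by (intro integrable_scaleR_right) auto
    show "AE z in lebesgue. norm (\<psi> z *\<^sub>R u z) \<le> norm (B *\<^sub>R (indicator K z *\<^sub>R u z))"
      using B \<psi>K by (intro always_eventually allI) (auto simp: indicator_def intro!: mult_right_mono, force+)
  qed auto
qed

text \<open>The fundamental lemma of the calculus of variations. Approximating indicators of boxes by test
  functions shows that the integral over every box vanishes, and a locally integrable function is
  almost everywhere the limit of its means over shrinking cubes.\<close>

lemma AE_zero_if_test_integrals_zero:
  fixes u :: "'a::euclidean_space \<Rightarrow> 'b::euclidean_space"
  assumes u: "locally_integrable u"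
    and zero: "\<And>\<psi>. \<psi> \<in> Cc_infty \<Longrightarrow> (LINT v|lebesgue. \<psi> v *\<^sub>R u v) = 0"
  shows "AE v in lebesgue. u v = 0"
proof -
  have [measurable]: "u \<in> borel_measurable lebesgue" by (rule locally_integrable_measurable[OF u])
  have int: "set_integrable lebesgue (cbox a b) u" for a b
    using u by (simp add: locally_integrable_def)
  have [measurable]: "box a b \<in> sets lebesgue" for a b :: 'a
    by (simp add: fmeasurableD)
  have box0: "(LINT v:box a b|lebesgue. u v) = 0" for a b
  proof -
    obtain \<psi> :: "nat \<Rightarrow> 'a \<Rightarrow> real" where \<psi>: "\<And>m. \<psi> m \<in> Cc_infty"
      "\<And>m z. 0 \<le> \<psi> m z \<and> \<psi> m z \<le> indicator (box a b) z"
      "\<And>z. (\<lambda>m. \<psi> m z) \<longlonglongrightarrow> indicator (box a b) z"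
      using box_indicator_limit_test[of a b] by blast
    have [measurable]: "\<psi> m \<in> borel_measurable lebesgue" for m
      by (rule borel_measurable_lebesgueI[OF borel_measurable_continuous_onI[OF Cc_inftyD(3)[OF \<psi>(1)]]])
    have "(\<lambda>m. LINT v|lebesgue. \<psi> m v *\<^sub>R u v) \<longlonglongrightarrow> (LINT v|lebesgue. indicator (box a b) v *\<^sub>R u v)"
    proof (rule integral_dominated_convergence[where w = "\<lambda>v. norm (indicator (cbox a b) v *\<^sub>R u v)"])
      show "integrable lebesgue (\<lambda>v. norm (indicator (cbox a b) v *\<^sub>R u v))"
        using int by (intro integrable_norm) (simp add: set_integrable_def)
      show "AE v in lebesgue. norm (\<psi> m v *\<^sub>R u v) \<le> norm (indicator (cbox a b) v *\<^sub>R u v)" for m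
      proof (intro always_eventually allI)
        fix v
        have "\<bar>\<psi> m v\<bar> \<le> indicator (cbox a b) v"
          using \<psi>(2)[of m v] box_subset_cbox[of a b] by (auto simp: indicator_def of_bool_def split: if_splits)
        then show "norm (\<psi> m v *\<^sub>R u v) \<le> norm (indicator (cbox a b) v *\<^sub>R u v)"
          by (auto intro!: mult_right_mono)
      qed
    qed (auto intro!: tendsto_intros \<psi>(3))
    then show ?thesis
      using zero[OF \<psi>(1)] by (simp add: set_lebesgue_integral_def LIMSEQ_const_iff)
  qed
  have int0: "integral (cbox a b) u = 0" for a b
  proof -
    have "integral (cbox a b) u = integral (box a b) u" by (rule integral_open_interval[symmetric])
    also have "\<dots> = (LINT v:box a b|lebesgue. u v)"
      by (intro set_lebesgue_integral_eq_integral(2)[symmetric] set_integrable_subset[OF int _ box_subset_cbox])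
         auto
    finally show ?thesis using box0 by simp
  qed
  have "u integrable_on cbox a b" for a b
    by (rule set_lebesgue_integral_eq_integral(1)[OF int])
  from integrable_ccontinuous_explicit[OF this] obtain N where N: "negligible N"
    "\<And>x e. \<lbrakk>x \<notin> N; 0 < e\<rbrakk> \<Longrightarrow> \<exists>d>0. \<forall>h. 0 < h \<and> h < d \<longrightarrow>
        norm (integral (cbox x (x + h *\<^sub>R One)) u /\<^sub>R h ^ DIM('a) - u x) < e"
    by metis
  have "u x = 0" if x: "x \<notin> N" for x
  proof (rule ccontr)
    assume "u x \<noteq> 0"
    then obtain d :: real where d: "d > 0" "\<forall>h. \<not> (0 < h \<and> h < d)"
      using N(2)[OF x, of "norm (u x)"] by (auto simp: int0)
    then show False using d(1) d(2)[rule_format, of "d / 2"] by simp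
  qed
  then show ?thesis
    using N(1) by (intro AE_I'[of N]) (auto simp: negligible_iff_null_sets)
qed

section \<open>Weak gradients\<close>

lemma grad_eq:
  assumes "(\<phi> has_derivative D) (at z)"
  shows "grad \<phi> z = (\<Sum>b\<in>Basis. D b *\<^sub>R b)" and "grad \<phi> z \<bullet> y = D y"
proof -
  have D: "frechet_derivative \<phi> (at z) = D" using frechet_derivative_at[OF assms] by simp
  then show *: "grad \<phi> z = (\<Sum>b\<in>Basis. D b *\<^sub>R b)" by (simp add: grad_def)
  have lin: "linear D" using assms has_derivative_linear by blast
  have "D y = D (\<Sum>b\<in>Basis. (y \<bullet> b) *\<^sub>R b)" by (simp add: euclidean_representation)
  also have "\<dots> = (\<Sum>b\<in>Basis. D b * (b \<bullet> y))"
    using lin by (simp add: linear_sum linear_scale inner_commute mult.commute)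
  finally show "grad \<phi> z \<bullet> y = D y"
    by (simp add: * inner_sum_left)
qed

lemma grad_has_derivative:
  assumes "\<phi> differentiable at z"
  shows "(\<phi> has_derivative (\<lambda>y. grad \<phi> z \<bullet> y)) (at z)"
proof -
  obtain D where D: "(\<phi> has_derivative D) (at z)" using assms by (auto simp: differentiable_def)
  have "D = (\<lambda>y. grad \<phi> z \<bullet> y)" by (rule ext) (simp add: grad_eq(2)[OF D])
  with D show ?thesis by simp
qed

lemma C_k_grad:
  assumes "\<And>k. C_k k \<phi>"
  shows "continuous_on UNIV (grad \<phi>)" and "(\<phi> has_derivative (\<lambda>y. grad \<phi> z \<bullet> y)) (at z)"
proof -
  show "(\<phi> has_derivative (\<lambda>y. grad \<phi> z \<bullet> y)) (at z)"
    using assms[of "Suc 0"] by (intro grad_has_derivative) simp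
  show "continuous_on UNIV (grad \<phi>)"
    unfolding grad_def using assms[of "Suc 0"] by (auto intro!: continuous_intros)
qed

lemma grad_test_support:
  fixes \<psi> :: "'a::euclidean_space \<Rightarrow> real"
  assumes \<psi>: "\<psi> \<in> Cc_infty"
  shows "bounded {z. grad \<psi> z \<noteq> 0}"
proof (rule bounded_subset[OF compact_imp_bounded])
  show "compact (closure {z. \<psi> z \<noteq> 0})" using \<psi> by (simp add: Cc_infty_def)
  show "{z. grad \<psi> z \<noteq> 0} \<subseteq> closure {z. \<psi> z \<noteq> 0}"
  proof
    fix z assume z: "z \<in> {z. grad \<psi> z \<noteq> 0}"
    show "z \<in> closure {z. \<psi> z \<noteq> 0}"
    proof (rule ccontr)
      assume "z \<notin> closure {z. \<psi> z \<noteq> 0}"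
      then have "(\<psi> has_derivative (\<lambda>y. 0)) (at z)"
        by (intro has_derivative_transform_within_open[where f = "\<lambda>y. 0", OF has_derivative_const, of "- closure {z. \<psi> z \<noteq> 0}"])
           (use closure_subset[of "{z. \<psi> z \<noteq> 0}"] in auto)
      from grad_eq(1)[OF this] z show False by simp
    qed
  qed
qed

lemma continuous_bounded_support_bound:
  fixes \<psi> :: "'a::euclidean_space \<Rightarrow> 'b::real_normed_vector"
  assumes "continuous_on UNIV \<psi>" "bounded {z. \<psi> z \<noteq> 0}"
  obtains B where "B \<ge> 0" "\<And>z. norm (\<psi> z) \<le> B"
proof -
  have "compact (\<psi> ` closure {z. \<psi> z \<noteq> 0})"
    using assms by (intro compact_continuous_image continuous_on_subset[OF assms(1)]) (auto simp: compact_closure)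
  then obtain B where B: "\<And>z. z \<in> closure {z. \<psi> z \<noteq> 0} \<Longrightarrow> norm (\<psi> z) \<le> B"
    using compact_imp_bounded[THEN bounded_normE] by (metis imageI)
  have "norm (\<psi> z) \<le> max 0 B" for z
    using B[of z] closure_subset[of "{z. \<psi> z \<noteq> 0}"] by (cases "\<psi> z = 0") (auto simp: le_max_iff_disj)
  then show ?thesis using that[of "max 0 B"] by auto
qed

lemma locally_integrable_bounded:
  fixes u :: "'a::euclidean_space \<Rightarrow> 'b::euclidean_space"
  assumes "u \<in> borel_measurable lebesgue" "\<And>v. norm (u v) \<le> B"
  shows "locally_integrable u"
  unfolding locally_integrable_def set_integrable_def
proof (intro allI impI)
  fix K :: "'a set" assume K: "compact K"
  then have [measurable]: "K \<in> sets lebesgue" and "emeasure lebesgue K < \<infinity>"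
    using lmeasurable_compact[of K] by (auto simp: fmeasurable_def)
  then show "integrable lebesgue (\<lambda>v. indicator K v *\<^sub>R u v)"
    using assms by (intro integrableI_bounded_set[where A = K and B = B]) (auto simp: indicator_def)
qed

lemma locally_integrable_scale:
  fixes u :: "'a::euclidean_space \<Rightarrow> 'b::euclidean_space" and a :: "'a \<Rightarrow> real"
  assumes u: "locally_integrable u" and a: "continuous_on UNIV a"
    and U: "U \<in> borel_measurable lebesgue" and le: "\<And>v. norm (U v) \<le> \<bar>a v\<bar> * norm (u v)"
  shows "locally_integrable (U :: 'a \<Rightarrow> 'c::euclidean_space)"
  unfolding locally_integrable_def
proof (intro allI impI)
  fix K :: "'a set" assume K: "compact K"
  then have "compact (a ` K)" using a by (intro compact_continuous_image continuous_on_subset[OF a]) auto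
  then obtain B where B: "\<And>z. z \<in> K \<Longrightarrow> norm (a z) \<le> B"
    using compact_imp_bounded[THEN bounded_normE] by (metis imageI)
  have [measurable]: "K \<in> sets lebesgue" "u \<in> borel_measurable lebesgue" "U \<in> borel_measurable lebesgue"
    using lmeasurable_compact[OF K] U locally_integrable_measurable[OF u] by (auto simp: fmeasurable_def)
  have "integrable lebesgue (\<lambda>v. B *\<^sub>R (indicator K v *\<^sub>R u v))"
    using u K unfolding locally_integrable_def set_integrable_def by (intro integrable_scaleR_right) auto
  then show "set_integrable lebesgue K U"
    unfolding set_integrable_def
  proof (rule Bochner_Integration.integrable_bound)
    show "AE v in lebesgue. norm (indicator K v *\<^sub>R U v) \<le> norm (B *\<^sub>R (indicator K v *\<^sub>R u v))"
    proof (intro always_eventually allI)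
      fix v show "norm (indicator K v *\<^sub>R U v) \<le> norm (B *\<^sub>R (indicator K v *\<^sub>R u v))"
      proof (cases "v \<in> K")
        case True
        have "norm (U v) \<le> \<bar>a v\<bar> * norm (u v)" by (rule le)
        also have "\<dots> \<le> \<bar>B\<bar> * norm (u v)" using B[OF True] by (intro mult_right_mono) auto
        finally show ?thesis using True by simp
      qed auto
    qed
  qed auto
qed

lemma locally_integrable_diff:
  "locally_integrable u \<Longrightarrow> locally_integrable u' \<Longrightarrow> locally_integrable (\<lambda>v. u v - u' v)"
  unfolding locally_integrable_def by (auto intro: set_integral_diff)

lemma locally_integrable_add:
  "locally_integrable u \<Longrightarrow> locally_integrable u' \<Longrightarrow> locally_integrable (\<lambda>v. u v + u' v)"
  unfolding locally_integrable_def by (auto intro: set_integral_add)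

lemma locally_integrable_cong_AE:
  fixes u :: "'a::euclidean_space \<Rightarrow> 'b::euclidean_space"
  assumes "locally_integrable u" "u' \<in> borel_measurable lebesgue" "AE v in lebesgue. u v = u' v"
  shows "locally_integrable u'"
  unfolding locally_integrable_def set_integrable_def
proof (intro allI impI)
  fix K :: "'a set" assume K: "compact K"
  have [measurable]: "K \<in> sets lebesgue" "u \<in> borel_measurable lebesgue" "u' \<in> borel_measurable lebesgue"
    using lmeasurable_compact[OF K] assms(2) locally_integrable_measurable[OF assms(1)] by (auto simp: fmeasurable_def)
  have "integrable lebesgue (\<lambda>v. indicator K v *\<^sub>R u v)"
    using assms(1) K by (simp add: locally_integrable_def set_integrable_def)
  then show "integrable lebesgue (\<lambda>v. indicator K v *\<^sub>R u' v)"
    by (rule integrable_cong_AE_imp) (use assms(3) in auto)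
qed

lemma has_weak_grad_cong_AE:
  assumes w: "has_weak_grad u G" and m: "u' \<in> borel_measurable lebesgue" "G' \<in> borel_measurable lebesgue"
    and eq: "AE v in lebesgue. u v = u' v" "AE v in lebesgue. G v = G' v"
  shows "has_weak_grad u' G'"
  unfolding has_weak_grad_def
proof (intro conjI ballI)
  have u: "locally_integrable u" and G: "locally_integrable G" using w by (auto simp: has_weak_grad_def)
  note [measurable] = m locally_integrable_measurable[OF u] locally_integrable_measurable[OF G]
  show "locally_integrable u'" "locally_integrable G'"
    using locally_integrable_cong_AE u G m eq by blast+
  fix \<psi> :: "'a \<Rightarrow> real" assume \<psi>: "\<psi> \<in> Cc_infty"
  have [measurable]: "\<psi> \<in> borel_measurable lebesgue" "grad \<psi> \<in> borel_measurable lebesgue"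
    by (intro borel_measurable_lebesgueI borel_measurable_continuous_onI Cc_inftyD(3)[OF \<psi>]
        C_k_grad(1) Cc_inftyD(1)[OF \<psi>])+
  have "(LINT v|lebesgue. u' v *\<^sub>R grad \<psi> v) = (LINT v|lebesgue. u v *\<^sub>R grad \<psi> v)"
    using eq(1) by (intro integral_cong_AE) auto
  also have "\<dots> = - (LINT v|lebesgue. \<psi> v *\<^sub>R G v)" using w \<psi> by (simp add: has_weak_grad_def)
  also have "(LINT v|lebesgue. \<psi> v *\<^sub>R G v) = (LINT v|lebesgue. \<psi> v *\<^sub>R G' v)"
    using eq(2) by (intro integral_cong_AE) auto
  finally show "(LINT v|lebesgue. u' v *\<^sub>R grad \<psi> v) = - (LINT v|lebesgue. \<psi> v *\<^sub>R G' v)" .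
qed

lemma weak_grad_unique:
  assumes "has_weak_grad u G" "has_weak_grad u G'"
  shows "AE v in lebesgue. G v = G' v"
proof -
  have G: "locally_integrable G" "locally_integrable G'" using assms by (auto simp: has_weak_grad_def)
  have "AE v in lebesgue. G v - G' v = 0"
  proof (rule AE_zero_if_test_integrals_zero)
    fix \<psi> :: "'a \<Rightarrow> real" assume \<psi>: "\<psi> \<in> Cc_infty"
    note int = locally_integrable_test[OF _ Cc_inftyD(3)[OF \<psi>] Cc_inftyD(2)[OF \<psi>]]
    have "(LINT v|lebesgue. \<psi> v *\<^sub>R (G v - G' v)) = (LINT v|lebesgue. \<psi> v *\<^sub>R G v) - (LINT v|lebesgue. \<psi> v *\<^sub>R G' v)"
      using int[OF G(1)] int[OF G(2)] by (simp add: scaleR_diff_right)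
    also have "\<dots> = 0" using assms \<psi> by (auto simp: has_weak_grad_def)
    finally show "(LINT v|lebesgue. \<psi> v *\<^sub>R (G v - G' v)) = 0" .
  qed (intro locally_integrable_diff G)
  then show ?thesis by simp
qed

lemma has_weak_grad_weak_grad: "has_weak_grad u G \<Longrightarrow> has_weak_grad u (weak_grad u)"
  unfolding weak_grad_def by (rule someI[of "has_weak_grad u"])

lemma weak_grad_eq_AE: "has_weak_grad u G \<Longrightarrow> AE v in lebesgue. weak_grad u v = G v"
  by (rule weak_grad_unique[OF has_weak_grad_weak_grad])

text \<open>A smooth factor can be moved onto the test function, which yields the Leibniz rule.\<close>

lemma has_weak_grad_smooth_mult:
  fixes u :: "'a::euclidean_space \<Rightarrow> real"
  assumes w: "has_weak_grad u G" and a: "\<And>k. C_k k a"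
  shows "has_weak_grad (\<lambda>v. a v * u v) (\<lambda>v. a v *\<^sub>R G v + u v *\<^sub>R grad a v)"
  unfolding has_weak_grad_def
proof (intro conjI ballI)
  have u: "locally_integrable u" and G: "locally_integrable G" using w by (auto simp: has_weak_grad_def)
  have ca: "continuous_on UNIV a" "continuous_on UNIV (grad a)"
    by (rule C_k_continuous[OF a[of 0]], rule C_k_grad[OF a])
  have [measurable]: "a \<in> borel_measurable lebesgue" "grad a \<in> borel_measurable lebesgue"
    by (intro borel_measurable_lebesgueI borel_measurable_continuous_onI ca)+
  note [measurable] = locally_integrable_measurable[OF u] locally_integrable_measurable[OF G]
  show "locally_integrable (\<lambda>v. a v * u v)"
    by (rule locally_integrable_scale[OF u ca(1)]) (auto simp: abs_mult)
  have ug: "locally_integrable (\<lambda>v. u v *\<^sub>R grad a v)"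
    by (rule locally_integrable_scale[OF u continuous_on_norm[OF ca(2)]]) auto
  have aG: "locally_integrable (\<lambda>v. a v *\<^sub>R G v)"
    by (rule locally_integrable_scale[OF G ca(1)]) auto
  show "locally_integrable (\<lambda>v. a v *\<^sub>R G v + u v *\<^sub>R grad a v)"
    by (rule locally_integrable_add[OF aG ug])
  fix \<psi> :: "'a \<Rightarrow> real" assume \<psi>: "\<psi> \<in> Cc_infty"
  have a\<psi>: "(\<lambda>v. a v * \<psi> v) \<in> Cc_infty" by (rule Cc_infty_mult[OF a \<psi>])
  have gr: "grad (\<lambda>v. a v * \<psi> v) v = a v *\<^sub>R grad \<psi> v + \<psi> v *\<^sub>R grad a v" for v
  proof -
    have "((\<lambda>v. a v * \<psi> v) has_derivative (\<lambda>y. a v * (grad \<psi> v \<bullet> y) + (grad a v \<bullet> y) * \<psi> v)) (at v)"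
      by (rule has_derivative_mult[OF C_k_grad(2)[OF a] C_k_grad(2)[OF Cc_inftyD(1)[OF \<psi>]]])
    note D = grad_eq(2)[OF this]
    have "grad (\<lambda>v. a v * \<psi> v) v \<bullet> y = (a v *\<^sub>R grad \<psi> v + \<psi> v *\<^sub>R grad a v) \<bullet> y" for y
      by (subst D) (simp add: inner_add_left mult.commute)
    then show ?thesis using vector_eq_rdot by blast
  qed
  have i1: "integrable lebesgue (\<lambda>v. \<psi> v *\<^sub>R (a v *\<^sub>R G v))" "integrable lebesgue (\<lambda>v. \<psi> v *\<^sub>R (u v *\<^sub>R grad a v))"
    by (rule locally_integrable_test[OF aG Cc_inftyD(3,2)[OF \<psi>]],
        rule locally_integrable_test[OF ug Cc_inftyD(3,2)[OF \<psi>]])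
  have [measurable]: "grad (\<lambda>v. a v * \<psi> v) \<in> borel_measurable lebesgue"
    by (intro borel_measurable_lebesgueI borel_measurable_continuous_onI C_k_grad(1) Cc_inftyD(1)[OF a\<psi>])
  have i2: "integrable lebesgue (\<lambda>v. u v *\<^sub>R grad (\<lambda>v. a v * \<psi> v) v)"
  proof (rule Bochner_Integration.integrable_bound)
    show "integrable lebesgue (\<lambda>v. norm (grad (\<lambda>v. a v * \<psi> v) v) *\<^sub>R u v)"
      by (rule locally_integrable_test[OF u])
         (auto intro!: continuous_on_norm C_k_grad(1) Cc_inftyD(1)[OF a\<psi>] grad_test_support[OF a\<psi>])
  qed (auto simp: abs_mult)
  have "(LINT v|lebesgue. (a v * u v) *\<^sub>R grad \<psi> v) =
      (LINT v|lebesgue. u v *\<^sub>R grad (\<lambda>v. a v * \<psi> v) v - \<psi> v *\<^sub>R (u v *\<^sub>R grad a v))"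
    by (intro Bochner_Integration.integral_cong refl) (simp only: gr, simp add: algebra_simps)
  also have "\<dots> = - (LINT v|lebesgue. (a v * \<psi> v) *\<^sub>R G v) - (LINT v|lebesgue. \<psi> v *\<^sub>R (u v *\<^sub>R grad a v))"
    using i1 i2 w a\<psi> by (simp add: has_weak_grad_def)
  also have "(LINT v|lebesgue. (a v * \<psi> v) *\<^sub>R G v) = (LINT v|lebesgue. \<psi> v *\<^sub>R (a v *\<^sub>R G v))"
    by (simp add: mult.commute)
  also have "- \<dots> - (LINT v|lebesgue. \<psi> v *\<^sub>R (u v *\<^sub>R grad a v)) =
      - (LINT v|lebesgue. \<psi> v *\<^sub>R (a v *\<^sub>R G v + u v *\<^sub>R grad a v))"
    using i1 by (simp add: scaleR_add_right)
  finally show "(LINT v|lebesgue. (a v * u v) *\<^sub>R grad \<psi> v) =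
      - (LINT v|lebesgue. \<psi> v *\<^sub>R (a v *\<^sub>R G v + u v *\<^sub>R grad a v))" .
qed

text \<open>The gradient of \<open>\<langle>v\<rangle>\<^sup>s\<close> is \<open>s \<langle>v\<rangle>\<^sup>s\<^sup>-\<^sup>2 v\<close>, and so differentiating the weight does not increase
  its order of growth.\<close>

lemma norm_grad_jap_powr:
  fixes v :: "'a::euclidean_space"
  shows "norm (grad (\<lambda>v. jap v powr s) v) \<le> \<bar>s\<bar> * jap v powr s"
proof -
  have pos: "0 < 1 + v \<bullet> v" by (simp add: add_pos_nonneg)
  have eq: "(\<lambda>v :: 'a. jap v powr s) = (\<lambda>v. (1 + v \<bullet> v) powr (s/2))"
    by (auto simp: jap_def power2_norm_eq_inner powr_powr powr_half_sqrt[symmetric])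
  have 1: "((\<lambda>t. t powr (s/2)) has_real_derivative s/2 * (1 + v \<bullet> v) powr (s/2 - 1)) (at (1 + v \<bullet> v))"
    using pos by (rule has_real_derivative_powr)
  have 2: "((\<lambda>v. 1 + v \<bullet> v) has_derivative (\<lambda>y. 2 * (v \<bullet> y))) (at v)"
    by (auto intro!: derivative_eq_intros simp: fun_eq_iff inner_commute)
  have "((\<lambda>v :: 'a. jap v powr s) has_derivative (\<lambda>y. (s * (1 + v \<bullet> v) powr (s/2 - 1)) * (v \<bullet> y))) (at v)"
    using DERIV_compose_FDERIV[where f = "\<lambda>t. t powr (s/2)" and g = "\<lambda>v. 1 + v \<bullet> v", OF 1 2]
    unfolding eq by (simp add: mult_ac)
  note D = grad_eq(2)[OF this]
  have "grad (\<lambda>v. jap v powr s) v \<bullet> y = ((s * (1 + v \<bullet> v) powr (s/2 - 1)) *\<^sub>R v) \<bullet> y" for y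
    by (subst D) simp
  then have "grad (\<lambda>v. jap v powr s) v = (s * (1 + v \<bullet> v) powr (s/2 - 1)) *\<^sub>R v"
    using vector_eq_rdot by blast
  then have "norm (grad (\<lambda>v. jap v powr s) v) = \<bar>s\<bar> * ((1 + v \<bullet> v) powr (s/2 - 1) * norm v)"
    by (simp add: abs_mult)
  also have "(1 + v \<bullet> v) powr (s/2 - 1) * norm v \<le> (1 + v \<bullet> v) powr (s/2 - 1) * (1 + v \<bullet> v)"
  proof (intro mult_left_mono)
    have "2 * norm v \<le> 1 + (norm v)\<^sup>2" using sum_squares_bound[of 1 "norm v"] by simp
    then show "norm v \<le> 1 + v \<bullet> v" using norm_ge_zero[of v]
      unfolding power2_norm_eq_inner by linarith
  qed simp
  also have "\<dots> = jap v powr s"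
    using pos by (simp add: fun_cong[OF eq] powr_diff)
  finally show ?thesis by (simp add: mult_left_mono)
qed

text \<open>The parameter of the segment from \<open>v\<close> to \<open>v + h\<close> is integrated against the uniform
  distribution on the unit interval.\<close>

abbreviation unit_uniform :: "real measure" where
  "unit_uniform \<equiv> uniform_measure lborel {0..1}"

lemma prob_space_unit_uniform: "prob_space unit_uniform"
  by (rule prob_space_uniform_measure) auto

lemma AE_unit_uniform: "AE s in unit_uniform. 0 \<le> s \<and> s \<le> 1"
  by (rule AE_uniform_measureI) auto

lemma integral_unit_uniform:
  fixes F :: "real \<Rightarrow> 'b::{banach, second_countable_topology}"
  assumes "F \<in> borel_measurable borel"
  shows "(LINT s|unit_uniform. F s) = (LINT s|lborel. indicator {0..1} s *\<^sub>R F s)"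
proof -
  have "unit_uniform = density lborel (\<lambda>s. ennreal (indicator {0..1} s))"
    unfolding uniform_measure_def by (intro density_cong) (auto simp: indicator_def divide_ennreal_def)
  then show ?thesis using assms by (simp add: integral_density)
qed

lemma integral_unit_uniform_derivative:
  fixes p :: "real \<Rightarrow> real"
  assumes "\<And>s. (p has_real_derivative p' s) (at s)" "continuous_on UNIV p'"
  shows "(LINT s|unit_uniform. p' s) = p 1 - p 0"
proof -
  have "(LINT s|unit_uniform. p' s) = (LINT s|lborel. p' s * indicator {0..1} s)"
    using borel_measurable_continuous_onI[OF assms(2)]
    by (simp add: integral_unit_uniform mult.commute)
  also have "\<dots> = p 1 - p 0"
    using assms by (intro integral_FTC_Icc_real) (auto simp: continuous_on_eq_continuous_at)
  finally show ?thesis .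
qed

lemma nn_integral_lborel_translate:
  fixes F :: "'a::euclidean_space \<Rightarrow> ennreal"
  assumes "F \<in> borel_measurable borel"
  shows "(\<integral>\<^sup>+v. F (v + c) \<partial>lborel) = (\<integral>\<^sup>+v. F v \<partial>lborel)"
proof -
  have "(\<integral>\<^sup>+v. F v \<partial>lborel) = (\<integral>\<^sup>+v. F v \<partial>distr lborel borel (\<lambda>v. c + v))"
    by (simp only: lborel_distr_plus)
  also have "\<dots> = (\<integral>\<^sup>+v. F (v + c) \<partial>lborel)"
    using assms by (simp add: nn_integral_distr add.commute)
  finally show ?thesis by simp
qed

lemma integral_lborel_translate:
  fixes F :: "'a::euclidean_space \<Rightarrow> 'b::{banach, second_countable_topology}"
  assumes "F \<in> borel_measurable borel"
  shows "(LINT v|lborel. F (v + c)) = (LINT v|lborel. F v)"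
proof -
  have "(LINT v|lborel. F v) = (LINT v|distr lborel borel (\<lambda>v. c + v). F v)"
    by (simp only: lborel_distr_plus)
  also have "\<dots> = (LINT v|lborel. F (v + c))"
    using assms by (simp add: integral_distr add.commute)
  finally show ?thesis by simp
qed

lemma integral_lebesgue_lborel:
  fixes F :: "'a::euclidean_space \<Rightarrow> 'b::{banach, second_countable_topology}"
  assumes "F \<in> borel_measurable borel"
  shows "(LINT v|lebesgue. F v) = (LINT v|lborel. F v)"
  using assms by (intro integral_completion) simp

text \<open>The identity is tested against \<open>\<psi>\<close>. By translation invariance the increment moves onto the
  smooth function \<open>\<psi>\<close>, where it is the integral of a classical derivative along the segment; for
  each parameter of the segment the translate of \<open>\<psi>\<close> is again a test function, and the definition
  of the weak gradient applies to it.\<close>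

lemma weak_grad_segment:
  fixes u :: "'a::euclidean_space \<Rightarrow> real" and G :: "'a \<Rightarrow> 'a"
  assumes w: "has_weak_grad u G"
    and [measurable]: "u \<in> borel_measurable borel" "G \<in> borel_measurable borel"
    and bd: "\<And>v. \<bar>u v\<bar> \<le> M" "\<And>v. norm (G v) \<le> M"
  shows "AE v in lborel. u (v + h) - u v = (LINT s|unit_uniform. h \<bullet> G (v + s *\<^sub>R h))"
proof -
  interpret U: prob_space unit_uniform by (rule prob_space_unit_uniform)
  interpret P: pair_sigma_finite "lborel :: 'a measure" unit_uniform ..
  have M: "M \<ge> 0" using bd(1)[of 0] by linarith
  define D where "D v = u (v + h) - u v - (LINT s|unit_uniform. h \<bullet> G (v + s *\<^sub>R h))" for v
  have hG: "\<bar>h \<bullet> G v\<bar> \<le> norm h * M" for v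
    using Cauchy_Schwarz_ineq2[of h "G v"] bd(2)[of v] by (meson mult_left_mono norm_ge_zero order_trans)
  have Im[measurable]: "(\<lambda>v. LINT s|unit_uniform. h \<bullet> G (v + s *\<^sub>R h)) \<in> borel_measurable borel"
    by measurable
  have Ib: "\<bar>LINT s|unit_uniform. h \<bullet> G (v + s *\<^sub>R h)\<bar> \<le> norm h * M" for v
  proof -
    have "norm (LINT s|unit_uniform. h \<bullet> G (v + s *\<^sub>R h)) \<le> (LINT s|unit_uniform. norm (h \<bullet> G (v + s *\<^sub>R h)))"
      by (rule integral_norm_bound)
    also have "\<dots> \<le> (LINT s|unit_uniform. norm h * M)"
      using hG by (intro integral_mono) (auto intro!: U.integrable_const_bound[where B = "norm h * M"])
    finally show ?thesis by (simp add: U.prob_space)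
  qed
  have Dm[measurable]: "D \<in> borel_measurable borel" unfolding D_def by measurable
  have Db: "\<bar>D v\<bar> \<le> M + M + norm h * M" for v
    unfolding D_def using bd(1)[of v] bd(1)[of "v + h"] Ib[of v] by linarith
  have loc: "locally_integrable D"
    by (rule locally_integrable_bounded[OF borel_measurable_lebesgueI[OF Dm]]) (unfold real_norm_def, rule Db)
  have "AE v in lebesgue. D v = 0"
  proof (rule AE_zero_if_test_integrals_zero[OF loc])
    fix \<psi> :: "'a \<Rightarrow> real" assume \<psi>: "\<psi> \<in> Cc_infty"
    have c\<psi>: "continuous_on UNIV \<psi>" "continuous_on UNIV (grad \<psi>)"
      by (rule Cc_inftyD[OF \<psi>], rule C_k_grad(1)[OF Cc_inftyD(1)[OF \<psi>]])
    have [measurable]: "\<psi> \<in> borel_measurable borel" "grad \<psi> \<in> borel_measurable borel"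
      by (intro borel_measurable_continuous_onI c\<psi>)+
    obtain B where B: "B \<ge> 0" "\<And>z. norm (\<psi> z) \<le> B"
      using continuous_bounded_support_bound[OF c\<psi>(1) Cc_inftyD(2)[OF \<psi>]] by blast
    obtain B' where B': "B' \<ge> 0" "\<And>z. norm (grad \<psi> z) \<le> B'"
      using continuous_bounded_support_bound[OF c\<psi>(2) grad_test_support[OF \<psi>]] by blast
    obtain R where R: "\<And>z. \<psi> z \<noteq> 0 \<Longrightarrow> norm z \<le> R" "\<And>z. grad \<psi> z \<noteq> 0 \<Longrightarrow> norm z \<le> R"
    proof -
      have "bounded ({z. \<psi> z \<noteq> 0} \<union> {z. grad \<psi> z \<noteq> 0})"
        using Cc_inftyD(2)[OF \<psi>] grad_test_support[OF \<psi>] by simp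
      then obtain R where "\<And>z. z \<in> {z. \<psi> z \<noteq> 0} \<union> {z. grad \<psi> z \<noteq> 0} \<Longrightarrow> norm z \<le> R"
        unfolding bounded_iff by blast
      then show ?thesis using that[of R] by blast
    qed
    \<comment> \<open>Everything below is bounded and supported in a fixed ball.\<close>
    have int_prod: "integrable (lborel \<Otimes>\<^sub>M unit_uniform) F"
      if [measurable]: "F \<in> borel_measurable (borel \<Otimes>\<^sub>M borel)" and
        F: "\<And>v s. norm (F (v, s)) \<le> C" and
        F0: "\<And>v s. 0 \<le> s \<Longrightarrow> s \<le> 1 \<Longrightarrow> norm v > R + norm h \<Longrightarrow> F (v, s) = 0" for F :: "'a \<times> real \<Rightarrow> real" and C
    proof (rule integrableI_bounded_set[where A = "cball (0::'a) (R + norm h) \<times> UNIV" and B = C])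
      show "cball (0::'a) (R + norm h) \<times> UNIV \<in> sets (lborel \<Otimes>\<^sub>M unit_uniform)" by simp
      show "F \<in> borel_measurable (lborel \<Otimes>\<^sub>M unit_uniform)" by measurable
      show "emeasure (lborel \<Otimes>\<^sub>M unit_uniform) (cball (0::'a) (R + norm h) \<times> UNIV) < \<infinity>"
        using U.emeasure_space_1 emeasure_lborel_cball_finite[of "0::'a" "R + norm h"]
        by (simp add: U.emeasure_pair_measure_Times)
      show "AE x in lborel \<Otimes>\<^sub>M unit_uniform. x \<in> cball (0::'a) (R + norm h) \<times> UNIV \<longrightarrow> norm (F x) \<le> C"
        using F by auto
      have "AE x in (lborel :: 'a measure) \<Otimes>\<^sub>M unit_uniform. 0 \<le> snd x \<and> snd x \<le> 1"
        by (rule P.AE_pair_measure, measurable) (use AE_unit_uniform in simp)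
      then show "AE x in lborel \<Otimes>\<^sub>M unit_uniform. x \<notin> cball (0::'a) (R + norm h) \<times> UNIV \<longrightarrow> F x = 0"
      proof eventually_elim
        case (elim x)
        then show ?case using F0[of "snd x" "fst x"]
          by (cases x; cases "norm (fst x) \<le> R + norm h") auto
      qed
    qed
    have sh: "norm (s *\<^sub>R h) \<le> norm h" if "0 \<le> s" "s \<le> 1" for s
      using that mult_left_le_one_le[of "norm h" s] by simp
    have far: "R < norm (v - s *\<^sub>R h)" if "0 \<le> s" "s \<le> 1" "norm v > R + norm h" for s v
      using sh[OF that(1,2)] norm_triangle_ineq2[of v "s *\<^sub>R h"] that(3) by linarith
    have i1: "integrable (lborel \<Otimes>\<^sub>M unit_uniform) (\<lambda>(v, s). u v * (h \<bullet> grad \<psi> (v - s *\<^sub>R h)))"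
    proof (rule int_prod[of _ "M * (norm h * B')"])
      show "norm (case (v, s) of (v, s) \<Rightarrow> u v * (h \<bullet> grad \<psi> (v - s *\<^sub>R h))) \<le> M * (norm h * B')" for v s
      proof -
        have "\<bar>h \<bullet> grad \<psi> (v - s *\<^sub>R h)\<bar> \<le> norm h * B'"
          using Cauchy_Schwarz_ineq2[of h "grad \<psi> (v - s *\<^sub>R h)"] B'(2)[of "v - s *\<^sub>R h"]
          by (meson mult_left_mono norm_ge_zero order_trans)
        then show ?thesis using bd(1)[of v] M by (auto simp: abs_mult intro!: mult_mono)
      qed
      show "(case (v, s) of (v, s) \<Rightarrow> u v * (h \<bullet> grad \<psi> (v - s *\<^sub>R h))) = 0"
        if "0 \<le> s" "s \<le> 1" "norm v > R + norm h" for v s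
        using far[OF that] R(2)[of "v - s *\<^sub>R h"] by (cases "grad \<psi> (v - s *\<^sub>R h) = 0") auto
    qed measurable
    have i2: "integrable (lborel \<Otimes>\<^sub>M unit_uniform) (\<lambda>(v, s). \<psi> v * (h \<bullet> G (v + s *\<^sub>R h)))"
    proof (rule int_prod[of _ "B * (norm h * M)"])
      show "norm (case (v, s) of (v, s) \<Rightarrow> \<psi> v * (h \<bullet> G (v + s *\<^sub>R h))) \<le> B * (norm h * M)" for v s
        using hG[of "v + s *\<^sub>R h"] B(1) B(2)[of v] by (auto simp: abs_mult intro!: mult_mono)
      show "(case (v, s) of (v, s) \<Rightarrow> \<psi> v * (h \<bullet> G (v + s *\<^sub>R h))) = 0"
        if "0 \<le> s" "s \<le> 1" "norm v > R + norm h" for v s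
        using that(3) R(1)[of v] norm_ge_zero[of h] by (cases "\<psi> v = 0") auto
    qed measurable
    have test: "integrable lborel (\<lambda>v. \<psi> v * F v)" "integrable lborel (\<lambda>v. \<psi> (v - a) * F v)"
      if [measurable]: "F \<in> borel_measurable borel" and "\<And>v. \<bar>F v\<bar> \<le> C" for F :: "'a \<Rightarrow> real" and a C
    proof -
      have "locally_integrable F"
        using that by (intro locally_integrable_bounded[where B = C]) (auto intro: borel_measurable_lebesgueI)
      from locally_integrable_test[OF this Cc_inftyD(3,2)[OF \<psi>]]
        locally_integrable_test[OF this Cc_inftyD(3,2)[OF Cc_infty_translate[OF \<psi>]], of a]
      show "integrable lborel (\<lambda>v. \<psi> v * F v)" "integrable lborel (\<lambda>v. \<psi> (v - a) * F v)"
        by (simp_all add: integrable_completion)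
    qed
    have *: "(LINT v|lborel. u v * (h \<bullet> grad \<psi> (v - s *\<^sub>R h))) = - (LINT v|lborel. \<psi> v * (h \<bullet> G (v + s *\<^sub>R h)))" for s
    proof -
      let ?\<psi> = "\<lambda>v. \<psi> (v - s *\<^sub>R h)"
      have ts: "?\<psi> \<in> Cc_infty" by (rule Cc_infty_translate[OF \<psi>])
      have gr: "grad ?\<psi> v = grad \<psi> (v - s *\<^sub>R h)" for v
      proof -
        have "(?\<psi> has_derivative (\<lambda>y. grad \<psi> (v - s *\<^sub>R h) \<bullet> y)) (at v)"
          by (rule has_derivative_compose[OF _ C_k_grad(2)[OF Cc_inftyD(1)[OF \<psi>]]])
             (auto intro!: derivative_eq_intros)
        note D = grad_eq(2)[OF this]
        then show ?thesis using vector_eq_rdot by blast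
      qed
      have locu: "locally_integrable u" "locally_integrable G" using w by (auto simp: has_weak_grad_def)
      have iu: "integrable lborel (\<lambda>v. u v *\<^sub>R grad \<psi> (v - s *\<^sub>R h))"
      proof (rule Bochner_Integration.integrable_bound)
        show "integrable lborel (\<lambda>v. norm (grad ?\<psi> v) *\<^sub>R u v)"
          using locally_integrable_test[OF locu(1) continuous_on_norm[OF C_k_grad(1)[OF Cc_inftyD(1)[OF ts]]]]
            grad_test_support[OF ts] borel_measurable_continuous_onI[OF C_k_grad(1)[OF Cc_inftyD(1)[OF ts]]]
          by (simp add: integrable_completion)
      qed (auto simp: gr mult.commute)
      have iG: "integrable lborel (\<lambda>v. \<psi> (v - s *\<^sub>R h) *\<^sub>R G v)"
        using locally_integrable_test[OF locu(2) Cc_inftyD(3,2)[OF ts]] by (simp add: integrable_completion)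
      have "(LINT v|lborel. u v * (h \<bullet> grad \<psi> (v - s *\<^sub>R h))) = h \<bullet> (LINT v|lborel. u v *\<^sub>R grad \<psi> (v - s *\<^sub>R h))"
        using iu by (simp flip: integral_inner_right)
      also have "(LINT v|lborel. u v *\<^sub>R grad \<psi> (v - s *\<^sub>R h)) = (LINT v|lebesgue. u v *\<^sub>R grad ?\<psi> v)"
        by (simp add: gr integral_lebesgue_lborel)
      also have "\<dots> = - (LINT v|lebesgue. ?\<psi> v *\<^sub>R G v)" using w ts by (auto simp: has_weak_grad_def)
      also have "(LINT v|lebesgue. ?\<psi> v *\<^sub>R G v) = (LINT v|lborel. ?\<psi> v *\<^sub>R G v)"
        by (simp add: integral_lebesgue_lborel)
      also have "h \<bullet> - \<dots> = - (LINT v|lborel. \<psi> (v - s *\<^sub>R h) * (h \<bullet> G v))"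
        using iG by (simp flip: integral_inner_right)
      also have "(LINT v|lborel. \<psi> (v - s *\<^sub>R h) * (h \<bullet> G v)) = (LINT v|lborel. \<psi> v * (h \<bullet> G (v + s *\<^sub>R h)))"
        by (subst integral_lborel_translate[where c = "s *\<^sub>R h", symmetric]) auto
      finally show ?thesis .
    qed
    have ftc: "\<psi> (v - h) - \<psi> v = - (LINT s|unit_uniform. h \<bullet> grad \<psi> (v - s *\<^sub>R h))" for v
    proof -
      have "(LINT s|unit_uniform. - (h \<bullet> grad \<psi> (v - s *\<^sub>R h))) = \<psi> (v - 1 *\<^sub>R h) - \<psi> (v - 0 *\<^sub>R h)"
      proof (rule integral_unit_uniform_derivative)
        fix s
        have "((\<lambda>s. \<psi> (v - s *\<^sub>R h)) has_derivative (\<lambda>t. grad \<psi> (v - s *\<^sub>R h) \<bullet> (- t *\<^sub>R h))) (at s)"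
          by (rule has_derivative_compose[OF _ C_k_grad(2)[OF Cc_inftyD(1)[OF \<psi>]]])
             (auto intro!: derivative_eq_intros)
        then show "((\<lambda>s. \<psi> (v - s *\<^sub>R h)) has_real_derivative - (h \<bullet> grad \<psi> (v - s *\<^sub>R h))) (at s)"
          by (rule has_derivative_imp_has_field_derivative) (simp add: inner_commute)
        show "continuous_on UNIV (\<lambda>s. - (h \<bullet> grad \<psi> (v - s *\<^sub>R h)))"
          by (intro continuous_intros continuous_on_compose2[OF c\<psi>(2)]) auto
      qed
      then show ?thesis by simp
    qed
    have "(LINT v|lborel. \<psi> v * (u (v + h) - u v)) = (LINT v|lborel. \<psi> v * u (v + h)) - (LINT v|lborel. \<psi> v * u v)"
      using test(1)[of u M] test(1)[of "\<lambda>v. u (v + h)" M] bd by (simp add: right_diff_distrib)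
    also have "(LINT v|lborel. \<psi> v * u (v + h)) = (LINT v|lborel. \<psi> (v - h) * u v)"
      by (subst integral_lborel_translate[where c = h, symmetric]) auto
    also have "\<dots> - (LINT v|lborel. \<psi> v * u v) = (LINT v|lborel. u v * (\<psi> (v - h) - \<psi> v))"
      using test[of u M] bd by (simp add: algebra_simps)
    also have "\<dots> = - (LINT v|lborel. LINT s|unit_uniform. u v * (h \<bullet> grad \<psi> (v - s *\<^sub>R h)))"
      by (simp add: ftc)
    also have "(LINT v|lborel. LINT s|unit_uniform. u v * (h \<bullet> grad \<psi> (v - s *\<^sub>R h))) =
        (LINT s|unit_uniform. LINT v|lborel. u v * (h \<bullet> grad \<psi> (v - s *\<^sub>R h)))"
      by (rule P.Fubini_integral[OF i1, symmetric])
    also have "- \<dots> = (LINT s|unit_uniform. LINT v|lborel. \<psi> v * (h \<bullet> G (v + s *\<^sub>R h)))"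
      by (simp add: *)
    also have "\<dots> = (LINT v|lborel. LINT s|unit_uniform. \<psi> v * (h \<bullet> G (v + s *\<^sub>R h)))"
      by (rule P.Fubini_integral[OF i2])
    also have "\<dots> = (LINT v|lborel. \<psi> v * (LINT s|unit_uniform. h \<bullet> G (v + s *\<^sub>R h)))"
      by simp
    finally have eq: "(LINT v|lborel. \<psi> v * (u (v + h) - u v)) =
        (LINT v|lborel. \<psi> v * (LINT s|unit_uniform. h \<bullet> G (v + s *\<^sub>R h)))" .
    have "(LINT v|lborel. \<psi> v * D v) = (LINT v|lborel. \<psi> v * (u (v + h) - u v)) -
        (LINT v|lborel. \<psi> v * (LINT s|unit_uniform. h \<bullet> G (v + s *\<^sub>R h)))"
    proof -
      have "\<bar>u (v + h) - u v\<bar> \<le> M + M" for v using bd(1)[of v] bd(1)[of "v + h"] by linarith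
      then show ?thesis
        unfolding D_def right_diff_distrib[of _ "_ - _"]
        by (intro Bochner_Integration.integral_diff test(1)[of _ "M + M"] test(1)[OF Im Ib]) auto
    qed
    then show "(LINT v|lebesgue. \<psi> v *\<^sub>R D v) = 0"
      by (simp add: eq integral_lebesgue_lborel)
  qed
  then have "AE v in lborel. D v = 0" by (simp add: AE_completion_iff)
  then show ?thesis by (auto simp: D_def)
qed

section \<open>A moving frame for the collision geometry\<close>

definition reflect :: "'a::real_inner \<Rightarrow> 'a \<Rightarrow> 'a" where
  "reflect u x = x - (2 * (u \<bullet> x) / (u \<bullet> u)) *\<^sub>R u"

lemma orthogonal_transformation_reflect: "orthogonal_transformation (reflect u)"
  unfolding orthogonal_transformation_def
proof (intro conjI allI)
  show "linear (reflect u)"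
    by (auto simp: reflect_def intro!: linearI simp: algebra_simps add_divide_distrib inner_add_right)
  fix v w show "reflect u v \<bullet> reflect u w = v \<bullet> w"
  proof (cases "u = 0")
    case False
    define a b where "a = 2 * (u \<bullet> v) / (u \<bullet> u)" and "b = 2 * (u \<bullet> w) / (u \<bullet> u)"
    have "u \<bullet> u \<noteq> 0" using False by simp
    then have ab: "a * b * (u \<bullet> u) = 2 * (a * (u \<bullet> w))" "b * (u \<bullet> v) = a * (u \<bullet> w)"
      by (simp_all add: a_def b_def)
    have "reflect u v \<bullet> reflect u w = v \<bullet> w - b * (u \<bullet> v) - a * (u \<bullet> w) + a * b * (u \<bullet> u)"
      unfolding reflect_def a_def[symmetric] b_def[symmetric]
      by (simp add: inner_diff_left inner_diff_right inner_commute[of v u] algebra_simps)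
    then show ?thesis using ab by simp
  qed (simp add: reflect_def)
qed

text \<open>The unit vectors orthogonal to a direction are parametrized by those orthogonal to a fixed
  unit vector \<open>e\<close>, through a map that carries \<open>e\<close> to the direction. In most
  dimensions no such map depends continuously on the direction; the reflection along \<open>w + |w| e\<close> is
  singular only at \<open>w = - |w| e\<close>, so one reflection is used on each of the two half spaces. With the signs chosen
  below the map is odd in \<open>w\<close> off the hyperplane orthogonal to \<open>e\<close>, which makes the
  exchange of the two particles act on \<open>w\<close> alone.\<close>

definition frame :: "'a::real_inner \<Rightarrow> 'a \<Rightarrow> 'a \<Rightarrow> 'a" where
  "frame e w q = (if 0 \<le> w \<bullet> e then - reflect (w + norm w *\<^sub>R e) q else reflect (w - norm w *\<^sub>R e) q)"

lemma orthogonal_transformation_frame: "orthogonal_transformation (frame e w)"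
proof (cases "0 \<le> w \<bullet> e")
  case True
  then have "frame e w = (\<lambda>q. - reflect (w + norm w *\<^sub>R e) q)" by (simp add: frame_def fun_eq_iff)
  then show ?thesis by (simp add: orthogonal_transformation_neg orthogonal_transformation_reflect)
next
  case False
  then have "frame e w = reflect (w - norm w *\<^sub>R e)" by (simp add: frame_def fun_eq_iff)
  then show ?thesis by (simp add: orthogonal_transformation_reflect)
qed

lemma norm_frame: "norm (frame e w q) = norm q"
  by (rule orthogonal_transformation_norm[OF orthogonal_transformation_frame])

lemma frame_minus: "w \<bullet> e \<noteq> 0 \<Longrightarrow> frame e (- w) q = - frame e w q"
proof -
  have "reflect (- u) q = reflect u q" for u :: 'a by (simp add: reflect_def)
  from this[of "w + norm w *\<^sub>R e"] this[of "w - norm w *\<^sub>R e"]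
  show "w \<bullet> e \<noteq> 0 \<Longrightarrow> frame e (- w) q = - frame e w q" by (auto simp: frame_def)
qed

lemma frame_scale:
  assumes "c > 0" shows "frame e (c *\<^sub>R w) q = frame e w q"
proof -
  have r: "reflect (c *\<^sub>R u) q = reflect u q" for u using assms by (simp add: reflect_def)
  have "c *\<^sub>R w + norm (c *\<^sub>R w) *\<^sub>R e = c *\<^sub>R (w + norm w *\<^sub>R e)"
    "c *\<^sub>R w - norm (c *\<^sub>R w) *\<^sub>R e = c *\<^sub>R (w - norm w *\<^sub>R e)"
    using assms by (simp_all add: algebra_simps)
  then show ?thesis using assms r by (simp add: frame_def zero_le_mult_iff)
qed

lemma frame_e:
  assumes e: "norm e = 1" and k: "norm k = 1"
  shows "frame e k e = k"
proof -
  have ee: "e \<bullet> e = 1" "k \<bullet> k = 1" using e k by (simp_all add: norm_eq_1)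
  show ?thesis
  proof (cases "0 \<le> k \<bullet> e")
    case True
    have r: "2 * ((k + e) \<bullet> e) / ((k + e) \<bullet> (k + e)) = 1"
      using True ee by (simp add: inner_add_left inner_add_right inner_commute[of e k])
    then have "reflect (k + e) e = e - (k + e)" unfolding reflect_def r by simp
    then show ?thesis using True k by (simp add: frame_def)
  next
    case False
    have r: "2 * ((k - e) \<bullet> e) / ((k - e) \<bullet> (k - e)) = - 1"
      using False ee by (simp add: inner_diff_left inner_diff_right inner_commute[of e k] field_simps)
    then have "reflect (k - e) e = e + (k - e)" unfolding reflect_def r by simp
    then show ?thesis using False k by (simp add: frame_def)
  qed
qed

text \<open>On the half space \<open>w \<bullet> e \<ge> 0\<close> this is \<open>|w|\<close> times the image of the azimuth \<open>q\<close> under the frame. The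
  quotient is bounded by \<open>1\<close> there if \<open>q\<close> is a unit vector, since \<open>|w| \<le> |w| + w \<bullet> e\<close>.\<close>

definition slide :: "'a::real_inner \<Rightarrow> 'a \<Rightarrow> 'a \<Rightarrow> 'a" where
  "slide e q w = ((w \<bullet> q) / (norm w + w \<bullet> e)) *\<^sub>R (w + norm w *\<^sub>R e) - norm w *\<^sub>R q"

lemma norm_scaled_frame:
  assumes e: "norm e = 1" and q: "q \<bullet> e = 0"
  shows "norm w *\<^sub>R frame e w q = (if 0 \<le> w \<bullet> e then slide e q w else - slide (- e) q w)"
proof (cases "w = 0")
  case True
  then show ?thesis by (simp add: slide_def)
next
  case False
  have ee: "e \<bullet> e = 1" using e by (simp add: norm_eq_1)
  have ww: "w \<bullet> w = norm w * norm w" by (metis power2_norm_eq_inner power2_eq_square)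
  have qe: "e \<bullet> q = 0" "q \<bullet> e = 0" using q by (simp_all add: inner_commute)
  have N: "norm w > 0" using False by simp
  have cancel: "2 * x / (2 * n * E) * n = x / E" if "n > 0" "E > 0" for x n E :: real
    using that by (simp add: field_simps)
  show ?thesis
  proof (cases "0 \<le> w \<bullet> e")
    case True
    have D: "norm w + w \<bullet> e > 0" using True N by linarith
    have "(w + norm w *\<^sub>R e) \<bullet> (w + norm w *\<^sub>R e) = 2 * norm w * (norm w + w \<bullet> e)"
      by (simp add: inner_add_left inner_add_right inner_commute[of e w] ee ww algebra_simps)
    moreover have "(w + norm w *\<^sub>R e) \<bullet> q = w \<bullet> q" by (simp add: inner_add_left qe)
    ultimately have "2 * ((w + norm w *\<^sub>R e) \<bullet> q) / ((w + norm w *\<^sub>R e) \<bullet> (w + norm w *\<^sub>R e)) * norm w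
        = (w \<bullet> q) / (norm w + w \<bullet> e)"
      using cancel[OF N D] by (simp only:)
    then show ?thesis using True
      by (simp add: frame_def reflect_def slide_def scaleR_diff_right mult.commute del: scaleR_add_right)
  next
    case False
    have D: "norm w - w \<bullet> e > 0" using False N by linarith
    have "(w - norm w *\<^sub>R e) \<bullet> (w - norm w *\<^sub>R e) = 2 * norm w * (norm w - w \<bullet> e)"
      by (simp add: inner_diff_left inner_diff_right inner_commute[of e w] ee ww algebra_simps)
    moreover have "(w - norm w *\<^sub>R e) \<bullet> q = w \<bullet> q" by (simp add: inner_diff_left qe)
    ultimately have "2 * ((w - norm w *\<^sub>R e) \<bullet> q) / ((w - norm w *\<^sub>R e) \<bullet> (w - norm w *\<^sub>R e)) * norm w
        = (w \<bullet> q) / (norm w - w \<bullet> e)"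
      using cancel[OF N D] by (simp only:)
    then show ?thesis using False
      by (simp add: frame_def reflect_def slide_def scaleR_diff_right mult.commute del: scaleR_add_right)
  qed
qed

text \<open>The quotient \<open>\<alpha>\<close> in \<open>slide\<close> is not Lipschitz at the origin, but \<open>(\<alpha>(w\<^sub>1) - \<alpha>(w\<^sub>2)) |w\<^sub>2|\<close> is
  controlled by \<open>|w\<^sub>1 - w\<^sub>2|\<close>, and the factor next to \<open>\<alpha>\<close> is at most \<open>2 |w|\<close>.\<close>

lemma slide_lipschitz:
  assumes e: "norm e = 1" and q: "norm q = 1" and w: "0 \<le> w1 \<bullet> e" "0 \<le> w2 \<bullet> e"
  shows "norm (slide e q w1 - slide e q w2) \<le> 9 * norm (w1 - w2)"
proof -
  define \<alpha> D z where "\<alpha> w = (w \<bullet> q) / (norm w + w \<bullet> e)" and "D w = norm w + w \<bullet> e"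
    and "z w = w + norm w *\<^sub>R e" for w
  define \<Delta> where "\<Delta> = norm (w1 - w2)"
  have N: "\<bar>norm w1 - norm w2\<bar> \<le> \<Delta>" unfolding \<Delta>_def by (rule norm_triangle_ineq3)
  have D: "norm w \<le> D w" if "0 \<le> w \<bullet> e" for w using that by (simp add: D_def)
  have \<alpha>D: "\<alpha> w * D w = w \<bullet> q" and \<alpha>1: "\<bar>\<alpha> w\<bar> \<le> 1" if "0 \<le> w \<bullet> e" for w
  proof -
    have wq: "\<bar>w \<bullet> q\<bar> \<le> norm w" using Cauchy_Schwarz_ineq2[of w q] q by simp
    show "\<alpha> w * D w = w \<bullet> q"
      using wq D[OF that] by (cases "D w = 0") (auto simp: \<alpha>_def D_def)
    show "\<bar>\<alpha> w\<bar> \<le> 1"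
      using wq D[OF that] norm_ge_zero[of w] by (auto simp: \<alpha>_def D_def[symmetric] divide_le_eq)
  qed
  have zd: "norm (z w1 - z w2) \<le> 2 * \<Delta>"
  proof -
    have "z w1 - z w2 = (w1 - w2) + (norm w1 - norm w2) *\<^sub>R e" by (simp add: z_def algebra_simps)
    then show ?thesis
      using norm_triangle_ineq[of "w1 - w2" "(norm w1 - norm w2) *\<^sub>R e"] N e by (simp add: \<Delta>_def)
  qed
  have zn: "norm (z w) \<le> 2 * norm w" for w
    using norm_triangle_ineq[of w "norm w *\<^sub>R e"] e by (simp add: z_def)
  have Dd: "\<bar>D w1 - D w2\<bar> \<le> 2 * \<Delta>"
  proof -
    have "\<bar>(w1 - w2) \<bullet> e\<bar> \<le> \<Delta>" using Cauchy_Schwarz_ineq2[of "w1 - w2" e] e by (simp add: \<Delta>_def)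
    then show ?thesis using N by (simp add: D_def inner_diff_left)
  qed
  have "(\<alpha> w1 - \<alpha> w2) * D w2 = (w1 - w2) \<bullet> q - \<alpha> w1 * (D w1 - D w2)"
    using \<alpha>D[OF w(1)] \<alpha>D[OF w(2)] by (simp add: algebra_simps inner_diff_left)
  then have "\<bar>\<alpha> w1 - \<alpha> w2\<bar> * \<bar>D w2\<bar> = \<bar>(w1 - w2) \<bullet> q - \<alpha> w1 * (D w1 - D w2)\<bar>"
    by (simp only: abs_mult[symmetric])
  moreover have "\<bar>D w2\<bar> = D w2" using D[OF w(2)] norm_ge_zero[of w2] by linarith
  ultimately have "\<bar>\<alpha> w1 - \<alpha> w2\<bar> * D w2 \<le> \<bar>(w1 - w2) \<bullet> q\<bar> + \<bar>\<alpha> w1\<bar> * \<bar>D w1 - D w2\<bar>"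
    using abs_triangle_ineq4[of "(w1 - w2) \<bullet> q" "\<alpha> w1 * (D w1 - D w2)"] by (simp add: abs_mult)
  also have "\<dots> \<le> \<Delta> + 1 * (2 * \<Delta>)"
    using Cauchy_Schwarz_ineq2[of "w1 - w2" q] q \<alpha>1[OF w(1)] Dd
    by (intro add_mono mult_mono) (auto simp: \<Delta>_def)
  finally have "\<bar>\<alpha> w1 - \<alpha> w2\<bar> * D w2 \<le> 3 * \<Delta>" by simp
  then have ad: "\<bar>\<alpha> w1 - \<alpha> w2\<bar> * norm w2 \<le> 3 * \<Delta>"
    using D[OF w(2)] by (meson abs_ge_zero mult_left_mono order_trans)
  have "slide e q w1 - slide e q w2 =
      \<alpha> w1 *\<^sub>R (z w1 - z w2) + (\<alpha> w1 - \<alpha> w2) *\<^sub>R z w2 - (norm w1 - norm w2) *\<^sub>R q"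
    by (simp add: slide_def \<alpha>_def z_def algebra_simps)
  then have "norm (slide e q w1 - slide e q w2) \<le>
      \<bar>\<alpha> w1\<bar> * norm (z w1 - z w2) + \<bar>\<alpha> w1 - \<alpha> w2\<bar> * norm (z w2) + \<bar>norm w1 - norm w2\<bar>"
    using norm_triangle_ineq4[of "\<alpha> w1 *\<^sub>R (z w1 - z w2) + (\<alpha> w1 - \<alpha> w2) *\<^sub>R z w2" "(norm w1 - norm w2) *\<^sub>R q"]
      norm_triangle_ineq[of "\<alpha> w1 *\<^sub>R (z w1 - z w2)" "(\<alpha> w1 - \<alpha> w2) *\<^sub>R z w2"] q by simp
  also have "\<dots> \<le> 1 * (2 * \<Delta>) + \<bar>\<alpha> w1 - \<alpha> w2\<bar> * (2 * norm w2) + \<Delta>"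
    using \<alpha>1[OF w(1)] zd zn[of w2] N by (intro add_mono mult_mono) auto
  also have "\<dots> = 3 * \<Delta> + 2 * (\<bar>\<alpha> w1 - \<alpha> w2\<bar> * norm w2)" by (simp add: algebra_simps)
  also have "\<dots> \<le> 9 * \<Delta>" using ad by linarith
  finally show ?thesis by (simp add: \<Delta>_def)
qed

text \<open>The velocity change \<open>v' - v\<close> of a collision with relative velocity \<open>w\<close>, deviation angle
  \<open>\<theta>\<close> and azimuth \<open>q\<close>.\<close>

definition dev :: "'a::real_inner \<Rightarrow> real \<Rightarrow> 'a \<Rightarrow> 'a \<Rightarrow> 'a" where
  "dev e \<theta> q w = ((cos \<theta> - 1) / 2) *\<^sub>R w + (sin \<theta> / 2 * norm w) *\<^sub>R frame e w q"

lemma one_minus_cos_bounds: "0 \<le> 1 - cos (\<theta> :: real)" "1 - cos \<theta> \<le> \<theta>\<^sup>2 / 2"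
proof -
  show "0 \<le> 1 - cos \<theta>" by simp
  have "1 - cos \<theta> = 2 * (sin (\<theta> / 2))\<^sup>2" using cos_double_sin[of "\<theta> / 2"] by simp
  also have "(sin (\<theta> / 2))\<^sup>2 \<le> (\<theta> / 2)\<^sup>2"
    using abs_sin_x_le_abs_x[of "\<theta> / 2"] by (metis abs_ge_zero power2_abs power_mono)
  finally show "1 - cos \<theta> \<le> \<theta>\<^sup>2 / 2" by (simp add: power_divide)
qed

lemma one_minus_cos_le: "0 \<le> \<theta> \<Longrightarrow> 1 - cos (\<theta> :: real) \<le> \<theta>"
proof (cases "\<theta> \<le> 2")
  case True
  assume "0 \<le> \<theta>"
  with True have "\<theta>\<^sup>2 \<le> 2 * \<theta>" unfolding power2_eq_square by (rule mult_right_mono)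
  then show ?thesis using one_minus_cos_bounds(2)[of \<theta>] by linarith
next
  case False
  then show ?thesis using cos_ge_minus_one[of \<theta>] by linarith
qed

lemma norm_dev_le:
  assumes "norm q = 1" "0 \<le> \<theta>" shows "norm (dev e \<theta> q w) \<le> \<theta> * norm w"
proof -
  have "norm (dev e \<theta> q w) \<le> \<bar>(cos \<theta> - 1) / 2\<bar> * norm w + \<bar>sin \<theta> / 2\<bar> * norm w"
    unfolding dev_def using norm_triangle_ineq[of "((cos \<theta> - 1) / 2) *\<^sub>R w" "(sin \<theta> / 2 * norm w) *\<^sub>R frame e w q"]
    by (simp add: norm_frame assms abs_mult)
  also have "\<dots> \<le> (\<theta> / 2) * norm w + (\<theta> / 2) * norm w"
    using one_minus_cos_bounds(1)[of \<theta>] one_minus_cos_le[of \<theta>] abs_sin_x_le_abs_x[of \<theta>] assms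
    by (intro add_mono mult_right_mono) auto
  finally show ?thesis by simp
qed

lemma dev_minus: "w \<bullet> e \<noteq> 0 \<Longrightarrow> dev e \<theta> q (- w) = - dev e \<theta> q w"
  by (simp add: dev_def frame_minus)

lemma dev_asymptotics:
  "((\<lambda>\<theta>. dev e \<theta> q w /\<^sub>R \<theta>) \<longlongrightarrow> (norm w / 2) *\<^sub>R frame e w q) (at_right 0)"
proof -
  have "((\<lambda>\<theta> :: real. (cos \<theta> - 1) / \<theta>) \<longlongrightarrow> 0) (at 0)"
    using DERIV_cos[of 0] by (simp add: has_field_derivative_iff)
  then have c: "((\<lambda>\<theta> :: real. (cos \<theta> - 1) / \<theta>) \<longlongrightarrow> 0) (at_right 0)"
    by (rule Lim_at_imp_Lim_at_within)
  have "((\<lambda>\<theta> :: real. sin \<theta> / \<theta>) \<longlongrightarrow> 1) (at 0)"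
    using DERIV_sin[of 0] by (simp add: has_field_derivative_iff)
  then have s: "((\<lambda>\<theta> :: real. sin \<theta> / \<theta>) \<longlongrightarrow> 1) (at_right 0)"
    by (rule Lim_at_imp_Lim_at_within)
  have "((\<lambda>\<theta>. ((cos \<theta> - 1) / \<theta> / 2) *\<^sub>R w + (sin \<theta> / \<theta> / 2 * norm w) *\<^sub>R frame e w q) \<longlongrightarrow>
      (0 / 2) *\<^sub>R w + (1 / 2 * norm w) *\<^sub>R frame e w q) (at_right 0)"
    by (intro tendsto_intros c s) auto
  moreover have "(\<lambda>\<theta>. dev e \<theta> q w /\<^sub>R \<theta>) =
      (\<lambda>\<theta>. ((cos \<theta> - 1) / \<theta> / 2) *\<^sub>R w + (sin \<theta> / \<theta> / 2 * norm w) *\<^sub>R frame e w q)"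
  proof (rule ext)
    fix \<theta>
    have "inverse \<theta> * ((cos \<theta> - 1) / 2) = (cos \<theta> - 1) / \<theta> / 2"
      "inverse \<theta> * (sin \<theta> / 2 * norm w) = sin \<theta> / \<theta> / 2 * norm w"
      by (simp_all add: field_simps)
    then show "dev e \<theta> q w /\<^sub>R \<theta> =
        ((cos \<theta> - 1) / \<theta> / 2) *\<^sub>R w + (sin \<theta> / \<theta> / 2 * norm w) *\<^sub>R frame e w q"
      by (simp only: dev_def scaleR_add_right scaleR_scaleR)
  qed
  ultimately show ?thesis by simp
qed

text \<open>For small angles \<open>w + c dev w\<close> is, on each half space, a perturbation of the identity by a
  map with Lipschitz constant at most \<open>1/2\<close>: the constant \<open>9\<close> of \<open>slide\<close> gives
  \<open>(\<theta>/2) (1 + 9) \<le> 1/4\<close> for \<open>dev\<close>, and \<open>c \<le> 2\<close>. The values \<open>c = 1 + s\<close> with \<open>s\<close> between \<open>0\<close> and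
  \<open>1\<close> occur after shifting along a segment.\<close>

lemma dev_expansion:
  assumes e: "norm e = 1" and q: "norm q = 1" "q \<bullet> e = 0" and c: "0 \<le> c" "c \<le> 2"
    and \<theta>: "0 \<le> \<theta>" "\<theta> \<le> 1 / 20" and same: "0 \<le> w1 \<bullet> e \<longleftrightarrow> 0 \<le> w2 \<bullet> e"
  shows "norm (w1 - w2) \<le> 2 * norm ((w1 + c *\<^sub>R dev e \<theta> q w1) - (w2 + c *\<^sub>R dev e \<theta> q w2))"
proof -
  define \<Delta> where "\<Delta> = norm (w1 - w2)"
  have fr: "norm (norm w1 *\<^sub>R frame e w1 q - norm w2 *\<^sub>R frame e w2 q) \<le> 9 * \<Delta>"
  proof (cases "0 \<le> w1 \<bullet> e")
    case True
    then show ?thesis using same slide_lipschitz[OF e q(1)] by (simp add: norm_scaled_frame[OF e q(2)] \<Delta>_def)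
  next
    case False
    have "norm (slide (- e) q w1 - slide (- e) q w2) \<le> 9 * norm (w1 - w2)"
      using False same e by (intro slide_lipschitz q) auto
    then show ?thesis
      using False same by (simp add: norm_scaled_frame[OF e q(2)] \<Delta>_def norm_minus_commute)
  qed
  have "dev e \<theta> q w1 - dev e \<theta> q w2 = ((cos \<theta> - 1) / 2) *\<^sub>R (w1 - w2) +
      (sin \<theta> / 2) *\<^sub>R (norm w1 *\<^sub>R frame e w1 q - norm w2 *\<^sub>R frame e w2 q)"
    by (simp add: dev_def algebra_simps)
  then have "norm (dev e \<theta> q w1 - dev e \<theta> q w2) \<le> \<bar>(cos \<theta> - 1) / 2\<bar> * \<Delta> +
      \<bar>sin \<theta> / 2\<bar> * norm (norm w1 *\<^sub>R frame e w1 q - norm w2 *\<^sub>R frame e w2 q)"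
    using norm_triangle_ineq[of "((cos \<theta> - 1) / 2) *\<^sub>R (w1 - w2)"
      "(sin \<theta> / 2) *\<^sub>R (norm w1 *\<^sub>R frame e w1 q - norm w2 *\<^sub>R frame e w2 q)"] by (simp add: \<Delta>_def)
  also have "\<dots> \<le> (\<theta> / 2) * \<Delta> + (\<theta> / 2) * (9 * \<Delta>)"
    using one_minus_cos_bounds(1)[of \<theta>] one_minus_cos_le[of \<theta>] abs_sin_x_le_abs_x[of \<theta>] \<theta> fr
    by (intro add_mono mult_mono) (auto simp: \<Delta>_def)
  also have "\<dots> \<le> \<Delta> / 4"
    using \<theta> mult_right_mono[of \<theta> "1/20" \<Delta>] by (simp add: \<Delta>_def)
  finally have dl: "norm (dev e \<theta> q w1 - dev e \<theta> q w2) \<le> \<Delta> / 4" .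
  have "\<Delta> - norm (c *\<^sub>R (dev e \<theta> q w1 - dev e \<theta> q w2)) \<le>
      norm ((w1 - w2) + c *\<^sub>R (dev e \<theta> q w1 - dev e \<theta> q w2))"
    unfolding \<Delta>_def by (rule norm_diff_ineq)
  moreover have "c * norm (dev e \<theta> q w1 - dev e \<theta> q w2) \<le> 2 * (\<Delta> / 4)"
    using c dl by (intro mult_mono) auto
  moreover have eq: "(w1 + c *\<^sub>R dev e \<theta> q w1) - (w2 + c *\<^sub>R dev e \<theta> q w2) =
      (w1 - w2) + c *\<^sub>R (dev e \<theta> q w1 - dev e \<theta> q w2)"
    by (simp add: algebra_simps)
  ultimately show ?thesis
    using c(1) unfolding eq norm_scaleR \<Delta>_def[symmetric] by simp
qed

lemma norm_le_dev:
  assumes q: "norm q = 1" and c: "0 \<le> c" "c \<le> 2" and \<theta>: "0 \<le> \<theta>" "\<theta> \<le> 1 / 20"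
  shows "norm w \<le> 2 * norm (w + c *\<^sub>R dev e \<theta> q w)"
proof -
  have "norm (dev e \<theta> q w) \<le> 1/20 * norm w"
    using norm_dev_le[OF q \<theta>(1), of e w] mult_right_mono[OF \<theta>(2) norm_ge_zero, of w] by linarith
  then have "c * norm (dev e \<theta> q w) \<le> 2 * (1/20 * norm w)"
    using c by (intro mult_mono) auto
  then have "norm (c *\<^sub>R dev e \<theta> q w) \<le> 1/10 * norm w" using c by simp
  then show ?thesis using norm_diff_ineq[of w "c *\<^sub>R dev e \<theta> q w"] norm_ge_zero[of w] by linarith
qed

lemma measurable_reflect[measurable]:
  fixes F :: "'b \<Rightarrow> 'a::euclidean_space"
  assumes [measurable]: "F \<in> borel_measurable M" "H \<in> borel_measurable M"
  shows "(\<lambda>x. reflect (F x) (H x)) \<in> borel_measurable M"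
  unfolding reflect_def by measurable

lemma measurable_frame[measurable]:
  fixes F :: "'b \<Rightarrow> 'a::euclidean_space"
  assumes [measurable]: "F \<in> borel_measurable M" "H \<in> borel_measurable M"
  shows "(\<lambda>x. frame e (F x) (H x)) \<in> borel_measurable M"
  unfolding frame_def by measurable

lemma measurable_dev[measurable]:
  fixes F :: "'b \<Rightarrow> 'a::euclidean_space"
  assumes [measurable]: "\<theta> \<in> borel_measurable M" "F \<in> borel_measurable M" "H \<in> borel_measurable M"
  shows "(\<lambda>x. dev e (\<theta> x) (F x) (H x)) \<in> borel_measurable M"
  unfolding dev_def by measurable

text \<open>The expansion confines the relative velocities that bring \<open>u + w + c dev w\<close> into a ball to a
  set of bounded diameter, whatever \<open>u\<close> is. This gives the growth \<open>\<langle>u\<rangle>\<^sup>r\<close>; the bound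
  \<open>|w| \<le> 2 (|u| + R)\<close> alone would cost an additional factor \<open>\<langle>u\<rangle>\<^sup>d\<close>.\<close>

lemma nn_integral_dev_ball_le:
  assumes R: "R \<ge> 0" and r: "r \<ge> 0"
  shows "\<exists>K\<ge>0. \<forall>(c :: real) \<theta> (u :: 'a::euclidean_space) q e.
    norm e = 1 \<and> norm q = 1 \<and> q \<bullet> e = 0 \<and> 0 \<le> c \<and> c \<le> 2 \<and> 0 \<le> \<theta> \<and> \<theta> \<le> 1/20 \<longrightarrow>
    (\<integral>\<^sup>+w. ennreal (norm w powr r) * indicator (cball 0 R) (u + w + c *\<^sub>R dev e \<theta> q w) \<partial>lborel)
      \<le> ennreal (K * jap u powr r)"
proof -
  define V where "V = unit_ball_vol (real DIM('a)) * (4 * R) ^ DIM('a)"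
  define K where "K = 2 * ((2 * (1 + R)) powr r * V)"
  have V: "V \<ge> 0" using R by (simp add: V_def)
  then have K: "K \<ge> 0" by (simp add: K_def)
  have bound: "(\<integral>\<^sup>+w. ennreal (norm w powr r) * indicator (cball 0 R) (u + w + c *\<^sub>R dev e \<theta> q w) \<partial>lborel)
      \<le> ennreal (K * jap u powr r)"
    if e: "norm e = 1" and q: "norm q = 1" "q \<bullet> e = 0" and c: "0 \<le> c" "c \<le> 2" and \<theta>: "0 \<le> \<theta>" "\<theta> \<le> 1/20"
    for c \<theta> :: real and u q e :: 'a
  proof -
  define \<Psi> where "\<Psi> w = w + c *\<^sub>R dev e \<theta> q w" for w
  have \<Psi>m[measurable]: "\<Psi> \<in> borel_measurable borel" unfolding \<Psi>_def by measurable
  define S where "S b = {w. (0 \<le> w \<bullet> e) = b \<and> u + \<Psi> w \<in> cball 0 R}" for b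
  have Sm[measurable]: "S b \<in> sets borel" for b unfolding S_def mem_cball by measurable
  have ES: "emeasure lborel (S b) \<le> ennreal V" for b
  proof (cases "S b = {}")
    case False
    then obtain w0 where w0: "w0 \<in> S b" by blast
    have "S b \<subseteq> cball w0 (4 * R)"
    proof
      fix w assume w: "w \<in> S b"
      have "norm (w0 - w) \<le> 2 * norm (\<Psi> w0 - \<Psi> w)"
        unfolding \<Psi>_def using w w0 by (intro dev_expansion e q c \<theta>) (auto simp: S_def)
      moreover have "norm (\<Psi> w0 - \<Psi> w) \<le> R + R"
        using norm_triangle_ineq4[of "u + \<Psi> w0" "u + \<Psi> w"] w w0 by (simp add: S_def)
      ultimately show "w \<in> cball w0 (4 * R)" by (simp add: dist_norm)
    qed
    then have "emeasure lborel (S b) \<le> emeasure lborel (cball w0 (4 * R))" by (intro emeasure_mono) auto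
    also have "\<dots> = ennreal V" using R by (simp add: emeasure_cball V_def)
    finally show ?thesis .
  qed simp
  have "(\<integral>\<^sup>+w. ennreal (norm w powr r) * indicator (cball 0 R) (u + w + c *\<^sub>R dev e \<theta> q w) \<partial>lborel)
    \<le> (\<integral>\<^sup>+w. ennreal ((2 * (1 + R) * jap u) powr r) * (indicator (S True) w + indicator (S False) w) \<partial>lborel)"
  proof (rule nn_integral_mono)
    fix w
    show "ennreal (norm w powr r) * indicator (cball 0 R) (u + w + c *\<^sub>R dev e \<theta> q w) \<le>
       ennreal ((2 * (1 + R) * jap u) powr r) * (indicator (S True) w + indicator (S False) w)"
    proof (cases "u + \<Psi> w \<in> cball 0 R")
      case True
      have "norm w \<le> 2 * norm (\<Psi> w)" unfolding \<Psi>_def by (rule norm_le_dev[OF q(1) c \<theta>])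
      also have "norm (\<Psi> w) \<le> norm (u + \<Psi> w) + norm u"
        using norm_triangle_ineq4[of "u + \<Psi> w" u] by simp
      also have "\<dots> \<le> R * jap u + jap u"
        using True jap_ge_norm[of u] mult_left_mono[OF jap_ge_1[of u] R] by simp
      finally have "norm w \<le> 2 * (1 + R) * jap u" by (simp add: algebra_simps)
      then have "norm w powr r \<le> (2 * (1 + R) * jap u) powr r" using r by (intro powr_mono2) auto
      moreover have "indicator (S True) w + indicator (S False) w = (1 :: ennreal)"
        using True by (auto simp: S_def indicator_def)
      ultimately show ?thesis using True by (simp add: \<Psi>_def add.assoc ennreal_leI)
    qed (simp add: \<Psi>_def add.assoc)
  qed
  also have "\<dots> = ennreal ((2 * (1 + R) * jap u) powr r) * (emeasure lborel (S True) + emeasure lborel (S False))"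
    by (simp add: nn_integral_cmult nn_integral_add)
  also have "\<dots> \<le> ennreal ((2 * (1 + R) * jap u) powr r) * (ennreal V + ennreal V)"
    using ES by (intro mult_left_mono add_mono) auto
  also have "\<dots> = ennreal (K * jap u powr r)"
  proof -
    have "(2 * (1 + R) * jap u) powr r = (2 * (1 + R)) powr r * jap u powr r"
      using R jap_ge_1[of u] by (simp add: powr_mult)
    then show ?thesis
      using V by (simp add: K_def ennreal_plus[symmetric] ennreal_mult''[symmetric] mult_ac del: ennreal_plus)
  qed
  finally show ?thesis .
  qed
  show ?thesis using K bound by blast
qed

section \<open>The surface measure on the unit vectors orthogonal to a direction\<close>

abbreviation sph :: "'a::euclidean_space \<Rightarrow> 'a measure" where
  "sph \<equiv> sphere_perp_borel"

lemma sets_sph[simp, measurable_cong]: "sets (sph k) = sets borel"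
  by (simp add: sphere_perp_borel_def)

lemma space_sph[simp]: "space (sph k) = UNIV"
  by (simp add: sphere_perp_borel_def)

text \<open>The surface measure is defined from the Lebesgue measure of cones, which is invariant under
  orthogonal transformations.\<close>

lemma distr_sph:
  fixes T :: "'a::euclidean_space \<Rightarrow> 'a"
  assumes T: "orthogonal_transformation T"
  shows "distr (sph k) borel T = sph (T k)"
proof (rule measure_eqI)
  have [measurable]: "T \<in> borel_measurable borel"
    using orthogonal_transformation_linear[OF T]
    by (intro borel_measurable_continuous_onI linear_continuous_on) (simp add: linear_conv_bounded_linear)
  show "sets (distr (sph k) borel T) = sets (sph (T k))" by simp
  fix A assume "A \<in> sets (distr (sph k) borel T)"
  then have A: "A \<in> sets borel" by simp
  then show "emeasure (distr (sph k) borel T) A = emeasure (sph (T k)) A"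
    using measurable_sets_borel[of T borel A]
    by (simp add: emeasure_distr emeasure_sphere_perp_borel emeasure_cone_set_transfer[OF T])
qed

lemma sph_frame:
  fixes e k :: "'a::euclidean_space"
  assumes "norm e = 1" "norm k = 1"
  shows "sph k = distr (sph e) borel (frame e k)"
  using distr_sph[OF orthogonal_transformation_frame, of e e k] frame_e[OF assms] by simp

lemma emeasure_sph:
  fixes e :: "'a::euclidean_space"
  assumes "e \<in> Basis" "DIM('a) \<ge> 2"
  shows "emeasure (sph e) UNIV = ennreal (sphere_area DIM('a))"
  using emeasure_cone_set_UNIV_Basis[OF assms]
  by (simp add: emeasure_sphere_perp_borel sphere_area_def ennreal_mult' del: of_nat_diff)

lemma finite_measure_sph:
  fixes e :: "'a::euclidean_space"
  assumes "e \<in> Basis" "DIM('a) \<ge> 2"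
  shows "finite_measure (sph e)"
  by (rule finite_measureI) (simp add: emeasure_sph[OF assms])

lemma AE_sph:
  fixes e :: "'a::euclidean_space"
  assumes e: "norm e = 1"
  shows "AE q in sph e. norm q = 1 \<and> q \<bullet> e = 0"
proof -
  have ee: "e \<bullet> e = 1" using e by (simp add: norm_eq_1)
  have "proj_perp e w \<bullet> e = 0" for w :: 'a
    using e ee by (simp add: proj_perp_def inner_diff_left inner_commute[of e w])
  then show ?thesis
    unfolding sphere_perp_borel_def
    by (subst AE_distr_iff) (auto simp: AE_density indicator_def)
qed

lemma measurable_orthogonal_transformation:
  fixes T :: "'a::euclidean_space \<Rightarrow> 'a"
  assumes T: "orthogonal_transformation T"
  shows "T \<in> borel_measurable borel"
  using orthogonal_transformation_linear[OF T]
  by (intro borel_measurable_continuous_onI linear_continuous_on) (simp add: linear_conv_bounded_linear)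

lemma integral_sph_invariant:
  fixes T :: "'a::euclidean_space \<Rightarrow> 'a" and F :: "'a \<Rightarrow> real"
  assumes T: "orthogonal_transformation T" "T e = e" and F: "F \<in> borel_measurable borel"
  shows "(LINT q|sph e. F (T q)) = (LINT q|sph e. F q)"
proof -
  have "(LINT q|sph e. F q) = (LINT q|distr (sph e) borel T. F q)"
    using distr_sph[OF T(1), of e] T(2) by simp
  also have "\<dots> = (LINT q|sph e. F (T q))"
    using F measurable_orthogonal_transformation[OF T(1)] by (intro integral_distr) auto
  finally show ?thesis by simp
qed

text \<open>The second moments of the surface measure. The reflections that fix \<open>e\<close> and change the sign
  of one coordinate, or exchange two coordinates, make the off-diagonal moments vanish and the
  diagonal ones equal; their sum is the total mass.\<close>

lemma sph_second_moment_Basis: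
  fixes e X Y :: "'a::euclidean_space"
  assumes e: "e \<in> Basis" and d: "DIM('a) \<ge> 2"
  shows "(LINT q|sph e. (q \<bullet> X) * (q \<bullet> Y)) = sphere_area DIM('a) / real (DIM('a) - 1) * (X \<bullet> Y - (X \<bullet> e) * (Y \<bullet> e))"
proof -
  interpret finite_measure "sph e" by (rule finite_measure_sph[OF e d])
  let ?B = "Basis - {e}"
  define m where "m i j = (LINT q|sph e. (q \<bullet> i) * (q \<bullet> j))" for i j
  have ne: "norm e = 1" using e by simp
  have int: "integrable (sph e) (\<lambda>q. (q \<bullet> i) * (q \<bullet> j))" for i j
  proof (rule integrable_const_bound[where B = "norm i * norm j"])
    show "AE q in sph e. norm ((q \<bullet> i) * (q \<bullet> j)) \<le> norm i * norm j"
      using AE_sph[OF ne]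
    proof eventually_elim
      case (elim q)
      then show ?case
        using Cauchy_Schwarz_ineq2[of q i] Cauchy_Schwarz_ineq2[of q j]
        by (auto simp: abs_mult intro!: mult_mono)
    qed
  qed measurable
  have off: "m i j = 0" if "i \<in> ?B" "j \<in> Basis" "i \<noteq> j" for i j
  proof -
    have r: "reflect i e = e" "reflect i q \<bullet> i = - (q \<bullet> i)" "reflect i q \<bullet> j = q \<bullet> j" for q
      using that e by (auto simp: reflect_def inner_diff_left inner_Basis inner_commute[of i q])
    have "m i j = (LINT q|sph e. (reflect i q \<bullet> i) * (reflect i q \<bullet> j))"
      unfolding m_def
      by (rule integral_sph_invariant[OF orthogonal_transformation_reflect r(1), symmetric]) measurable
    also have "\<dots> = - m i j" by (simp add: r m_def)
    finally show ?thesis by simp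
  qed
  have diag: "m i i = m j j" if "i \<in> ?B" "j \<in> ?B" for i j
  proof (cases "i = j")
    case False
    have nn: "(i - j) \<bullet> (i - j) = 2" using that False by (simp add: inner_diff_left inner_diff_right inner_Basis)
    have "(i - j) \<bullet> e = 0" using that e by (auto simp: inner_diff_left inner_Basis)
    then have r: "reflect (i - j) e = e" by (simp add: reflect_def)
    have r': "reflect (i - j) q \<bullet> i = q \<bullet> j" for q
    proof -
      have "(i - j) \<bullet> i = 1" using that False by (simp add: inner_diff_left inner_Basis)
      then show ?thesis
        unfolding reflect_def nn by (simp add: inner_diff_left inner_diff_right inner_commute[of _ q] diff_divide_distrib)
    qed
    have "m i i = (LINT q|sph e. (reflect (i - j) q \<bullet> i) * (reflect (i - j) q \<bullet> i))"
      unfolding m_def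
      by (rule integral_sph_invariant[OF orthogonal_transformation_reflect r, symmetric]) measurable
    also have "\<dots> = m j j" by (simp add: r' m_def)
    finally show ?thesis .
  qed simp
  have m_e: "m e j = 0" "m j e = 0" for j
  proof -
    have "AE q in sph e. q \<bullet> e = 0" using AE_sph[OF ne] by eventually_elim simp
    then have "AE q in sph e. (q \<bullet> e) * (q \<bullet> j) = 0" "AE q in sph e. (q \<bullet> j) * (q \<bullet> e) = 0"
      by (auto elim!: eventually_mono)
    then show "m e j = 0" "m j e = 0" unfolding m_def by (auto intro!: integral_eq_zero_AE)
  qed
  define c where "c = sphere_area DIM('a) / real (DIM('a) - 1)"
  have card: "card ?B = DIM('a) - 1" using e by (simp add: card_Diff_subset)
  have "(\<Sum>i\<in>Basis. m i i) = (LINT q|sph e. (\<Sum>i\<in>Basis. (q \<bullet> i) * (q \<bullet> i)))"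
    unfolding m_def by (rule Bochner_Integration.integral_sum[symmetric]) (rule int)
  also have "\<dots> = (LINT q|sph e. 1)"
    using AE_sph[OF ne]
    by (intro integral_cong_AE) (auto simp: euclidean_inner[symmetric] norm_eq_1 elim!: eventually_mono)
  also have "\<dots> = sphere_area DIM('a)"
    using emeasure_sph[OF e d] by (simp add: measure_def sphere_area_def unit_ball_vol_nonneg)
  finally have sum: "(\<Sum>i\<in>?B. m i i) = sphere_area DIM('a)"
    using e by (simp add: sum.remove[of Basis e] m_e)
  have mc: "m i i = c" if "i \<in> ?B" for i
  proof -
    have "(\<Sum>j\<in>?B. m j j) = real (DIM('a) - 1) * m i i"
      using diag[OF _ that] card by simp
    then show ?thesis using sum d by (simp add: c_def field_simps)
  qed
  have mm: "m i j = (if i = j \<and> i \<noteq> e then c else 0)" if "i \<in> Basis" "j \<in> Basis" for i j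
    using that off[of i j] mc[of i] m_e by auto
  have "(q \<bullet> X) * (q \<bullet> Y) = (\<Sum>i\<in>Basis. \<Sum>j\<in>Basis. (X \<bullet> i) * (Y \<bullet> j) * ((q \<bullet> i) * (q \<bullet> j)))" for q
    by (subst (1 2) euclidean_inner) (simp add: sum_product mult_ac)
  then have "(LINT q|sph e. (q \<bullet> X) * (q \<bullet> Y)) = (\<Sum>i\<in>Basis. \<Sum>j\<in>Basis. (X \<bullet> i) * (Y \<bullet> j) * m i j)"
    using int by (simp add: m_def)
  also have "\<dots> = (\<Sum>i\<in>Basis. (X \<bullet> i) * (Y \<bullet> i) * (if i \<noteq> e then c else 0))"
  proof (rule sum.cong[OF refl])
    fix i :: 'a assume i: "i \<in> Basis"
    have "(\<Sum>j\<in>Basis. (X \<bullet> i) * (Y \<bullet> j) * m i j) =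
        (\<Sum>j\<in>Basis. if j = i then (X \<bullet> i) * (Y \<bullet> i) * (if i \<noteq> e then c else 0) else 0)"
      using i by (intro sum.cong refl) (auto simp: mm)
    then show "(\<Sum>j\<in>Basis. (X \<bullet> i) * (Y \<bullet> j) * m i j) = (X \<bullet> i) * (Y \<bullet> i) * (if i \<noteq> e then c else 0)"
      using i by simp
  qed
  also have "\<dots> = (\<Sum>i\<in>?B. (X \<bullet> i) * (Y \<bullet> i)) * c"
    using e by (subst sum.remove[of _ e]) (auto simp: sum_distrib_right intro!: sum.cong)
  also have "(\<Sum>i\<in>?B. (X \<bullet> i) * (Y \<bullet> i)) = X \<bullet> Y - (X \<bullet> e) * (Y \<bullet> e)"
    using e by (subst euclidean_inner[of X Y]) (simp add: sum.remove[of Basis e])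
  finally show ?thesis by (simp add: c_def mult.commute)
qed

text \<open>The frame is orthogonal and carries \<open>e\<close> to the direction of \<open>w\<close>, so it transports the second
  moments from \<open>e\<close> to \<open>w\<close>.\<close>

lemma sph_second_moment:
  fixes e w X Y :: "'a::euclidean_space"
  assumes e: "e \<in> Basis" and d: "DIM('a) \<ge> 2" and w: "w \<noteq> 0"
  shows "(LINT q|sph e. (frame e w q \<bullet> X) * (frame e w q \<bullet> Y)) =
    sphere_area DIM('a) / real (DIM('a) - 1) * (X \<bullet> proj_perp w Y)"
proof -
  define T where "T = frame e w"
  have T: "orthogonal_transformation T" unfolding T_def by (rule orthogonal_transformation_frame)
  have Te: "T e = w /\<^sub>R norm w"
  proof -
    have "T e = frame e (w /\<^sub>R norm w) e" unfolding T_def using w by (intro frame_scale[symmetric]) simp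
    also have "\<dots> = w /\<^sub>R norm w" using e w by (intro frame_e) auto
    finally show ?thesis .
  qed
  obtain X' Y' where XY: "X = T X'" "Y = T Y'"
    using orthogonal_transformation_surj[OF T] by (metis surjD)
  have in_T: "T a \<bullet> T b = a \<bullet> b" for a b using T by (simp add: orthogonal_transformation_def)
  have "(LINT q|sph e. (frame e w q \<bullet> X) * (frame e w q \<bullet> Y)) = (LINT q|sph e. (q \<bullet> X') * (q \<bullet> Y'))"
    by (simp add: T_def[symmetric] XY in_T)
  also have "\<dots> = sphere_area DIM('a) / real (DIM('a) - 1) * (X' \<bullet> Y' - (X' \<bullet> e) * (Y' \<bullet> e))"
    by (rule sph_second_moment_Basis[OF e d])
  also have "X' \<bullet> Y' - (X' \<bullet> e) * (Y' \<bullet> e) = X \<bullet> Y - (X \<bullet> T e) * (Y \<bullet> T e)"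
    by (simp add: XY in_T)
  also have "\<dots> = X \<bullet> proj_perp w Y"
    by (simp add: Te proj_perp_def inner_diff_right inner_commute[of Y w] power2_eq_square divide_inverse mult_ac)
  finally show ?thesis .
qed

text \<open>The collision operators integrate Lebesgue measurable functions over completed measures. The
  next lemmas replace such integrals by Borel integrals of almost everywhere equal functions.\<close>

lemma completion_measurable_AE:
  assumes g: "g \<in> borel_measurable M" and eq: "AE x in M. f x = g x"
  shows "f \<in> borel_measurable (completion M)"
proof (rule measurableI)
  fix A :: "'b set" assume A: "A \<in> sets borel"
  have gA: "g -` A \<inter> space M \<in> sets M" using g A by (rule measurable_sets)
  have "AE x in completion M. x \<in> g -` A \<inter> space M \<longleftrightarrow> x \<in> f -` A \<inter> space M"
    using eq AE_space[of M] by (intro AE_completion) (auto elim!: eventually_elim2)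
  then have "f -` A \<inter> space M \<in> sets (completion M)"
    by (rule completion.in_sets_AE) (use gA in auto)
  then show "f -` A \<inter> space (completion M) \<in> sets (completion M)" by simp
qed auto

lemma integral_completion_AE:
  fixes f g :: "'a \<Rightarrow> 'b::{banach, second_countable_topology}"
  assumes g: "g \<in> borel_measurable M" and eq: "AE x in M. f x = g x"
  shows "(LINT x|completion M. f x) = (LINT x|M. g x)"
proof -
  have "(LINT x|completion M. f x) = (LINT x|completion M. g x)"
    using g eq completion_measurable_AE[OF assms]
    by (intro integral_cong_AE) (auto intro: measurable_completion AE_completion)
  also have "\<dots> = (LINT x|M. g x)" by (rule integral_completion[OF g])
  finally show ?thesis .
qed

lemma AE_sphere_frame:
  fixes e k :: "'a::euclidean_space"
  assumes "norm e = 1" "norm k = 1" and P: "{q. P q} \<in> sets borel"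
  shows "(AE p in sph k. P p) \<longleftrightarrow> (AE q in sph e. P (frame e k q))"
proof -
  show ?thesis
    unfolding sph_frame[OF assms(1,2)] using P by (intro AE_distr_iff) auto
qed

lemma integral_sphere_perp:
  fixes e k :: "'a::euclidean_space" and F :: "'a \<Rightarrow> real"
  assumes e: "norm e = 1" "norm k = 1" and F: "F \<in> borel_measurable borel"
    and eq: "AE p in sph k. F' p = F p"
  shows "(LINT p|sphere_perp k. F' p) = (LINT q|sph e. F (frame e k q))"
proof -
  have "(LINT p|sphere_perp k. F' p) = (LINT p|sph k. F p)"
    unfolding sphere_perp_def using F eq by (intro integral_completion_AE) auto
  also have "\<dots> = (LINT p|distr (sph e) borel (frame e k). F p)" using sph_frame[OF e] by simp
  also have "\<dots> = (LINT q|sph e. F (frame e k q))" using F by (intro integral_distr) auto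
  finally show ?thesis .
qed

section \<open>Dominated convergence with converging bounds\<close>

text \<open>The part of \<open>|f\<^sub>n - F|\<close> below \<open>2 W\<close> is covered by dominated convergence. Since
  \<open>|f\<^sub>n - F| \<le> w\<^sub>n + W\<close>, the part above \<open>2 W\<close> is at most \<open>w\<^sub>n - min w\<^sub>n W\<close>, whose integral tends
  to zero.\<close>

lemma integral_dominated_convergence_converging_bounds:
  fixes f :: "nat \<Rightarrow> 'a \<Rightarrow> real"
  assumes [measurable]: "\<And>n. f n \<in> borel_measurable M" "F \<in> borel_measurable M"
    and w: "\<And>n. integrable M (w n)" "integrable M W" "(\<lambda>n. LINT x|M. w n x) \<longlonglongrightarrow> (LINT x|M. W x)"
    and lim: "AE x in M. (\<lambda>n. f n x) \<longlonglongrightarrow> F x" "AE x in M. (\<lambda>n. w n x) \<longlonglongrightarrow> W x"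
    and bound: "\<And>n. AE x in M. \<bar>f n x\<bar> \<le> w n x"
  shows "integrable M F" and "\<And>n. integrable M (f n)" and "(\<lambda>n. LINT x|M. f n x) \<longlonglongrightarrow> (LINT x|M. F x)"
proof -
  note [measurable] = borel_measurable_integrable[OF w(1)] borel_measurable_integrable[OF w(2)]
  show fi: "integrable M (f n)" for n
    by (rule Bochner_Integration.integrable_bound[OF w(1)[of n]]) (use bound[of n] in \<open>auto elim!: eventually_mono\<close>)
  have ab: "AE x in M. \<forall>n. \<bar>f n x\<bar> \<le> w n x" using bound by (simp add: AE_all_countable)
  have FW: "AE x in M. \<bar>F x\<bar> \<le> W x"
    using lim ab
  proof eventually_elim
    case (elim x)
    then show ?case by (intro LIMSEQ_le[OF tendsto_rabs elim(2)]) auto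
  qed
  show Fi: "integrable M F"
    by (rule Bochner_Integration.integrable_bound[OF w(2)]) (use FW in \<open>auto elim!: eventually_mono\<close>)
  have "(\<lambda>n. LINT x|M. min \<bar>f n x - F x\<bar> (2 * W x)) \<longlonglongrightarrow> (LINT x|M. 0)"
  proof (rule integral_dominated_convergence[where w = "\<lambda>x. 2 * W x"])
    show "AE x in M. (\<lambda>n. min \<bar>f n x - F x\<bar> (2 * W x)) \<longlonglongrightarrow> 0"
      using lim(1) FW
    proof eventually_elim
      case (elim x)
      have "(\<lambda>n. min \<bar>f n x - F x\<bar> (2 * W x)) \<longlonglongrightarrow> min \<bar>F x - F x\<bar> (2 * W x)"
        by (intro tendsto_intros elim)
      then show ?case using elim(2) by simp
    qed
    show "AE x in M. norm (min \<bar>f n x - F x\<bar> (2 * W x)) \<le> 2 * W x" for n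
      using FW by eventually_elim auto
  qed (use w(2) in auto)
  then have l1: "(\<lambda>n. LINT x|M. min \<bar>f n x - F x\<bar> (2 * W x)) \<longlonglongrightarrow> 0" by simp
  have l2: "(\<lambda>n. LINT x|M. min (w n x) (W x)) \<longlonglongrightarrow> (LINT x|M. W x)"
  proof (rule integral_dominated_convergence[where w = W])
    show "AE x in M. (\<lambda>n. min (w n x) (W x)) \<longlonglongrightarrow> W x"
      using lim(2)
    proof eventually_elim
      case (elim x)
      have "(\<lambda>n. min (w n x) (W x)) \<longlonglongrightarrow> min (W x) (W x)" by (intro tendsto_intros elim)
      then show ?case by simp
    qed
    show "AE x in M. norm (min (w n x) (W x)) \<le> W x" for n
      using FW bound[of n] by eventually_elim auto
  qed (use w(2) in auto)
  have mi: "integrable M (\<lambda>x. min (w n x) (W x))" for n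
    using w(1)[of n] w(2) by (rule integrable_min)
  have di: "integrable M (\<lambda>x. \<bar>f n x - F x\<bar>)" for n
    using fi Fi by (intro integrable_abs Bochner_Integration.integrable_diff)
  have di2: "integrable M (\<lambda>x. min \<bar>f n x - F x\<bar> (2 * W x))" for n
    using di w(2) by (intro integrable_min) auto
  have b: "norm ((LINT x|M. f n x) - (LINT x|M. F x)) \<le>
      (LINT x|M. min \<bar>f n x - F x\<bar> (2 * W x)) + ((LINT x|M. w n x) - (LINT x|M. min (w n x) (W x)))" for n
  proof -
    have "norm ((LINT x|M. f n x) - (LINT x|M. F x)) = \<bar>LINT x|M. f n x - F x\<bar>"
      using fi Fi by simp
    also have "\<dots> \<le> (LINT x|M. \<bar>f n x - F x\<bar>)" by (rule integral_abs_bound)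
    also have "\<dots> \<le> (LINT x|M. min \<bar>f n x - F x\<bar> (2 * W x) + (w n x - min (w n x) (W x)))"
    proof (rule integral_mono_AE)
      show "AE x in M. \<bar>f n x - F x\<bar> \<le> min \<bar>f n x - F x\<bar> (2 * W x) + (w n x - min (w n x) (W x))"
        using bound[of n] FW by eventually_elim auto
    qed (use di di2 mi w in auto)
    also have "\<dots> = (LINT x|M. min \<bar>f n x - F x\<bar> (2 * W x)) + ((LINT x|M. w n x) - (LINT x|M. min (w n x) (W x)))"
      using di2 mi w by simp
    finally show ?thesis .
  qed
  have "(\<lambda>n. (LINT x|M. min \<bar>f n x - F x\<bar> (2 * W x)) + ((LINT x|M. w n x) - (LINT x|M. min (w n x) (W x))))
      \<longlonglongrightarrow> 0 + ((LINT x|M. W x) - (LINT x|M. W x))"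
    by (intro tendsto_intros l1 l2 w)
  then have "(\<lambda>n. (LINT x|M. min \<bar>f n x - F x\<bar> (2 * W x)) + ((LINT x|M. w n x) - (LINT x|M. min (w n x) (W x))))
      \<longlonglongrightarrow> 0" by simp
  with always_eventually[OF allI[OF b]] have "(\<lambda>n. (LINT x|M. f n x) - (LINT x|M. F x)) \<longlonglongrightarrow> 0"
    by (rule Lim_null_comparison)
  then show "(\<lambda>n. LINT x|M. f n x) \<longlonglongrightarrow> (LINT x|M. F x)" by (rule LIM_zero_cancel)
qed

section \<open>Changes of variables in phase space\<close>

text \<open>Points of phase space are pairs \<open>\<xi> = (x, v)\<close>; a velocity shift is a translation of \<open>\<xi>\<close>.
  Points of \<open>coll_space Z\<close> are \<open>((z, w), (x, v))\<close> with collision parameters \<open>z\<close> and relative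
  velocity \<open>w\<close>.\<close>

abbreviation shift :: "'a::real_vector \<Rightarrow> 'a \<times> 'a \<Rightarrow> 'a \<times> 'a" where
  "shift c \<xi> \<equiv> \<xi> + (0, c)"

abbreviation coll_space :: "'z measure \<Rightarrow> (('z \<times> 'a) \<times> ('a \<times> 'a::euclidean_space)) measure" where
  "coll_space Z \<equiv> (Z \<Otimes>\<^sub>M lborel) \<Otimes>\<^sub>M lborel"

lemma measurable_fst_snd_euclidean[measurable]:
  "fst \<in> borel_measurable (borel :: ('a::euclidean_space \<times> 'b::euclidean_space) measure)"
  "snd \<in> borel_measurable (borel :: ('a::euclidean_space \<times> 'b::euclidean_space) measure)"
  by (intro borel_measurable_continuous_onI continuous_intros)+

lemma nn_integral_lborel_reflect:
  fixes F :: "'a::euclidean_space \<Rightarrow> ennreal"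
  assumes "F \<in> borel_measurable borel"
  shows "(\<integral>\<^sup>+v. F (- v) \<partial>lborel) = (\<integral>\<^sup>+v. F v \<partial>lborel)"
proof -
  have "orthogonal_transformation (\<lambda>v :: 'a. - v)"
    using orthogonal_transformation_neg[of id] by (simp add: orthogonal_transformation_def linear_id)
  then have "(\<integral>\<^sup>+v. F v \<partial>lborel) = (\<integral>\<^sup>+v. F v \<partial>distr lborel borel uminus)"
    by (subst lborel_distr_orthogonal) auto
  also have "\<dots> = (\<integral>\<^sup>+v. F (- v) \<partial>lborel)" using assms by (intro nn_integral_distr) auto
  finally show ?thesis by simp
qed

lemma nn_integral_lborel_prod:
  fixes F :: "'a::euclidean_space \<times> 'b::euclidean_space \<Rightarrow> ennreal"
  assumes "F \<in> borel_measurable borel"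
  shows "(\<integral>\<^sup>+\<xi>. F \<xi> \<partial>lborel) = (\<integral>\<^sup>+x. \<integral>\<^sup>+v. F (x, v) \<partial>lborel \<partial>lborel)"
  using assms by (simp add: lborel.nn_integral_fst borel_prod lborel_prod)

lemma distr_eqI_nn:
  assumes T[measurable]: "T \<in> measurable M N"
    and eq: "\<And>F. F \<in> borel_measurable N \<Longrightarrow> (\<integral>\<^sup>+x. F (T x) \<partial>M) = (\<integral>\<^sup>+x. F x \<partial>N)"
  shows "distr M N T = N"
proof (rule measure_eqI)
  fix A assume A: "A \<in> sets (distr M N T)"
  then have [measurable]: "A \<in> sets N" by simp
  have "emeasure (distr M N T) A = (\<integral>\<^sup>+x. indicator A x \<partial>distr M N T)" using A by simp
  also have "\<dots> = (\<integral>\<^sup>+x. indicator A (T x) \<partial>M)" by (intro nn_integral_distr) auto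
  also have "\<dots> = (\<integral>\<^sup>+x. indicator A x \<partial>N)" by (rule eq) auto
  finally show "emeasure (distr M N T) A = emeasure N A" by simp
qed simp

lemma distr_shift:
  fixes Y :: "'y measure"
  assumes [measurable]: "c \<in> borel_measurable Y" and "sigma_finite_measure Y"
  shows "distr (Y \<Otimes>\<^sub>M (lborel :: ('a::euclidean_space \<times> 'a) measure)) (Y \<Otimes>\<^sub>M lborel)
     (\<lambda>(y, \<xi>). (y, shift (c y) \<xi>)) = Y \<Otimes>\<^sub>M lborel"
proof (rule distr_eqI_nn)
  interpret Y: sigma_finite_measure Y by fact
  interpret pair_sigma_finite Y "lborel :: ('a \<times> 'a) measure" ..
  show "(\<lambda>(y, \<xi>). (y, shift (c y) \<xi>)) \<in> measurable (Y \<Otimes>\<^sub>M lborel) (Y \<Otimes>\<^sub>M (lborel :: ('a \<times> 'a) measure))"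
    by measurable
  fix F :: "'y \<times> ('a \<times> 'a) \<Rightarrow> ennreal" assume [measurable]: "F \<in> borel_measurable (Y \<Otimes>\<^sub>M (lborel :: ('a \<times> 'a) measure))"
  have "(\<integral>\<^sup>+p. F (case p of (y, \<xi>) \<Rightarrow> (y, shift (c y) \<xi>)) \<partial>(Y \<Otimes>\<^sub>M lborel)) =
      (\<integral>\<^sup>+y. \<integral>\<^sup>+\<xi>. F (y, shift (c y) \<xi>) \<partial>lborel \<partial>Y)"
    by (subst lborel.nn_integral_fst[symmetric]) auto
  also have "\<dots> = (\<integral>\<^sup>+y. \<integral>\<^sup>+\<xi>. F (y, \<xi>) \<partial>lborel \<partial>Y)"
  proof (rule nn_integral_cong)
    fix y assume "y \<in> space Y"
    then have "(\<lambda>\<xi>. F (y, \<xi>)) \<in> borel_measurable borel" by measurable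
    then show "(\<integral>\<^sup>+\<xi>. F (y, shift (c y) \<xi>) \<partial>lborel) = (\<integral>\<^sup>+\<xi>. F (y, \<xi>) \<partial>lborel)"
      by (rule nn_integral_lborel_translate)
  qed
  also have "\<dots> = (\<integral>\<^sup>+p. F p \<partial>(Y \<Otimes>\<^sub>M lborel))"
    by (subst lborel.nn_integral_fst[symmetric]) auto
  finally show "(\<integral>\<^sup>+p. F (case p of (y, \<xi>) \<Rightarrow> (y, shift (c y) \<xi>)) \<partial>(Y \<Otimes>\<^sub>M lborel)) =
      (\<integral>\<^sup>+p. F p \<partial>(Y \<Otimes>\<^sub>M lborel))" .
qed

text \<open>Exchange of the two particles: \<open>v\<close> and \<open>v\<^sub>* = v - w\<close> change places.\<close>

lemma distr_exchange:
  assumes "sigma_finite_measure Z"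
  shows "distr (coll_space Z) (coll_space Z) (\<lambda>((z, w), \<xi>). ((z, - w), shift (- w) \<xi>)) =
    (coll_space Z :: (('z \<times> 'a) \<times> ('a::euclidean_space \<times> 'a)) measure)"
proof (rule distr_eqI_nn)
  interpret Z: sigma_finite_measure Z by fact
  interpret ZW: pair_sigma_finite Z "lborel :: 'a measure" ..
  interpret pair_sigma_finite "Z \<Otimes>\<^sub>M (lborel :: 'a measure)" "lborel :: ('a \<times> 'a) measure" ..
  let ?E = "\<lambda>((z, w), \<xi>). ((z, - w), shift (- w) \<xi>)"
  show E[measurable]: "?E \<in> measurable (coll_space Z) (coll_space Z :: (('z \<times> 'a) \<times> ('a \<times> 'a)) measure)"
    unfolding case_prod_unfold by measurable
  fix F :: "('z \<times> 'a) \<times> ('a \<times> 'a) \<Rightarrow> ennreal" assume [measurable]: "F \<in> borel_measurable (coll_space Z :: (('z \<times> 'a) \<times> ('a \<times> 'a)) measure)"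
  have "(\<integral>\<^sup>+p. F (?E p) \<partial>coll_space Z) = (\<integral>\<^sup>+y. \<integral>\<^sup>+\<xi>. F (?E (y, \<xi>)) \<partial>lborel \<partial>(Z \<Otimes>\<^sub>M lborel))"
    by (rule lborel.nn_integral_fst[symmetric]) measurable
  also have "\<dots> = (\<integral>\<^sup>+z. \<integral>\<^sup>+w. \<integral>\<^sup>+\<xi>. F (?E ((z, w), \<xi>)) \<partial>lborel \<partial>lborel \<partial>Z)"
    by (rule lborel.nn_integral_fst[symmetric]) measurable
  also have "\<dots> = (\<integral>\<^sup>+z. \<integral>\<^sup>+w. \<integral>\<^sup>+\<xi>. F ((z, w), \<xi>) \<partial>lborel \<partial>lborel \<partial>Z)"
  proof (rule nn_integral_cong)
    fix z assume [measurable]: "z \<in> space Z"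
    have "(\<integral>\<^sup>+w. \<integral>\<^sup>+\<xi>. F (?E ((z, w), \<xi>)) \<partial>lborel \<partial>lborel) =
        (\<integral>\<^sup>+w. \<integral>\<^sup>+\<xi>. F ((z, - w), \<xi>) \<partial>lborel \<partial>lborel)"
    proof (rule nn_integral_cong)
      fix w :: 'a
      have "(\<lambda>\<xi>. F ((z, - w), \<xi>)) \<in> borel_measurable borel" by measurable
      from nn_integral_lborel_translate[OF this, of "(0, - w)"]
      show "(\<integral>\<^sup>+\<xi>. F (?E ((z, w), \<xi>)) \<partial>lborel) = (\<integral>\<^sup>+\<xi>. F ((z, - w), \<xi>) \<partial>lborel)" by simp
    qed
    also have "\<dots> = (\<integral>\<^sup>+w. \<integral>\<^sup>+\<xi>. F ((z, w), \<xi>) \<partial>lborel \<partial>lborel)"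
      by (rule nn_integral_lborel_reflect) measurable
    finally show "(\<integral>\<^sup>+w. \<integral>\<^sup>+\<xi>. F (?E ((z, w), \<xi>)) \<partial>lborel \<partial>lborel) =
        (\<integral>\<^sup>+w. \<integral>\<^sup>+\<xi>. F ((z, w), \<xi>) \<partial>lborel \<partial>lborel)" .
  qed
  also have "\<dots> = (\<integral>\<^sup>+y. \<integral>\<^sup>+\<xi>. F (y, \<xi>) \<partial>lborel \<partial>(Z \<Otimes>\<^sub>M lborel))"
    by (rule lborel.nn_integral_fst) measurable
  also have "\<dots> = (\<integral>\<^sup>+p. F p \<partial>coll_space Z)"
    by (rule lborel.nn_integral_fst) measurable
  finally show "(\<integral>\<^sup>+p. F (?E p) \<partial>coll_space Z) = (\<integral>\<^sup>+p. F p \<partial>coll_space Z)" .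
qed

text \<open>The same integrals in the variables \<open>((x, v, v\<^sub>*), z)\<close>.\<close>

lemma distr_relative_velocity:
  assumes "sigma_finite_measure Z"
  shows "distr (lborel \<Otimes>\<^sub>M Z) (coll_space Z) (\<lambda>((x, v, vs), z). ((z, v - vs), (x, v))) =
    (coll_space Z :: (('z \<times> 'a) \<times> ('a::euclidean_space \<times> 'a)) measure)"
proof (rule distr_eqI_nn)
  interpret Z: sigma_finite_measure Z by fact
  interpret ZW: pair_sigma_finite Z "lborel :: 'a measure" ..
  interpret XZ: pair_sigma_finite "lborel :: ('a \<times> 'a \<times> 'a) measure" Z ..
  interpret pair_sigma_finite "Z \<Otimes>\<^sub>M (lborel :: 'a measure)" "lborel :: ('a \<times> 'a) measure" ..
  let ?E = "\<lambda>((x :: 'a, v :: 'a, vs), z). ((z, v - vs), (x, v))"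
  show E[measurable]: "?E \<in> measurable (lborel \<Otimes>\<^sub>M Z) (coll_space Z)"
    unfolding case_prod_unfold by measurable
  fix F :: "('z \<times> 'a) \<times> ('a \<times> 'a) \<Rightarrow> ennreal" assume [measurable]: "F \<in> borel_measurable (coll_space Z :: (('z \<times> 'a) \<times> ('a \<times> 'a)) measure)"
  have "(\<integral>\<^sup>+p. F (?E p) \<partial>(lborel \<Otimes>\<^sub>M Z)) = (\<integral>\<^sup>+z. \<integral>\<^sup>+X. F (?E (X, z)) \<partial>lborel \<partial>Z)"
    by (rule XZ.nn_integral_snd[symmetric]) measurable
  also have "\<dots> = (\<integral>\<^sup>+z. \<integral>\<^sup>+w. \<integral>\<^sup>+\<xi>. F ((z, w), \<xi>) \<partial>lborel \<partial>lborel \<partial>Z)"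
  proof (rule nn_integral_cong)
    fix z assume [measurable]: "z \<in> space Z"
    have "(\<integral>\<^sup>+X. F (?E (X, z)) \<partial>lborel) = (\<integral>\<^sup>+x. \<integral>\<^sup>+vv. F (?E ((x, vv), z)) \<partial>lborel \<partial>lborel)"
      by (rule nn_integral_lborel_prod) measurable
    also have "\<dots> = (\<integral>\<^sup>+x. \<integral>\<^sup>+v. \<integral>\<^sup>+vs. F (?E ((x, v, vs), z)) \<partial>lborel \<partial>lborel \<partial>lborel)"
      by (intro nn_integral_cong nn_integral_lborel_prod) measurable
    also have "\<dots> = (\<integral>\<^sup>+x. \<integral>\<^sup>+v. \<integral>\<^sup>+w. F ((z, w), (x, v)) \<partial>lborel \<partial>lborel \<partial>lborel)"
    proof (rule nn_integral_cong, rule nn_integral_cong)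
      fix x v :: 'a
      have [measurable]: "(\<lambda>w. F ((z, w), (x, v))) \<in> borel_measurable borel" by measurable
      have "(\<integral>\<^sup>+vs. F (?E ((x, v, vs), z)) \<partial>lborel) = (\<integral>\<^sup>+vs. F ((z, - vs + v), (x, v)) \<partial>lborel)" by simp
      also have "\<dots> = (\<integral>\<^sup>+vs. F ((z, vs + v), (x, v)) \<partial>lborel)"
        by (rule nn_integral_lborel_reflect[where F = "\<lambda>u. F ((z, u + v), (x, v))"]) measurable
      also have "\<dots> = (\<integral>\<^sup>+w. F ((z, w), (x, v)) \<partial>lborel)"
        by (rule nn_integral_lborel_translate[where F = "\<lambda>u. F ((z, u), (x, v))"]) measurable
      finally show "(\<integral>\<^sup>+vs. F (?E ((x, v, vs), z)) \<partial>lborel) = (\<integral>\<^sup>+w. F ((z, w), (x, v)) \<partial>lborel)" .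
    qed
    also have "\<dots> = (\<integral>\<^sup>+\<xi>. \<integral>\<^sup>+w. F ((z, w), \<xi>) \<partial>lborel \<partial>lborel)"
      by (rule nn_integral_lborel_prod[symmetric]) measurable
    also have "\<dots> = (\<integral>\<^sup>+w. \<integral>\<^sup>+\<xi>. F ((z, w), \<xi>) \<partial>lborel \<partial>lborel)"
      by (rule lborel_pair.Fubini') measurable
    finally show "(\<integral>\<^sup>+X. F (?E (X, z)) \<partial>lborel) = (\<integral>\<^sup>+w. \<integral>\<^sup>+\<xi>. F ((z, w), \<xi>) \<partial>lborel \<partial>lborel)" .
  qed
  also have "\<dots> = (\<integral>\<^sup>+y. \<integral>\<^sup>+\<xi>. F (y, \<xi>) \<partial>lborel \<partial>(Z \<Otimes>\<^sub>M lborel))"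
    by (rule lborel.nn_integral_fst) measurable
  also have "\<dots> = (\<integral>\<^sup>+p. F p \<partial>coll_space Z)"
    by (rule lborel.nn_integral_fst) measurable
  finally show "(\<integral>\<^sup>+p. F (?E p) \<partial>(lborel \<Otimes>\<^sub>M Z)) = (\<integral>\<^sup>+p. F p \<partial>coll_space Z)" .
qed

lemma integral_coll_space:
  fixes F :: "('z \<times> 'a) \<times> ('a::euclidean_space \<times> 'a) \<Rightarrow> real"
  assumes Z: "sigma_finite_measure Z" and F: "integrable (coll_space Z) F"
  shows "(LINT p|coll_space Z. F p) = (LINT (x, v, vs)|lborel. LINT z|Z. F ((z, v - vs), (x, v)))"
    and "AE (x, v, vs) in lborel. integrable Z (\<lambda>z. F ((z, v - vs), (x, v)))"
    and "(\<lambda>(x, v, vs). LINT z|Z. F ((z, v - vs), (x, v))) \<in> borel_measurable borel"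
proof -
  interpret Z: sigma_finite_measure Z by fact
  interpret XZ: pair_sigma_finite "lborel :: ('a \<times> 'a \<times> 'a) measure" Z ..
  let ?E = "\<lambda>((x :: 'a, v :: 'a, vs), z). ((z, v - vs), (x, v))"
  have E[measurable]: "?E \<in> measurable (lborel \<Otimes>\<^sub>M Z) (coll_space Z)"
    unfolding case_prod_unfold by measurable
  note [measurable] = borel_measurable_integrable[OF F]
  have int: "integrable (lborel \<Otimes>\<^sub>M Z) (\<lambda>p. F (?E p))"
    using F by (subst (asm) distr_relative_velocity[OF Z, symmetric]) (simp add: integrable_distr_eq[OF E])
  have "(LINT p|coll_space Z. F p) = (LINT p|distr (lborel \<Otimes>\<^sub>M Z) (coll_space Z) ?E. F p)"
    by (subst distr_relative_velocity[OF Z]) simp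
  also have "\<dots> = (LINT p|(lborel \<Otimes>\<^sub>M Z). F (?E p))" by (rule integral_distr[OF E]) measurable
  also have "\<dots> = (LINT X|lborel. LINT z|Z. F (?E (X, z)))"
    by (rule XZ.integral_fst'[OF int, symmetric])
  finally show "(LINT p|coll_space Z. F p) = (LINT (x, v, vs)|lborel. LINT z|Z. F ((z, v - vs), (x, v)))"
    by (simp add: case_prod_unfold)
  show "AE (x, v, vs) in lborel. integrable Z (\<lambda>z. F ((z, v - vs), (x, v)))"
    using XZ.AE_integrable_fst'[OF int] by (simp add: case_prod_unfold)
  have "(\<lambda>X. LINT z|Z. F (?E (X, z))) \<in> borel_measurable borel" by measurable
  then show "(\<lambda>(x, v, vs). LINT z|Z. F ((z, v - vs), (x, v))) \<in> borel_measurable borel"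
    by (simp add: case_prod_unfold)
qed

lemma AE_pair_fst:
  assumes "sigma_finite_measure M2" and ae: "AE x in M1. P x"
  shows "AE p in M1 \<Otimes>\<^sub>M M2. P (fst p)"
proof -
  interpret M2: sigma_finite_measure M2 by fact
  obtain N where N: "{x \<in> space M1. \<not> P x} \<subseteq> N" "emeasure M1 N = 0" "N \<in> sets M1"
    using ae by (rule AE_E)
  show ?thesis
  proof (rule AE_I)
    show "emeasure (M1 \<Otimes>\<^sub>M M2) (N \<times> space M2) = 0"
      using N by (simp add: M2.emeasure_pair_measure_Times)
  qed (use N in \<open>auto simp: space_pair_measure\<close>)
qed

lemma AE_pair_snd:
  assumes "sigma_finite_measure M2" and ae: "AE x in M2. P x"
  shows "AE p in M1 \<Otimes>\<^sub>M M2. P (snd p)"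
proof -
  interpret M2: sigma_finite_measure M2 by fact
  obtain N where N: "{x \<in> space M2. \<not> P x} \<subseteq> N" "emeasure M2 N = 0" "N \<in> sets M2"
    using ae by (rule AE_E)
  show ?thesis
  proof (rule AE_I)
    show "emeasure (M1 \<Otimes>\<^sub>M M2) (space M1 \<times> N) = 0"
      using N by (simp add: M2.emeasure_pair_measure_Times)
  qed (use N in \<open>auto simp: space_pair_measure\<close>)
qed

lemma integral_limit_of_nn_integral:
  fixes f :: "nat \<Rightarrow> 'a \<Rightarrow> real"
  assumes m: "\<And>n. f n \<in> borel_measurable M" "F \<in> borel_measurable M"
    and nn: "\<And>n x. 0 \<le> f n x" "\<And>x. 0 \<le> F x"
    and fin: "\<And>n. (\<integral>\<^sup>+x. ennreal (f n x) \<partial>M) < \<infinity>" "(\<integral>\<^sup>+x. ennreal (F x) \<partial>M) < \<infinity>"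
    and lim: "(\<lambda>n. \<integral>\<^sup>+x. ennreal (f n x) \<partial>M) \<longlonglongrightarrow> (\<integral>\<^sup>+x. ennreal (F x) \<partial>M)"
  shows "integrable M (f n)" "integrable M F" "(\<lambda>n. LINT x|M. f n x) \<longlonglongrightarrow> (LINT x|M. F x)"
proof -
  show "integrable M (f n)" for n using m nn fin by (intro integrableI_nonneg) auto
  show "integrable M F" using m nn fin by (intro integrableI_nonneg) auto
  have "(\<lambda>n. enn2real (\<integral>\<^sup>+x. ennreal (f n x) \<partial>M)) \<longlonglongrightarrow> enn2real (\<integral>\<^sup>+x. ennreal (F x) \<partial>M)"
    using fin lim by (intro tendsto_enn2real) (auto simp: less_top)
  then show "(\<lambda>n. LINT x|M. f n x) \<longlonglongrightarrow> (LINT x|M. F x)"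
    using m nn by (simp add: integral_eq_nn_integral)
qed

lemma distr_coll_space_assoc:
  assumes "sigma_finite_measure Y" "sigma_finite_measure Z"
  shows "distr (Y \<Otimes>\<^sub>M coll_space Z) (coll_space (Y \<Otimes>\<^sub>M Z)) (\<lambda>(s, ((z, w), \<xi>)). (((s, z), w), \<xi>)) =
    (coll_space (Y \<Otimes>\<^sub>M Z) :: ((('y \<times> 'z) \<times> 'a) \<times> ('a::euclidean_space \<times> 'a)) measure)"
proof (rule distr_eqI_nn)
  interpret Y: sigma_finite_measure Y by fact
  interpret Z: sigma_finite_measure Z by fact
  interpret YZ: pair_sigma_finite Y Z ..
  interpret ZW: pair_sigma_finite Z "lborel :: 'a measure" ..
  interpret C: pair_sigma_finite "Z \<Otimes>\<^sub>M (lborel :: 'a measure)" "lborel :: ('a \<times> 'a) measure" ..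
  let ?E = "\<lambda>(s, ((z, w :: 'a), \<xi> :: 'a \<times> 'a)). (((s, z), w), \<xi>)"
  show E[measurable]: "?E \<in> measurable (Y \<Otimes>\<^sub>M coll_space Z) (coll_space (Y \<Otimes>\<^sub>M Z))"
    unfolding case_prod_unfold by measurable
  fix F :: "(('y \<times> 'z) \<times> 'a) \<times> ('a \<times> 'a) \<Rightarrow> ennreal"
  assume [measurable]: "F \<in> borel_measurable (coll_space (Y \<Otimes>\<^sub>M Z))"
  have "(\<integral>\<^sup>+p. F (?E p) \<partial>(Y \<Otimes>\<^sub>M coll_space Z)) = (\<integral>\<^sup>+s. \<integral>\<^sup>+p. F (?E (s, p)) \<partial>coll_space Z \<partial>Y)"
    by (rule C.nn_integral_fst[symmetric]) measurable
  also have "\<dots> = (\<integral>\<^sup>+s. \<integral>\<^sup>+y. \<integral>\<^sup>+\<xi>. F (?E (s, (y, \<xi>))) \<partial>lborel \<partial>(Z \<Otimes>\<^sub>M lborel) \<partial>Y)"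
    by (rule nn_integral_cong, rule lborel.nn_integral_fst[symmetric]) measurable
  also have "\<dots> = (\<integral>\<^sup>+s. \<integral>\<^sup>+z. \<integral>\<^sup>+w. \<integral>\<^sup>+\<xi>. F (?E (s, ((z, w), \<xi>))) \<partial>lborel \<partial>lborel \<partial>Z \<partial>Y)"
    by (rule nn_integral_cong, rule lborel.nn_integral_fst[symmetric]) measurable
  also have "\<dots> = (\<integral>\<^sup>+s. \<integral>\<^sup>+z. \<integral>\<^sup>+w. \<integral>\<^sup>+\<xi>. F (((s, z), w), \<xi>) \<partial>lborel \<partial>lborel \<partial>Z \<partial>Y)"
    by simp
  also have "\<dots> = (\<integral>\<^sup>+x. \<integral>\<^sup>+w. \<integral>\<^sup>+\<xi>. F ((x, w), \<xi>) \<partial>lborel \<partial>lborel \<partial>(Y \<Otimes>\<^sub>M Z))"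
    by (rule Z.nn_integral_fst) measurable
  also have "\<dots> = (\<integral>\<^sup>+y. \<integral>\<^sup>+\<xi>. F (y, \<xi>) \<partial>lborel \<partial>((Y \<Otimes>\<^sub>M Z) \<Otimes>\<^sub>M lborel))"
    by (rule lborel.nn_integral_fst) measurable
  also have "\<dots> = (\<integral>\<^sup>+p. F p \<partial>coll_space (Y \<Otimes>\<^sub>M Z))"
    by (rule lborel.nn_integral_fst) measurable
  finally show "(\<integral>\<^sup>+p. F (?E p) \<partial>(Y \<Otimes>\<^sub>M coll_space Z)) = (\<integral>\<^sup>+p. F p \<partial>coll_space (Y \<Otimes>\<^sub>M Z))" .
qed

text \<open>The weights are confined in \<open>w\<close> for each fixed point of phase space, which calls for the
  integration over \<open>w\<close> to come first.\<close>

lemma nn_integral_coll_space_w_last: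
  fixes F :: "('z \<times> 'a) \<times> ('a::euclidean_space \<times> 'a) \<Rightarrow> ennreal"
  assumes [measurable]: "F \<in> borel_measurable (coll_space Z)"
  shows "(\<integral>\<^sup>+p. F p \<partial>coll_space Z) = (\<integral>\<^sup>+(z, \<xi>). \<integral>\<^sup>+w. F ((z, w), \<xi>) \<partial>lborel \<partial>(Z \<Otimes>\<^sub>M lborel))"
proof -
  have "(\<integral>\<^sup>+p. F p \<partial>coll_space Z) = (\<integral>\<^sup>+y. \<integral>\<^sup>+\<xi>. F (y, \<xi>) \<partial>lborel \<partial>(Z \<Otimes>\<^sub>M lborel))"
    by (rule lborel.nn_integral_fst[symmetric]) measurable
  also have "\<dots> = (\<integral>\<^sup>+z. \<integral>\<^sup>+w. \<integral>\<^sup>+\<xi>. F ((z, w), \<xi>) \<partial>lborel \<partial>lborel \<partial>Z)"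
    by (rule lborel.nn_integral_fst[symmetric]) measurable
  also have "\<dots> = (\<integral>\<^sup>+z. \<integral>\<^sup>+\<xi>. \<integral>\<^sup>+w. F ((z, w), \<xi>) \<partial>lborel \<partial>lborel \<partial>Z)"
    by (rule nn_integral_cong, rule lborel_pair.Fubini') measurable
  also have "\<dots> = (\<integral>\<^sup>+z. \<integral>\<^sup>+\<xi>. (case (z, \<xi>) of (z, \<xi>) \<Rightarrow> \<integral>\<^sup>+w. F ((z, w), \<xi>) \<partial>lborel) \<partial>lborel \<partial>Z)"
    by simp
  also have "\<dots> = (\<integral>\<^sup>+(z, \<xi>). \<integral>\<^sup>+w. F ((z, w), \<xi>) \<partial>lborel \<partial>(Z \<Otimes>\<^sub>M lborel))"
    by (rule lborel.nn_integral_fst) measurable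
  finally show ?thesis .
qed

section \<open>Grazing collisions\<close>

text \<open>A sequence of collision angles \<open>\<theta>\<^sub>n(z)\<close> tending to zero, with azimuth \<open>q(z)\<close>, on a space of
  collision parameters of finite measure. Up to the angle \<open>1/20\<close> the expansion estimate for \<open>dev\<close>
  holds.\<close>

locale grazing = finite_measure Z for Z :: "'z measure" +
  fixes e :: "'a::euclidean_space" and \<theta> :: "nat \<Rightarrow> 'z \<Rightarrow> real" and q :: "'z \<Rightarrow> 'a"
  assumes e: "norm e = 1"
    and \<theta>_measurable[measurable]: "\<And>n. \<theta> n \<in> borel_measurable Z"
    and q_measurable[measurable]: "q \<in> borel_measurable Z"
    and AE_q: "AE z in Z. norm (q z) = 1 \<and> q z \<bullet> e = 0"
    and AE_\<theta>: "AE z in Z. \<forall>n. 0 < \<theta> n z \<and> \<theta> n z \<le> 1 / 20"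
    and \<theta>_lim: "AE z in Z. (\<lambda>n. \<theta> n z) \<longlonglongrightarrow> 0"
begin

abbreviation h :: "nat \<Rightarrow> 'z \<Rightarrow> 'a \<Rightarrow> 'a" where
  "h n z w \<equiv> dev e (\<theta> n z) (q z) w"

text \<open>The space of collision parameters extended by the parameter of a segment.\<close>

abbreviation Z' :: "(real \<times> 'z) measure" where
  "Z' \<equiv> unit_uniform \<Otimes>\<^sub>M Z"

sublocale U: prob_space unit_uniform by (rule prob_space_unit_uniform)
sublocale UZ: pair_sigma_finite unit_uniform Z ..
sublocale Z': finite_measure Z'
  by (rule finite_measureI)
     (simp add: space_pair_measure emeasure_pair_measure_Times ennreal_mult_eq_top_iff U.emeasure_space_1[simplified])

lemma sigma_finite_Z: "sigma_finite_measure Z" and sigma_finite_Z': "sigma_finite_measure Z'"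
  by unfold_locales

definition good :: "'z \<Rightarrow> bool" where
  "good z \<longleftrightarrow> norm (q z) = 1 \<and> q z \<bullet> e = 0 \<and> (\<forall>n. 0 < \<theta> n z \<and> \<theta> n z \<le> 1 / 20) \<and> (\<lambda>n. \<theta> n z) \<longlonglongrightarrow> 0"

lemma AE_good: "AE z in Z. good z"
  using AE_q AE_\<theta> \<theta>_lim by eventually_elim (auto simp: good_def)

lemma AE_Z': "AE z in Z'. 0 \<le> fst z \<and> fst z \<le> 1 \<and> good (snd z)"
  using AE_pair_fst[OF sigma_finite_Z AE_unit_uniform] AE_pair_snd[OF sigma_finite_Z AE_good]
  by eventually_elim auto

lemma norm_h_le: "good z \<Longrightarrow> norm (h n z w) \<le> \<theta> n z * norm w"
  by (rule norm_dev_le) (auto simp: good_def less_imp_le)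

lemma h_lim: "good z \<Longrightarrow> (\<lambda>n. h n z w) \<longlonglongrightarrow> 0"
proof (rule Lim_null_comparison[OF always_eventually[OF allI]])
  assume z: "good z"
  show "norm (h n z w) \<le> \<theta> n z * norm w" for n by (rule norm_h_le[OF z])
  have "(\<lambda>n. \<theta> n z * norm w) \<longlonglongrightarrow> 0 * norm w" using z by (intro tendsto_intros) (simp add: good_def)
  then show "(\<lambda>n. \<theta> n z * norm w) \<longlonglongrightarrow> 0" by simp
qed

lemma h_direction_lim: "good z \<Longrightarrow> (\<lambda>n. h n z w /\<^sub>R \<theta> n z) \<longlonglongrightarrow> (norm w / 2) *\<^sub>R frame e w (q z)"
proof (rule filterlim_compose[OF dev_asymptotics])
  assume "good z"
  then show "filterlim (\<lambda>n. \<theta> n z) (at_right 0) sequentially"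
    unfolding filterlim_at good_def by (intro conjI always_eventually) (auto simp: less_le)
qed

text \<open>The weights that dominate the collision integrals. Their integrals converge by dominated
  convergence, first in \<open>w\<close>, where for each \<open>\<xi>\<close> the cutoff \<open>cut\<close> confines \<open>w\<close> to a ball, and then
  in \<open>\<xi>\<close>, where the confinement estimate provides the bound \<open>\<kappa>(\<xi>) \<langle>v\<rangle>\<^sup>r\<close>.\<close>

lemma weight_limit:
  fixes \<kappa> :: "'a \<times> 'a \<Rightarrow> real" and cut :: "'a \<Rightarrow> real" and c :: "real \<Rightarrow> real"
  assumes \<kappa>[measurable]: "\<kappa> \<in> borel_measurable borel" and \<kappa>0: "\<And>\<xi>. 0 \<le> \<kappa> \<xi>"
    and \<kappa>fin: "(\<integral>\<^sup>+\<xi>. ennreal (\<kappa> \<xi> * jap (snd \<xi>) powr r) \<partial>lborel) < \<infinity>" and r: "0 \<le> r"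
    and cut: "continuous_on UNIV cut" "\<And>v. 0 \<le> cut v \<and> cut v \<le> 1" "\<And>v. cut v \<noteq> 0 \<Longrightarrow> norm v \<le> R" and R: "R \<ge> 0"
    and c[measurable]: "c \<in> borel_measurable borel" and c02: "\<And>s. 0 \<le> s \<Longrightarrow> s \<le> 1 \<Longrightarrow> 0 \<le> c s \<and> c s \<le> 2"
  defines "W n \<equiv> \<lambda>(((s, z), w), \<xi>). \<kappa> \<xi> * norm w powr r * cut (snd \<xi> + w + c s *\<^sub>R h n z w)"
    and "W' \<equiv> \<lambda>((z, w), \<xi>). \<kappa> \<xi> * norm w powr r * cut (snd \<xi> + w)"
  shows "integrable (coll_space Z') (W n)" "integrable (coll_space Z') W'"
    "(\<lambda>n. LINT p|coll_space Z'. W n p) \<longlonglongrightarrow> (LINT p|coll_space Z'. W' p)"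
proof -
  have [measurable]: "cut \<in> borel_measurable borel" by (rule borel_measurable_continuous_onI[OF cut(1)])
  have Wm[measurable]: "W n \<in> borel_measurable (coll_space Z')" for n
    unfolding W_def case_prod_unfold by measurable
  have W'm[measurable]: "W' \<in> borel_measurable (coll_space Z')"
    unfolding W'_def case_prod_unfold by measurable
  have W0: "0 \<le> W n p" "0 \<le> W' p" for n p
    using \<kappa>0 cut(2) by (auto simp: W_def W'_def case_prod_unfold)
  obtain K where K: "K \<ge> 0" "\<forall>(c :: real) \<theta> (u :: 'a) q e.
    norm e = 1 \<and> norm q = 1 \<and> q \<bullet> e = 0 \<and> 0 \<le> c \<and> c \<le> 2 \<and> 0 \<le> \<theta> \<and> \<theta> \<le> 1/20 \<longrightarrow>
    (\<integral>\<^sup>+w. ennreal (norm w powr r) * indicator (cball 0 R) (u + w + c *\<^sub>R dev e \<theta> q w) \<partial>lborel)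
      \<le> ennreal (K * jap u powr r)"
    using nn_integral_dev_ball_le[OF R r, where 'a = 'a] by blast
  define I where "I n = (\<lambda>(sz, \<xi>). \<integral>\<^sup>+w. ennreal (W n ((sz, w), \<xi>)) \<partial>lborel)" for n
  define I' where "I' = (\<lambda>(sz :: real \<times> 'z, \<xi>). \<integral>\<^sup>+w. ennreal (W' ((sz, w), \<xi>)) \<partial>lborel)"
  have [measurable]: "I n \<in> borel_measurable (Z' \<Otimes>\<^sub>M lborel)" "I' \<in> borel_measurable (Z' \<Otimes>\<^sub>M lborel)" for n
    unfolding I_def I'_def by measurable
  have ae: "AE x in Z' \<Otimes>\<^sub>M (lborel :: ('a \<times> 'a) measure). 0 \<le> fst (fst x) \<and> fst (fst x) \<le> 1 \<and> good (snd (fst x))"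
    by (rule AE_pair_fst[OF lborel.sigma_finite_measure_axioms AE_Z'])
  let ?B = "\<lambda>x. ennreal (K * (\<kappa> (snd x) * jap (snd (snd x)) powr r))"
  have [measurable]: "?B \<in> borel_measurable (Z' \<Otimes>\<^sub>M (lborel :: ('a \<times> 'a) measure))"
    unfolding jap_def by measurable
  have Bfin: "(\<integral>\<^sup>+x. ?B x \<partial>(Z' \<Otimes>\<^sub>M (lborel :: ('a \<times> 'a) measure))) < \<infinity>"
  proof -
    have [measurable]: "(\<lambda>\<xi> :: 'a \<times> 'a. jap (snd \<xi>)) \<in> borel_measurable borel" unfolding jap_def by measurable
    have "(\<integral>\<^sup>+x. ?B x \<partial>(Z' \<Otimes>\<^sub>M (lborel :: ('a \<times> 'a) measure))) =
        (\<integral>\<^sup>+z. \<integral>\<^sup>+\<xi>. ?B (z, \<xi>) \<partial>lborel \<partial>Z')"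
      by (rule lborel.nn_integral_fst[symmetric]) measurable
    also have "\<dots> = (ennreal K * (\<integral>\<^sup>+\<xi>. ennreal (\<kappa> \<xi> * jap (snd \<xi>) powr r) \<partial>lborel)) * emeasure Z' (space Z')"
      using K(1) \<kappa>0 by (simp add: ennreal_mult nn_integral_cmult)
    also have "\<dots> < \<infinity>"
    proof -
      have "emeasure Z' (space Z') < \<infinity>"
        using Z'.emeasure_finite[of "space Z'"] by (metis infinity_ennreal_def less_top)
      with \<kappa>fin show ?thesis by (simp only: ennreal_mult_less_top ennreal_less_top infinity_ennreal_def simp_thms)
    qed
    finally show ?thesis .
  qed
  have Ibound: "AE x in Z' \<Otimes>\<^sub>M (lborel :: ('a \<times> 'a) measure). I n x \<le> ?B x" for n
    using ae
  proof eventually_elim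
    case (elim x)
    obtain s z \<xi> where x: "x = ((s, z), \<xi>)" by (metis prod.exhaust)
    have z: "good z" and s: "0 \<le> c s \<and> c s \<le> 2" using elim c02[of s] by (auto simp: x)
    have "I n x \<le> (\<integral>\<^sup>+w. ennreal (\<kappa> \<xi>) * (ennreal (norm w powr r) * indicator (cball 0 R) (snd \<xi> + w + c s *\<^sub>R h n z w)) \<partial>lborel)"
      unfolding I_def x prod.case
    proof (rule nn_integral_mono)
      fix w
      show "ennreal (W n (((s, z), w), \<xi>)) \<le> ennreal (\<kappa> \<xi>) * (ennreal (norm w powr r) * indicator (cball 0 R) (snd \<xi> + w + c s *\<^sub>R h n z w))"
      proof (cases "cut (snd \<xi> + w + c s *\<^sub>R h n z w) = 0")
        case False
        then have "snd \<xi> + w + c s *\<^sub>R h n z w \<in> cball 0 R" using cut(3) by auto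
        moreover have "\<kappa> \<xi> * norm w powr r * cut (snd \<xi> + w + c s *\<^sub>R h n z w) \<le> \<kappa> \<xi> * norm w powr r * 1"
          using cut(2) \<kappa>0 by (intro mult_left_mono) auto
        ultimately show ?thesis
          using \<kappa>0 by (simp add: W_def ennreal_mult[symmetric] ennreal_leI)
      qed (simp add: W_def)
    qed
    also have "\<dots> \<le> ennreal (\<kappa> \<xi>) * ennreal (K * jap (snd \<xi>) powr r)"
    proof (subst nn_integral_cmult)
      have "(\<lambda>w. snd \<xi> + w + c s *\<^sub>R h n z w) \<in> borel_measurable borel" by measurable
      then have [measurable]: "(\<lambda>w. indicator (cball 0 R) (snd \<xi> + w + c s *\<^sub>R h n z w) :: ennreal) \<in> borel_measurable borel"
        by (rule measurable_compose) (intro borel_measurable_indicator borel_closed closed_cball)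
      show "(\<lambda>w. ennreal (norm w powr r) * indicator (cball 0 R) (snd \<xi> + w + c s *\<^sub>R h n z w)) \<in> borel_measurable lborel"
        by measurable
    qed (use z s e K(2)[rule_format, of e "q z" "c s" "\<theta> n z" "snd \<xi>"] in
        \<open>auto simp: good_def less_imp_le intro!: mult_left_mono\<close>)
    also have "\<dots> = ?B x" using \<kappa>0 K(1) by (simp add: x ennreal_mult[symmetric] mult_ac)
    finally show ?case .
  qed
  have Ilim: "AE x in Z' \<Otimes>\<^sub>M (lborel :: ('a \<times> 'a) measure). (\<lambda>n. I n x) \<longlonglongrightarrow> I' x"
    using ae
  proof eventually_elim
    case (elim x)
    obtain s z \<xi> where x: "x = ((s, z), \<xi>)" by (metis prod.exhaust)
    have z: "good z" and s: "0 \<le> c s \<and> c s \<le> 2" using elim c02[of s] by (auto simp: x)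
    define L where "L = 2 * (norm (snd \<xi>) + R)"
    have L: "L \<ge> 0" using R by (simp add: L_def)
    show ?case
      unfolding I_def I'_def x prod.case
    proof (rule nn_integral_dominated_convergence[where w = "\<lambda>w. ennreal (\<kappa> \<xi> * L powr r) * indicator (cball 0 L) w"])
      show "(\<lambda>w. ennreal (W n (((s, z), w), \<xi>))) \<in> borel_measurable lborel" for n
        unfolding W_def prod.case by measurable
      show "(\<lambda>w. ennreal (W' (((s, z), w), \<xi>))) \<in> borel_measurable lborel"
        unfolding W'_def prod.case by measurable
      show "(\<lambda>w. ennreal (\<kappa> \<xi> * L powr r) * indicator (cball 0 L) w) \<in> borel_measurable (lborel :: 'a measure)"
        by (intro borel_measurable_times_ennreal borel_measurable_const borel_measurable_indicator) simp
      show "(\<integral>\<^sup>+w. ennreal (\<kappa> \<xi> * L powr r) * indicator (cball 0 L) w \<partial>(lborel :: 'a measure)) < \<infinity>"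
        using emeasure_lborel_cball_finite[of "0 :: 'a" L]
        by (simp add: nn_integral_cmult_indicator ennreal_mult_less_top)
      show "AE w in lborel. ennreal (W n (((s, z), w), \<xi>)) \<le> ennreal (\<kappa> \<xi> * L powr r) * indicator (cball 0 L) w" for n
      proof (intro always_eventually allI)
        fix w
        show "ennreal (W n (((s, z), w), \<xi>)) \<le> ennreal (\<kappa> \<xi> * L powr r) * indicator (cball 0 L) w"
        proof (cases "cut (snd \<xi> + w + c s *\<^sub>R h n z w) = 0")
          case False
          then have "norm (snd \<xi> + w + c s *\<^sub>R h n z w) \<le> R" using cut(3) by auto
          then have a: "norm (w + c s *\<^sub>R h n z w) \<le> R + norm (snd \<xi>)"
            using norm_triangle_ineq4[of "snd \<xi> + w + c s *\<^sub>R h n z w" "snd \<xi>"] by (simp add: add.assoc)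
          have "norm w \<le> 2 * norm (w + c s *\<^sub>R h n z w)"
            using z s by (intro norm_le_dev) (auto simp: good_def less_imp_le)
          also have "\<dots> \<le> L" using a unfolding L_def by simp
          finally have w: "norm w \<le> L" .
          then have "norm w powr r \<le> L powr r" using r by (intro powr_mono2) auto
          then have "\<kappa> \<xi> * norm w powr r * cut (snd \<xi> + w + c s *\<^sub>R h n z w) \<le> \<kappa> \<xi> * L powr r * 1"
            using cut(2) \<kappa>0 by (intro mult_mono) (auto intro!: mult_nonneg_nonneg)
          then show ?thesis using w by (simp add: W_def ennreal_leI)
        qed (simp add: W_def)
      qed
      show "AE w in lborel. (\<lambda>n. ennreal (W n (((s, z), w), \<xi>))) \<longlonglongrightarrow> ennreal (W' (((s, z), w), \<xi>))"
      proof (intro always_eventually allI tendsto_ennrealI)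
        fix w
        have "(\<lambda>n. cut (snd \<xi> + w + c s *\<^sub>R h n z w)) \<longlonglongrightarrow> cut (snd \<xi> + w + c s *\<^sub>R 0)"
          using cut(1) by (intro continuous_on_tendsto_compose[OF cut(1)] tendsto_intros h_lim z) auto
        then show "(\<lambda>n. W n (((s, z), w), \<xi>)) \<longlonglongrightarrow> W' (((s, z), w), \<xi>)"
          unfolding W_def W'_def prod.case by (intro tendsto_intros) simp
      qed
    qed
  qed
  have eq: "(\<integral>\<^sup>+p. ennreal (W n p) \<partial>coll_space Z') = (\<integral>\<^sup>+x. I n x \<partial>(Z' \<Otimes>\<^sub>M lborel))"
    "(\<integral>\<^sup>+p. ennreal (W' p) \<partial>coll_space Z') = (\<integral>\<^sup>+x. I' x \<partial>(Z' \<Otimes>\<^sub>M lborel))" for n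
    unfolding I_def I'_def by (rule nn_integral_coll_space_w_last, measurable)+
  have lim: "(\<lambda>n. \<integral>\<^sup>+p. ennreal (W n p) \<partial>coll_space Z') \<longlonglongrightarrow> (\<integral>\<^sup>+p. ennreal (W' p) \<partial>coll_space Z')"
    unfolding eq by (rule nn_integral_dominated_convergence[OF _ _ _ Ibound Bfin Ilim]) measurable
  have fin: "(\<integral>\<^sup>+p. ennreal (W n p) \<partial>coll_space Z') \<le> (\<integral>\<^sup>+x. ?B x \<partial>(Z' \<Otimes>\<^sub>M (lborel :: ('a \<times> 'a) measure)))" for n
    unfolding eq by (rule nn_integral_mono_AE[OF Ibound])
  have fin': "(\<integral>\<^sup>+p. ennreal (W' p) \<partial>coll_space Z') \<le> (\<integral>\<^sup>+x. ?B x \<partial>(Z' \<Otimes>\<^sub>M (lborel :: ('a \<times> 'a) measure)))"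
    using lim by (rule LIMSEQ_le_const2) (use fin in blast)
  note conv = integral_limit_of_nn_integral[of W "coll_space Z'" W', OF Wm W'm W0
      order.strict_trans1[OF fin Bfin] order.strict_trans1[OF fin' Bfin] lim]
  show "integrable (coll_space Z') (W n)" "integrable (coll_space Z') W'"
    "(\<lambda>n. LINT p|coll_space Z'. W n p) \<longlonglongrightarrow> (LINT p|coll_space Z'. W' p)"
    by (rule conv)+
qed

end

section \<open>Increments of the density\<close>

lemma shift_shift: "shift a (shift b \<xi>) = shift (a + b) \<xi>"
  by (cases \<xi>) (simp add: add_ac)

lemma fst_shift[simp]: "fst (shift c \<xi>) = fst \<xi>"
  by simp

lemma integral_shift:
  fixes F :: "'y \<times> ('a::euclidean_space \<times> 'a) \<Rightarrow> real"
  assumes c[measurable]: "c \<in> borel_measurable Y" and Y: "sigma_finite_measure Y"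
    and F: "integrable (Y \<Otimes>\<^sub>M lborel) F"
  shows "integrable (Y \<Otimes>\<^sub>M lborel) (\<lambda>(y, \<xi>). F (y, shift (c y) \<xi>))"
    and "(LINT (y, \<xi>)|(Y \<Otimes>\<^sub>M lborel). F (y, shift (c y) \<xi>)) = (LINT p|(Y \<Otimes>\<^sub>M lborel). F p)"
proof -
  let ?E = "\<lambda>(y, \<xi> :: 'a \<times> 'a). (y, shift (c y) \<xi>)"
  have E[measurable]: "?E \<in> measurable (Y \<Otimes>\<^sub>M lborel) (Y \<Otimes>\<^sub>M lborel)" by measurable
  note [measurable] = borel_measurable_integrable[OF F]
  have "integrable (Y \<Otimes>\<^sub>M lborel) (\<lambda>p. F (?E p))"
    using F by (subst (asm) distr_shift[OF c Y, symmetric]) (simp add: integrable_distr_eq[OF E])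
  then show "integrable (Y \<Otimes>\<^sub>M lborel) (\<lambda>(y, \<xi>). F (y, shift (c y) \<xi>))"
    by (simp add: case_prod_unfold)
  have "(LINT p|(Y \<Otimes>\<^sub>M lborel). F p) = (LINT p|distr (Y \<Otimes>\<^sub>M lborel) (Y \<Otimes>\<^sub>M lborel) ?E. F p)"
    by (subst distr_shift[OF c Y]) simp
  also have "\<dots> = (LINT p|(Y \<Otimes>\<^sub>M lborel). F (?E p))" by (rule integral_distr[OF E]) measurable
  finally show "(LINT (y, \<xi>)|(Y \<Otimes>\<^sub>M lborel). F (y, shift (c y) \<xi>)) = (LINT p|(Y \<Otimes>\<^sub>M lborel). F p)"
    by (simp add: case_prod_unfold)
qed

lemma AE_shift:
  fixes c :: "'y \<Rightarrow> 'a::euclidean_space"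
  assumes c[measurable]: "c \<in> borel_measurable Y" and Y: "sigma_finite_measure Y"
    and P: "AE (y, \<xi>) in Y \<Otimes>\<^sub>M lborel. P y \<xi>"
  shows "AE (y, \<xi>) in Y \<Otimes>\<^sub>M lborel. P y (shift (c y) \<xi>)"
proof -
  let ?E = "\<lambda>(y, \<xi> :: 'a \<times> 'a). (y, shift (c y) \<xi>)"
  have E: "?E \<in> measurable (Y \<Otimes>\<^sub>M lborel) (Y \<Otimes>\<^sub>M lborel)" by measurable
  have "AE p in distr (Y \<Otimes>\<^sub>M lborel) (Y \<Otimes>\<^sub>M lborel) ?E. case p of (y, \<xi>) \<Rightarrow> P y \<xi>"
    using P by (subst distr_shift[OF c Y])
  from AE_distrD[OF E this] show ?thesis by (simp add: case_prod_unfold)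
qed

lemma integral_segment:
  fixes F :: "((real \<times> 'z) \<times> 'a) \<times> ('a::euclidean_space \<times> 'a) \<Rightarrow> real"
  assumes Z: "sigma_finite_measure Z" and F: "integrable (coll_space (unit_uniform \<Otimes>\<^sub>M Z)) F"
  shows "integrable (coll_space Z) (\<lambda>((z, w), \<xi>). LINT s|unit_uniform. F (((s, z), w), \<xi>))"
    and "(LINT p|coll_space (unit_uniform \<Otimes>\<^sub>M Z). F p) =
      (LINT ((z, w), \<xi>)|coll_space Z. LINT s|unit_uniform. F (((s, z), w), \<xi>))"
proof -
  interpret U: prob_space unit_uniform by (rule prob_space_unit_uniform)
  interpret Z: sigma_finite_measure Z by fact
  interpret ZW: pair_sigma_finite Z "lborel :: 'a measure" ..
  interpret C: pair_sigma_finite "Z \<Otimes>\<^sub>M (lborel :: 'a measure)" "lborel :: ('a \<times> 'a) measure" ..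
  interpret UC: pair_sigma_finite unit_uniform "coll_space Z :: (('z \<times> 'a) \<times> ('a \<times> 'a)) measure" ..
  let ?E = "\<lambda>(s, ((z, w :: 'a), \<xi> :: 'a \<times> 'a)). (((s :: real, z :: 'z), w), \<xi>)"
  have E[measurable]: "?E \<in> measurable (unit_uniform \<Otimes>\<^sub>M coll_space Z) (coll_space (unit_uniform \<Otimes>\<^sub>M Z))"
    unfolding case_prod_unfold by measurable
  note [measurable] = borel_measurable_integrable[OF F]
  note d = distr_coll_space_assoc[OF U.sigma_finite_measure_axioms Z]
  have "integrable (unit_uniform \<Otimes>\<^sub>M coll_space Z) (\<lambda>p. F (?E p))"
    using F by (subst (asm) d[symmetric]) (simp add: integrable_distr_eq[OF E])
  then have int: "integrable (unit_uniform \<Otimes>\<^sub>M coll_space Z) (\<lambda>(s, p). F (?E (s, p)))"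
    by (simp add: case_prod_unfold)
  show "integrable (coll_space Z) (\<lambda>((z, w), \<xi>). LINT s|unit_uniform. F (((s, z), w), \<xi>))"
    using UC.integrable_snd[OF int] by (simp add: case_prod_unfold)
  have "(LINT p|coll_space (unit_uniform \<Otimes>\<^sub>M Z). F p) =
      (LINT p|distr (unit_uniform \<Otimes>\<^sub>M coll_space Z) (coll_space (unit_uniform \<Otimes>\<^sub>M Z)) ?E. F p)"
    by (subst d) simp
  also have "\<dots> = (LINT p|(unit_uniform \<Otimes>\<^sub>M coll_space Z). F (?E p))" by (rule integral_distr[OF E]) measurable
  also have "\<dots> = (LINT p|coll_space Z. LINT s|unit_uniform. F (?E (s, p)))"
    using UC.integral_snd[OF int] by (simp add: case_prod_unfold)
  finally show "(LINT p|coll_space (unit_uniform \<Otimes>\<^sub>M Z). F p) =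
      (LINT ((z, w), \<xi>)|coll_space Z. LINT s|unit_uniform. F (((s, z), w), \<xi>))"
    by (simp add: case_prod_unfold)
qed

text \<open>The data of the limit: \<open>g\<close> and \<open>G\<close> stand for the density and its velocity gradient, bounded
  by \<open>M(x)\<close>; \<open>\<phi>\<close> is the test function with velocity gradient \<open>D\<close> and \<open>cut\<close> a cutoff that
  localizes its increments.\<close>

locale grazing_collisions = grazing Z e \<theta> q
  for Z :: "'z measure" and e :: "'a::euclidean_space" and \<theta> q +
  fixes \<gamma> r R C :: real and g :: "'a \<times> 'a \<Rightarrow> real" and G :: "'a \<times> 'a \<Rightarrow> 'a" and M :: "'a \<Rightarrow> real"
    and \<phi> :: "'a \<times> 'a \<Rightarrow> real" and D :: "'a \<times> 'a \<Rightarrow> 'a" and cut :: "'a \<Rightarrow> real"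
  assumes r: "r = \<gamma> + 2" "0 \<le> r"
    and measurable_data[measurable]: "g \<in> borel_measurable borel" "G \<in> borel_measurable borel"
      "M \<in> borel_measurable borel" "\<phi> \<in> borel_measurable borel" "D \<in> borel_measurable borel"
    and g0: "\<And>\<xi>. 0 \<le> g \<xi>" and gM: "\<And>\<xi>. g \<xi> \<le> M (fst \<xi>)" and GM: "\<And>\<xi>. norm (G \<xi>) \<le> M (fst \<xi>)"
    and segment: "\<And>d. AE \<xi> in lborel. g (shift d \<xi>) - g \<xi> = (LINT s|unit_uniform. d \<bullet> G (shift (s *\<^sub>R d) \<xi>))"
    and finite_g: "(\<integral>\<^sup>+\<xi>. ennreal ((M (fst \<xi>))\<^sup>2 * g \<xi> * jap (snd \<xi>) powr r) \<partial>lborel) < \<infinity>"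
    and finite_G: "(\<integral>\<^sup>+\<xi>. ennreal ((M (fst \<xi>))\<^sup>2 * norm (G \<xi>) * jap (snd \<xi>) powr r) \<partial>lborel) < \<infinity>"
    and C: "0 \<le> C" and \<phi>_lipschitz:
      "\<And>a b \<xi>. \<bar>\<phi> (shift a \<xi>) - \<phi> (shift b \<xi>)\<bar> \<le> C * norm (a - b) * (cut (snd \<xi> + a) + cut (snd \<xi> + b))"
    and \<phi>_derivative: "\<And>\<xi>. ((\<lambda>v. \<phi> (shift v \<xi>)) has_derivative (\<lambda>v. D \<xi> \<bullet> v)) (at 0)"
    and cut: "continuous_on UNIV cut" "\<And>v. 0 \<le> cut v \<and> cut v \<le> 1" "\<And>v. cut v \<noteq> 0 \<Longrightarrow> norm v \<le> R" and R: "R \<ge> 0"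
begin

lemma M0: "0 \<le> M x"
  using g0[of "(x, 0)"] gM[of "(x, 0)"] by simp

lemma cut_measurable[measurable]: "cut \<in> borel_measurable borel"
  by (rule borel_measurable_continuous_onI[OF cut(1)])

lemma sigma_finite_Y: "sigma_finite_measure (Z \<Otimes>\<^sub>M (lborel :: 'a measure))"
  and sigma_finite_Y': "sigma_finite_measure (Z' \<Otimes>\<^sub>M (lborel :: 'a measure))"
proof -
  interpret pair_sigma_finite Z "lborel :: 'a measure" ..
  show "sigma_finite_measure (Z \<Otimes>\<^sub>M (lborel :: 'a measure))" by unfold_locales
next
  interpret pair_sigma_finite Z' "lborel :: 'a measure" ..
  show "sigma_finite_measure (Z' \<Otimes>\<^sub>M (lborel :: 'a measure))" by unfold_locales
qed

text \<open>The exceptional null set of the segment identity depends on the shift; by Fubini's theorem the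
  identity survives for a shift that varies with a parameter.\<close>

lemma segment_AE:
  assumes c[measurable]: "c \<in> borel_measurable Y" and Y: "sigma_finite_measure Y"
  shows "AE (y, \<xi>) in Y \<Otimes>\<^sub>M lborel.
    g (shift (c y) \<xi>) - g \<xi> = (LINT s|unit_uniform. c y \<bullet> G (shift (s *\<^sub>R c y) \<xi>))"
proof -
  interpret Y: sigma_finite_measure Y by fact
  interpret pair_sigma_finite Y "lborel :: ('a \<times> 'a) measure" ..
  show ?thesis
  proof (rule AE_pair_measure)
    show "{x \<in> space (Y \<Otimes>\<^sub>M lborel). case x of (y, \<xi>) \<Rightarrow>
        g (shift (c y) \<xi>) - g \<xi> = (LINT s|unit_uniform. c y \<bullet> G (shift (s *\<^sub>R c y) \<xi>))} \<in> sets (Y \<Otimes>\<^sub>M lborel)"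
      unfolding case_prod_unfold by measurable
  qed (simp add: segment)
qed

lemma lipschitz: "AE \<xi> in lborel. \<bar>g (shift d \<xi>) - g \<xi>\<bar> \<le> norm d * M (fst \<xi>)"
  using segment[of d]
proof eventually_elim
  case (elim \<xi>)
  have b: "\<bar>d \<bullet> G (shift (s *\<^sub>R d) \<xi>)\<bar> \<le> norm d * M (fst \<xi>)" for s
    using Cauchy_Schwarz_ineq2[of d "G (shift (s *\<^sub>R d) \<xi>)"] mult_left_mono[OF GM[of "shift (s *\<^sub>R d) \<xi>"], of "norm d"]
    by simp
  have "norm (LINT s|unit_uniform. d \<bullet> G (shift (s *\<^sub>R d) \<xi>)) \<le> (LINT s|unit_uniform. norm (d \<bullet> G (shift (s *\<^sub>R d) \<xi>)))"
    by (rule integral_norm_bound)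
  also have "\<dots> \<le> (LINT s|unit_uniform. norm d * M (fst \<xi>))"
    using b by (intro integral_mono) (auto intro!: U.integrable_const_bound[where B = "norm d * M (fst \<xi>)"])
  finally show ?case using elim by (simp add: U.prob_space)
qed

lemma lipschitz_AE:
  assumes c[measurable]: "c \<in> borel_measurable Y" and Y: "sigma_finite_measure Y"
  shows "AE (y, \<xi>) in Y \<Otimes>\<^sub>M lborel. \<bar>g (shift (c y) \<xi>) - g \<xi>\<bar> \<le> norm (c y) * M (fst \<xi>)"
proof -
  interpret Y: sigma_finite_measure Y by fact
  interpret pair_sigma_finite Y "lborel :: ('a \<times> 'a) measure" ..
  show ?thesis
  proof (rule AE_pair_measure)
    show "{x \<in> space (Y \<Otimes>\<^sub>M lborel). case x of (y, \<xi>) \<Rightarrow>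
        \<bar>g (shift (c y) \<xi>) - g \<xi>\<bar> \<le> norm (c y) * M (fst \<xi>)} \<in> sets (Y \<Otimes>\<^sub>M lborel)"
      unfolding case_prod_unfold by measurable
  qed (simp add: lipschitz)
qed

text \<open>The Lipschitz bound fails on a null set that depends on the shift, but a sequence of shifts
  involves only countably many of these null sets.\<close>

lemma g_shift_lim:
  assumes c[measurable]: "\<And>n. c n \<in> borel_measurable Y" "b \<in> borel_measurable Y" and Y: "sigma_finite_measure Y"
    and lim: "AE y in Y. (\<lambda>n. c n y) \<longlonglongrightarrow> b y"
  shows "AE (y, \<xi>) in Y \<Otimes>\<^sub>M lborel. (\<lambda>n. g (shift (c n y) \<xi>)) \<longlonglongrightarrow> g (shift (b y) \<xi>)"
proof -
  have "AE (y, \<xi>) in Y \<Otimes>\<^sub>M lborel. \<bar>g (shift (c n y - b y) (shift (b y) \<xi>)) - g (shift (b y) \<xi>)\<bar> \<le>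
      norm (c n y - b y) * M (fst (shift (b y) \<xi>))" for n
    by (rule AE_shift[OF c(2) Y]) (rule lipschitz_AE[OF _ Y], measurable)
  then have "AE p in Y \<Otimes>\<^sub>M lborel. \<forall>n. case p of (y, \<xi>) \<Rightarrow> \<bar>g (shift (c n y) \<xi>) - g (shift (b y) \<xi>)\<bar> \<le>
      norm (c n y - b y) * M (fst \<xi>)"
    by (simp add: AE_all_countable shift_shift)
  moreover have "AE p in Y \<Otimes>\<^sub>M (lborel :: ('a \<times> 'a) measure). (\<lambda>n. c n (fst p)) \<longlonglongrightarrow> b (fst p)"
    by (rule AE_pair_fst[OF lborel.sigma_finite_measure_axioms lim])
  ultimately show ?thesis
  proof eventually_elim
    case (elim p)
    obtain y \<xi> where p: "p = (y, \<xi>)" by (metis prod.exhaust)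
    have "(\<lambda>n. norm (c n y - b y) * M (fst \<xi>)) \<longlonglongrightarrow> norm (b y - b y) * M (fst \<xi>)"
      using elim(2) by (intro tendsto_intros) (simp add: p)
    then have "(\<lambda>n. norm (c n y - b y) * M (fst \<xi>)) \<longlonglongrightarrow> 0" by simp
    then have "(\<lambda>n. g (shift (c n y) \<xi>) - g (shift (b y) \<xi>)) \<longlonglongrightarrow> 0"
      by (rule Lim_null_comparison[rotated]) (use elim(1) in \<open>auto simp: p\<close>)
    then show ?case by (simp add: p LIM_zero_cancel)
  qed
qed

lemma \<phi>_quotient_lim:
  assumes \<tau>: "\<And>n. \<tau> n > 0" "\<tau> \<longlonglongrightarrow> 0"
    and a: "(\<lambda>n. a n /\<^sub>R \<tau> n) \<longlonglongrightarrow> a'" and b: "(\<lambda>n. b n /\<^sub>R \<tau> n) \<longlonglongrightarrow> b'"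
  shows "(\<lambda>n. (\<phi> (shift (a n) \<xi>) - \<phi> (shift (b n) \<xi>)) / \<tau> n) \<longlonglongrightarrow> D \<xi> \<bullet> (a' - b')"
proof -
  have one: "(\<lambda>n. (\<phi> (shift (a n) \<xi>) - \<phi> \<xi>) / \<tau> n) \<longlonglongrightarrow> D \<xi> \<bullet> a'"
    if a: "(\<lambda>n. a n /\<^sub>R \<tau> n) \<longlonglongrightarrow> a'" for a a'
  proof -
    have a0: "a \<longlonglongrightarrow> 0"
    proof -
      have "(\<lambda>n. \<tau> n *\<^sub>R (a n /\<^sub>R \<tau> n)) \<longlonglongrightarrow> 0 *\<^sub>R a'" by (intro tendsto_intros \<tau> a)
      then show ?thesis using \<tau>(1) by (simp add: less_imp_neq[symmetric])
    qed
    have "(\<lambda>n. (\<phi> (shift (a n) \<xi>) - \<phi> \<xi> - D \<xi> \<bullet> a n) / \<tau> n) \<longlonglongrightarrow> 0"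
    proof (rule LIMSEQ_I)
      fix \<epsilon> :: real assume \<epsilon>: "\<epsilon> > 0"
      define \<delta> where "\<delta> = \<epsilon> / (norm a' + 2)"
      have \<delta>: "\<delta> > 0" using \<epsilon> by (auto simp: \<delta>_def intro!: divide_pos_pos add_nonneg_pos)
      obtain d where d: "d > 0" "\<And>y. norm y < d \<Longrightarrow> \<bar>\<phi> (shift y \<xi>) - \<phi> \<xi> - D \<xi> \<bullet> y\<bar> \<le> \<delta> * norm y"
        using \<phi>_derivative[of \<xi>] \<delta> unfolding has_derivative_at_alt by (auto simp: zero_prod_def[symmetric])
      have "\<forall>\<^sub>F n in sequentially. norm (a n) < d"
        using tendsto_norm[OF a0] d(1) by (intro order_tendstoD(2)[of _ "norm (0 :: 'a)"]) auto
      moreover have "\<forall>\<^sub>F n in sequentially. norm (a n /\<^sub>R \<tau> n) < norm a' + 1"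
        using tendsto_norm[OF a] by (rule order_tendstoD(2)) simp
      ultimately have "\<forall>\<^sub>F n in sequentially. norm ((\<phi> (shift (a n) \<xi>) - \<phi> \<xi> - D \<xi> \<bullet> a n) / \<tau> n - 0) < \<epsilon>"
      proof eventually_elim
        case (elim n)
        have "\<bar>\<phi> (shift (a n) \<xi>) - \<phi> \<xi> - D \<xi> \<bullet> a n\<bar> / \<tau> n \<le> \<delta> * norm (a n) / \<tau> n"
          using d(2)[OF elim(1)] \<tau>(1)[of n] by (intro divide_right_mono) auto
        also have "\<dots> = \<delta> * norm (a n /\<^sub>R \<tau> n)" using \<tau>(1)[of n] by (simp add: divide_inverse mult_ac)
        also have "\<dots> \<le> \<delta> * (norm a' + 1)" using elim(2) \<delta> by (intro mult_left_mono) auto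
        also have "\<dots> < \<delta> * (norm a' + 2)" using \<delta> by (intro mult_strict_left_mono) auto
        also have "\<dots> = \<epsilon>" using norm_ge_zero[of a'] unfolding \<delta>_def by (simp add: add_nonneg_eq_0_iff)
        finally show ?case using \<tau>(1)[of n] by simp
      qed
      then show "\<exists>no. \<forall>n\<ge>no. norm ((\<phi> (shift (a n) \<xi>) - \<phi> \<xi> - D \<xi> \<bullet> a n) / \<tau> n - 0) < \<epsilon>"
        by (simp add: eventually_sequentially)
    qed
    from tendsto_add[OF this tendsto_inner[OF tendsto_const[of "D \<xi>"] a]]
    have "(\<lambda>n. (\<phi> (shift (a n) \<xi>) - \<phi> \<xi> - D \<xi> \<bullet> a n) / \<tau> n + D \<xi> \<bullet> (a n /\<^sub>R \<tau> n)) \<longlonglongrightarrow> D \<xi> \<bullet> a'" by simp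
    moreover have "(\<phi> (shift (a n) \<xi>) - \<phi> \<xi> - D \<xi> \<bullet> a n) / \<tau> n + D \<xi> \<bullet> (a n /\<^sub>R \<tau> n) =
        (\<phi> (shift (a n) \<xi>) - \<phi> \<xi>) / \<tau> n" for n
      by (simp add: divide_inverse algebra_simps)
    ultimately show ?thesis by simp
  qed
  from tendsto_diff[OF one[OF a] one[OF b]] show ?thesis
    by (simp add: diff_divide_distrib inner_diff_right)
qed

text \<open>The factor \<open>\<beta>(t) \<pi>\<^sup>2 / \<epsilon>\<^sup>2\<close> of the weak formulation is \<open>t\<^sup>2 \<beta>(t) / \<theta>\<^sup>2\<close> for \<open>\<theta> = \<epsilon> t / \<pi>\<close>. The factor
  \<open>t\<^sup>2 \<beta>(t)\<close> belongs to the measure \<open>Z\<close>.\<close>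

definition kern :: "nat \<Rightarrow> 'z \<Rightarrow> 'a \<Rightarrow> real" where
  "kern n z w = norm w powr \<gamma> / (\<theta> n z)\<^sup>2"

text \<open>Two small velocity changes compensate the singularity \<open>\<theta>\<^sup>-\<^sup>2\<close> and raise the power of the
  relative velocity by two.\<close>

lemma kern_bound:
  assumes z: "good z" and b: "\<bar>b1\<bar> \<le> norm (h n z w)" "\<bar>b2\<bar> \<le> norm (h n z w)"
  shows "kern n z w * \<bar>b1\<bar> * \<bar>b2\<bar> \<le> norm w powr r"
proof (cases "w = 0")
  case True
  then have "h n z w = 0" using norm_h_le[OF z, of n w] by simp
  then show ?thesis using b by simp
next
  case False
  have t: "\<theta> n z > 0" using z by (simp add: good_def)
  have "\<bar>b1\<bar> * \<bar>b2\<bar> \<le> (\<theta> n z * norm w) * (\<theta> n z * norm w)"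
    using b norm_h_le[OF z, of n w] by (intro mult_mono) (auto intro: order_trans)
  then have "kern n z w * (\<bar>b1\<bar> * \<bar>b2\<bar>) \<le> kern n z w * ((\<theta> n z * norm w) * (\<theta> n z * norm w))"
    by (intro mult_left_mono) (auto simp: kern_def)
  also have "\<dots> = norm w powr \<gamma> * norm w powr 2"
    using t by (simp add: kern_def power2_eq_square)
  also have "\<dots> = norm w powr r" using False by (simp add: r powr_add)
  finally show ?thesis by (simp add: mult.assoc)
qed

text \<open>The function \<open>c\<close> of the segment parameter tells which multiple of the velocity change remains in
  the argument of the cutoff after the shift.\<close>

definition dominating :: "('a \<times> 'a \<Rightarrow> real) \<Rightarrow> (real \<Rightarrow> real) \<Rightarrow> nat \<Rightarrow> ((real \<times> 'z) \<times> 'a) \<times> ('a \<times> 'a) \<Rightarrow> real" where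
  "dominating \<kappa> c n = (\<lambda>(((s, z), w), \<xi>). \<kappa> \<xi> * norm w powr r * cut (snd \<xi> + w + c s *\<^sub>R h n z w))"

definition dominating_limit :: "('a \<times> 'a \<Rightarrow> real) \<Rightarrow> ((real \<times> 'z) \<times> 'a) \<times> ('a \<times> 'a) \<Rightarrow> real" where
  "dominating_limit \<kappa> = (\<lambda>((z, w), \<xi>). \<kappa> \<xi> * norm w powr r * cut (snd \<xi> + w))"

lemma dominating_limit:
  assumes "\<kappa> \<in> borel_measurable borel" "\<And>\<xi>. 0 \<le> \<kappa> \<xi>"
    and "(\<integral>\<^sup>+\<xi>. ennreal (\<kappa> \<xi> * jap (snd \<xi>) powr r) \<partial>lborel) < \<infinity>"
    and "c \<in> borel_measurable borel" "\<And>s. 0 \<le> s \<Longrightarrow> s \<le> 1 \<Longrightarrow> 0 \<le> c s \<and> c s \<le> 2"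
  shows "integrable (coll_space Z') (dominating \<kappa> c n)" "integrable (coll_space Z') (dominating_limit \<kappa>)"
    "(\<lambda>n. LINT p|coll_space Z'. dominating \<kappa> c n p) \<longlonglongrightarrow> (LINT p|coll_space Z'. dominating_limit \<kappa> p)"
  unfolding dominating_def dominating_limit_def
  by (rule weight_limit[OF assms(1-3) r(2) cut R assms(4,5)]; assumption)+

lemma AE_good_coll: "AE (((s, z), w), \<xi>) in (coll_space Z' :: (((real \<times> 'z) \<times> 'a) \<times> ('a \<times> 'a)) measure). 0 \<le> s \<and> s \<le> 1 \<and> good z"
proof -
  have "AE y in Z' \<Otimes>\<^sub>M (lborel :: 'a measure). 0 \<le> fst (fst y) \<and> fst (fst y) \<le> 1 \<and> good (snd (fst y))"
    by (rule AE_pair_fst[OF lborel.sigma_finite_measure_axioms AE_Z'])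
  from AE_pair_fst[OF lborel.sigma_finite_measure_axioms this] show ?thesis
    by (simp add: case_prod_unfold)
qed

lemma scaled_h_lim: "good z \<Longrightarrow> (\<lambda>n. c *\<^sub>R h n z w) \<longlonglongrightarrow> 0"
  using tendsto_scaleR[OF tendsto_const[of c] h_lim[of z w]] by simp

text \<open>The limit of the velocity change divided by the angle.\<close>

definition dir :: "'z \<Rightarrow> 'a \<Rightarrow> 'a" where
  "dir z w = (norm w / 2) *\<^sub>R frame e w (q z)"

lemma kern_increment_lim:
  assumes z: "good z"
    and a: "(\<lambda>n. a n /\<^sub>R \<theta> n z) \<longlonglongrightarrow> a'" and b: "(\<lambda>n. b n /\<^sub>R \<theta> n z) \<longlonglongrightarrow> b'"
  shows "(\<lambda>n. kern n z w * ((\<phi> (shift (a n) \<xi>) - \<phi> (shift (b n) \<xi>)) * (h n z w \<bullet> X))) \<longlonglongrightarrow>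
    norm w powr \<gamma> * ((D \<xi> \<bullet> (a' - b')) * (dir z w \<bullet> X))"
proof -
  have t: "\<theta> n z > 0" for n using z by (simp add: good_def)
  have "(\<lambda>n. norm w powr \<gamma> * ((\<phi> (shift (a n) \<xi>) - \<phi> (shift (b n) \<xi>)) / \<theta> n z * ((h n z w /\<^sub>R \<theta> n z) \<bullet> X))) \<longlonglongrightarrow>
    norm w powr \<gamma> * ((D \<xi> \<bullet> (a' - b')) * (dir z w \<bullet> X))"
    unfolding dir_def using z
    by (intro tendsto_mult tendsto_const tendsto_inner \<phi>_quotient_lim[OF t _ a b] h_direction_lim[OF z])
       (simp add: good_def)
  moreover have "norm w powr \<gamma> * ((\<phi> (shift (a n) \<xi>) - \<phi> (shift (b n) \<xi>)) / \<theta> n z * ((h n z w /\<^sub>R \<theta> n z) \<bullet> X)) =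
     kern n z w * ((\<phi> (shift (a n) \<xi>) - \<phi> (shift (b n) \<xi>)) * (h n z w \<bullet> X))" for n
    using t[of n] by (simp add: kern_def power2_eq_square field_simps)
  ultimately show ?thesis by simp
qed

lemma kern_increment_bound:
  assumes z: "good z" and d: "norm (a - b) \<le> norm (h n z w)"
  shows "kern n z w * \<bar>(\<phi> (shift a \<xi>) - \<phi> (shift b \<xi>)) * (h n z w \<bullet> X)\<bar> \<le>
    C * norm X * norm w powr r * (cut (snd \<xi> + a) + cut (snd \<xi> + b))"
proof -
  have "\<bar>\<phi> (shift a \<xi>) - \<phi> (shift b \<xi>)\<bar> \<le> C * norm (h n z w) * (cut (snd \<xi> + a) + cut (snd \<xi> + b))"
    using \<phi>_lipschitz[of \<xi> a b] C d cut(2)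
    by (elim order_trans) (intro mult_right_mono mult_left_mono, auto intro!: add_nonneg_nonneg)
  moreover have "\<bar>h n z w \<bullet> X\<bar> \<le> norm (h n z w) * norm X" by (rule Cauchy_Schwarz_ineq2)
  ultimately have "\<bar>(\<phi> (shift a \<xi>) - \<phi> (shift b \<xi>)) * (h n z w \<bullet> X)\<bar> \<le>
      (C * norm (h n z w) * (cut (snd \<xi> + a) + cut (snd \<xi> + b))) * (norm (h n z w) * norm X)"
    unfolding abs_mult using C cut(2) by (intro mult_mono) (auto intro!: mult_nonneg_nonneg add_nonneg_nonneg)
  then have "kern n z w * \<bar>(\<phi> (shift a \<xi>) - \<phi> (shift b \<xi>)) * (h n z w \<bullet> X)\<bar> \<le>
      kern n z w * ((C * norm (h n z w) * (cut (snd \<xi> + a) + cut (snd \<xi> + b))) * (norm (h n z w) * norm X))"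
    by (intro mult_left_mono) (auto simp: kern_def)
  also have "\<dots> = (kern n z w * \<bar>norm (h n z w)\<bar> * \<bar>norm (h n z w)\<bar>) * (C * norm X * (cut (snd \<xi> + a) + cut (snd \<xi> + b)))"
    by simp
  also have "\<dots> \<le> norm w powr r * (C * norm X * (cut (snd \<xi> + a) + cut (snd \<xi> + b)))"
    using C cut(2) by (intro mult_right_mono kern_bound[OF z]) (auto intro!: mult_nonneg_nonneg add_nonneg_nonneg)
  finally show ?thesis by (simp add: mult_ac)
qed

text \<open>The two terms of the collision integral, \<open>F1\<close> with the increment \<open>f' - f\<close> and \<open>F2\<close> with the
  increment \<open>f'\<^sub>* - f\<^sub>*\<close>, after writing the increment as an integral over a segment and shifting
  the velocity so that the gradient is evaluated at the point \<open>\<xi>\<close> itself, independently of \<open>n\<close>. In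
  \<open>F2\<close> the point \<open>\<xi>\<close> is near the second particle, whence the sign of \<open>w\<close>. The limits are \<open>L1\<close>
  and \<open>L2\<close>.\<close>

definition F1 :: "nat \<Rightarrow> ((real \<times> 'z) \<times> 'a) \<times> ('a \<times> 'a) \<Rightarrow> real" where
  "F1 n = (\<lambda>(((s, z), w), \<xi>).
     g (shift (- w - s *\<^sub>R h n z w) \<xi>) * g (shift (- w - (1 + s) *\<^sub>R h n z w) \<xi>) *
     (kern n z w * ((\<phi> (shift ((1 - s) *\<^sub>R h n z w) \<xi>) - \<phi> (shift (- s *\<^sub>R h n z w) \<xi>)) * (h n z w \<bullet> G \<xi>))))"

definition F2 :: "nat \<Rightarrow> ((real \<times> 'z) \<times> 'a) \<times> ('a \<times> 'a) \<Rightarrow> real" where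
  "F2 n = (\<lambda>(((s, z), w), \<xi>).
     - (g (shift (w + s *\<^sub>R h n z w) \<xi>) * g (shift (w + (1 + s) *\<^sub>R h n z w) \<xi>) *
     (kern n z w * ((\<phi> (shift (w + (1 + s) *\<^sub>R h n z w) \<xi>) - \<phi> (shift (w + s *\<^sub>R h n z w) \<xi>)) * (h n z w \<bullet> G \<xi>)))))"

definition L1 :: "('z \<times> 'a) \<times> ('a \<times> 'a) \<Rightarrow> real" where
  "L1 = (\<lambda>((z, w), \<xi>). (g (shift (- w) \<xi>))\<^sup>2 * (norm w powr \<gamma> * ((D \<xi> \<bullet> dir z w) * (dir z w \<bullet> G \<xi>))))"

definition L2 :: "('z \<times> 'a) \<times> ('a \<times> 'a) \<Rightarrow> real" where
  "L2 = (\<lambda>((z, w), \<xi>). - ((g (shift w \<xi>))\<^sup>2 * (norm w powr \<gamma> * ((D (shift w \<xi>) \<bullet> dir z w) * (dir z w \<bullet> G \<xi>)))))"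

definition drop_s :: "((real \<times> 'z) \<times> 'a) \<times> ('a \<times> 'a) \<Rightarrow> ('z \<times> 'a) \<times> ('a \<times> 'a)" where
  "drop_s = (\<lambda>(((s, z), w), \<xi>). ((z, w), \<xi>))"

lemma measurable_F[measurable]:
  "F1 n \<in> borel_measurable (coll_space Z')" "F2 n \<in> borel_measurable (coll_space Z')"
  "L1 \<in> borel_measurable (coll_space Z)" "L2 \<in> borel_measurable (coll_space Z)"
  "drop_s \<in> measurable (coll_space Z') (coll_space Z)"
  unfolding F1_def F2_def L1_def L2_def drop_s_def case_prod_unfold kern_def dir_def by measurable

lemma kappa_G: "(\<lambda>\<xi>. (M (fst \<xi>))\<^sup>2 * norm (G \<xi>)) \<in> borel_measurable borel" "0 \<le> (M (fst \<xi>))\<^sup>2 * norm (G \<xi>)"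
  and kappa_g: "(\<lambda>\<xi>. (M (fst \<xi>))\<^sup>2 * g \<xi>) \<in> borel_measurable borel" "0 \<le> (M (fst \<xi>))\<^sup>2 * g \<xi>"
  using g0 by (auto intro!: mult_nonneg_nonneg) measurable

text \<open>The gradient at \<open>\<xi>\<close> serves as the weight \<open>\<kappa>\<close>, because the increment of \<open>\<phi>\<close> lives near \<open>\<xi> + w\<close> and
  confines \<open>w\<close>.\<close>

lemma F2_lim:
  shows "integrable (coll_space Z') (F2 n)" "integrable (coll_space Z') (\<lambda>p. L2 (drop_s p))"
    "(\<lambda>n. LINT p|coll_space Z'. F2 n p) \<longlonglongrightarrow> (LINT p|coll_space Z'. L2 (drop_s p))"
proof -
  let ?\<kappa> = "\<lambda>\<xi>. (M (fst \<xi>))\<^sup>2 * norm (G \<xi>)"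
  let ?W = "dominating ?\<kappa>" and ?W' = "dominating_limit ?\<kappa>"
  note Ws = dominating_limit[OF kappa_G finite_G, of "\<lambda>s. s"]
  note Ws1 = dominating_limit[OF kappa_G finite_G, of "\<lambda>s. 1 + s"]
  have Y: "sigma_finite_measure (Z' \<Otimes>\<^sub>M (lborel :: 'a measure))" by (rule sigma_finite_Y')
  have aeY: "AE y in Z' \<Otimes>\<^sub>M (lborel :: 'a measure). good (snd (fst y))"
    using AE_pair_fst[OF lborel.sigma_finite_measure_axioms AE_Z'] by eventually_elim auto
  have gl: "AE (y, \<xi>) in coll_space Z'. (\<lambda>n. g (shift (snd y + c (fst (fst y)) *\<^sub>R h n (snd (fst y)) (snd y)) \<xi>)) \<longlonglongrightarrow> g (shift (snd y) \<xi>)"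
    if [measurable]: "c \<in> borel_measurable borel" for c
  proof (rule g_shift_lim[OF _ _ Y])
    show "AE y in Z' \<Otimes>\<^sub>M (lborel :: 'a measure).
        (\<lambda>n. snd y + c (fst (fst y)) *\<^sub>R h n (snd (fst y)) (snd y)) \<longlonglongrightarrow> snd y"
      using aeY
    proof eventually_elim
      case (elim y)
      from tendsto_add[OF tendsto_const[of "snd y"] scaled_h_lim[OF elim]] show ?case by simp
    qed
  qed measurable
  have lim: "AE p in coll_space Z'. (\<lambda>n. F2 n p) \<longlonglongrightarrow> L2 (drop_s p)"
    using AE_good_coll gl[of "\<lambda>s. s", simplified] gl[of "\<lambda>s. 1 + s", simplified]
  proof eventually_elim
    case (elim p)
    obtain s z w \<xi> where p: "p = (((s, z), w), \<xi>)" by (metis prod.exhaust)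
    have z: "good z" and s: "0 \<le> s" "s \<le> 1" using elim(1) by (auto simp: p)
    have d: "(\<lambda>n. (c *\<^sub>R h n z w) /\<^sub>R \<theta> n z) \<longlonglongrightarrow> c *\<^sub>R dir z w" for c
      using tendsto_scaleR[OF tendsto_const[of c] h_direction_lim[OF z, of w]]
      by (simp add: dir_def mult.commute)
    have "(\<lambda>n. kern n z w * ((\<phi> (shift ((1 + s) *\<^sub>R h n z w) (shift w \<xi>)) - \<phi> (shift (s *\<^sub>R h n z w) (shift w \<xi>))) * (h n z w \<bullet> G \<xi>)))
      \<longlonglongrightarrow> norm w powr \<gamma> * ((D (shift w \<xi>) \<bullet> ((1 + s) *\<^sub>R dir z w - s *\<^sub>R dir z w)) * (dir z w \<bullet> G \<xi>))"
      by (rule kern_increment_lim[OF z d d])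
    then have k: "(\<lambda>n. kern n z w * ((\<phi> (shift (w + (1 + s) *\<^sub>R h n z w) \<xi>) - \<phi> (shift (w + s *\<^sub>R h n z w) \<xi>)) * (h n z w \<bullet> G \<xi>)))
      \<longlonglongrightarrow> norm w powr \<gamma> * ((D (shift w \<xi>) \<bullet> dir z w) * (dir z w \<bullet> G \<xi>))"
      unfolding shift_shift by (simp add: algebra_simps)
    have g1: "(\<lambda>n. g (shift (w + s *\<^sub>R h n z w) \<xi>)) \<longlonglongrightarrow> g (shift w \<xi>)"
      and g2: "(\<lambda>n. g (shift (w + (1 + s) *\<^sub>R h n z w) \<xi>)) \<longlonglongrightarrow> g (shift w \<xi>)"
      using elim(2,3) by (auto simp: p)
    from tendsto_minus[OF tendsto_mult[OF tendsto_mult[OF g1 g2] k]] show ?case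
      unfolding p F2_def L2_def drop_s_def prod.case power2_eq_square .
  qed
  have bound: "AE p in coll_space Z'. \<bar>F2 n p\<bar> \<le> C * (?W (\<lambda>s. 1 + s) n p + ?W (\<lambda>s. s) n p)" for n
    using AE_good_coll
  proof eventually_elim
    case (elim p)
    obtain s z w \<xi> where p: "p = (((s, z), w), \<xi>)" by (metis prod.exhaust)
    have z: "good z" using elim by (simp add: p)
    define A where "A = kern n z w * \<bar>(\<phi> (shift (w + (1 + s) *\<^sub>R h n z w) \<xi>) - \<phi> (shift (w + s *\<^sub>R h n z w) \<xi>)) * (h n z w \<bullet> G \<xi>)\<bar>"
    define B where "B = cut (snd \<xi> + (w + (1 + s) *\<^sub>R h n z w)) + cut (snd \<xi> + (w + s *\<^sub>R h n z w))"
    have k0: "0 \<le> kern n z w" by (simp add: kern_def)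
    have "A \<le> C * norm (G \<xi>) * norm w powr r * B"
      unfolding A_def B_def by (rule kern_increment_bound[OF z]) (simp add: algebra_simps)
    moreover have "\<bar>F2 n p\<bar> = g (shift (w + s *\<^sub>R h n z w) \<xi>) * g (shift (w + (1 + s) *\<^sub>R h n z w) \<xi>) * A"
      unfolding p F2_def prod.case A_def using k0 g0 by (simp add: abs_mult)
    moreover have "\<dots> \<le> M (fst \<xi>) * M (fst \<xi>) * A"
      using gM[of "shift (w + s *\<^sub>R h n z w) \<xi>"] gM[of "shift (w + (1 + s) *\<^sub>R h n z w) \<xi>"] g0 M0 k0
      by (intro mult_right_mono mult_mono) (auto simp: A_def)
    moreover have "M (fst \<xi>) * M (fst \<xi>) * A \<le> M (fst \<xi>) * M (fst \<xi>) * (C * norm (G \<xi>) * norm w powr r * B)"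
      using calculation(1) M0 by (intro mult_left_mono) auto
    moreover have "M (fst \<xi>) * M (fst \<xi>) * (C * norm (G \<xi>) * norm w powr r * B) = C * (?W (\<lambda>s. 1 + s) n p + ?W (\<lambda>s. s) n p)"
      by (simp add: p dominating_def B_def power2_eq_square algebra_simps)
    ultimately show ?case by linarith
  qed
  have Wlim: "AE p in coll_space Z'. (\<lambda>n. C * (?W (\<lambda>s. 1 + s) n p + ?W (\<lambda>s. s) n p)) \<longlonglongrightarrow> C * (?W' p + ?W' p)"
    using AE_good_coll
  proof eventually_elim
    case (elim p)
    obtain s z w \<xi> where p: "p = (((s, z), w), \<xi>)" by (metis prod.exhaust)
    have z: "good z" using elim by (simp add: p)
    have "(\<lambda>n. ?W c n p) \<longlonglongrightarrow> ?W' p" for c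
    proof -
      have "(\<lambda>n. cut (snd \<xi> + w + c s *\<^sub>R h n z w)) \<longlonglongrightarrow> cut (snd \<xi> + w + 0)"
        by (intro continuous_on_tendsto_compose[OF cut(1)] tendsto_intros scaled_h_lim[OF z]) auto
      then show ?thesis unfolding p dominating_def dominating_limit_def prod.case by (intro tendsto_intros) simp
    qed
    then show ?case by (intro tendsto_intros)
  qed
  have Wint: "integrable (coll_space Z') (\<lambda>p. C * (?W (\<lambda>s. 1 + s) n p + ?W (\<lambda>s. s) n p))"
    "integrable (coll_space Z') (\<lambda>p. C * (?W' p + ?W' p))" for n
    using Ws(1)[of n] Ws1(1)[of n] Ws(2) by auto
  have WL: "(\<lambda>n. LINT p|coll_space Z'. C * (?W (\<lambda>s. 1 + s) n p + ?W (\<lambda>s. s) n p)) \<longlonglongrightarrow>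
      (LINT p|coll_space Z'. C * (?W' p + ?W' p))"
  proof -
    have "(\<lambda>n. C * ((LINT p|coll_space Z'. ?W (\<lambda>s. 1 + s) n p) + (LINT p|coll_space Z'. ?W (\<lambda>s. s) n p))) \<longlonglongrightarrow>
      C * ((LINT p|coll_space Z'. ?W' p) + (LINT p|coll_space Z'. ?W' p))"
      using Ws(3) Ws1(3) by (intro tendsto_intros) auto
    then show ?thesis using Ws(1,2) Ws1(1) by simp
  qed
  have mL: "(\<lambda>p. L2 (drop_s p)) \<in> borel_measurable (coll_space Z')" by measurable
  note conv = integral_dominated_convergence_converging_bounds[OF measurable_F(2) mL Wint WL lim Wlim bound]
  show "integrable (coll_space Z') (F2 n)" "integrable (coll_space Z') (\<lambda>p. L2 (drop_s p))"
    "(\<lambda>n. LINT p|coll_space Z'. F2 n p) \<longlonglongrightarrow> (LINT p|coll_space Z'. L2 (drop_s p))"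
    by (rule conv)+
qed

end

section \<open>Limit of the collision integral\<close>

lemma integral_exchange:
  fixes F :: "('z \<times> 'a) \<times> ('a::euclidean_space \<times> 'a) \<Rightarrow> real"
  assumes Z: "sigma_finite_measure Z" and F: "integrable (coll_space Z) F"
  shows "integrable (coll_space Z) (\<lambda>((z, w), \<xi>). F ((z, - w), shift (- w) \<xi>))"
    and "(LINT ((z, w), \<xi>)|coll_space Z. F ((z, - w), shift (- w) \<xi>)) = (LINT p|coll_space Z. F p)"
proof -
  let ?E = "\<lambda>((z, w), \<xi>). ((z, - w), shift (- w) \<xi>)"
  have E[measurable]: "?E \<in> measurable (coll_space Z) (coll_space Z :: (('z \<times> 'a) \<times> ('a \<times> 'a)) measure)"
    unfolding case_prod_unfold by measurable
  note [measurable] = borel_measurable_integrable[OF F]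
  have "integrable (coll_space Z) (\<lambda>p. F (?E p))"
    using F by (subst (asm) distr_exchange[OF Z, symmetric]) (simp add: integrable_distr_eq[OF E])
  then show "integrable (coll_space Z) (\<lambda>((z, w), \<xi>). F ((z, - w), shift (- w) \<xi>))"
    by (simp add: case_prod_unfold)
  have "(LINT p|coll_space Z. F p) = (LINT p|distr (coll_space Z) (coll_space Z) ?E. F p)"
    by (subst distr_exchange[OF Z]) simp
  also have "\<dots> = (LINT p|coll_space Z. F (?E p))" by (rule integral_distr[OF E]) measurable
  finally show "(LINT ((z, w), \<xi>)|coll_space Z. F ((z, - w), shift (- w) \<xi>)) = (LINT p|coll_space Z. F p)"
    by (simp add: case_prod_unfold)
qed

context grazing_collisions begin

text \<open>Here the increment of \<open>\<phi>\<close> lives near \<open>\<xi>\<close> and does not confine \<open>w\<close>. The density at the shifted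
  point near \<open>\<xi> - w\<close> takes the place of the weight, and the gradient is estimated by \<open>M\<close>.\<close>

lemma F1_lim:
  shows "integrable (coll_space Z') (F1 n)" "integrable (coll_space Z') (\<lambda>p. L1 (drop_s p))"
    "(\<lambda>n. LINT p|coll_space Z'. F1 n p) \<longlonglongrightarrow> (LINT p|coll_space Z'. L1 (drop_s p))"
proof -
  let ?\<kappa> = "\<lambda>\<xi>. (M (fst \<xi>))\<^sup>2 * g \<xi>"
  note W0 = dominating_limit[OF kappa_g finite_g, of "\<lambda>s. 0"]
  note W1 = dominating_limit[OF kappa_g finite_g, of "\<lambda>s. 1"]
  have Y: "sigma_finite_measure (Z' \<Otimes>\<^sub>M (lborel :: 'a measure))" by (rule sigma_finite_Y')
  have aeY: "AE y in Z' \<Otimes>\<^sub>M (lborel :: 'a measure). good (snd (fst y))"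
    using AE_pair_fst[OF lborel.sigma_finite_measure_axioms AE_Z'] by eventually_elim auto
  define b where "b n = (\<lambda>((s, z), w). - w - s *\<^sub>R h n z w)" for n
  have bm[measurable]: "b n \<in> borel_measurable (Z' \<Otimes>\<^sub>M lborel)" for n
    unfolding b_def case_prod_unfold by measurable
  have gl: "AE (y, \<xi>) in coll_space Z'. (\<lambda>n. g (shift (- snd y - c (fst (fst y)) *\<^sub>R h n (snd (fst y)) (snd y)) \<xi>)) \<longlonglongrightarrow> g (shift (- snd y) \<xi>)"
    if [measurable]: "c \<in> borel_measurable borel" for c
  proof (rule g_shift_lim[OF _ _ Y])
    show "AE y in Z' \<Otimes>\<^sub>M (lborel :: 'a measure).
        (\<lambda>n. - snd y - c (fst (fst y)) *\<^sub>R h n (snd (fst y)) (snd y)) \<longlonglongrightarrow> - snd y"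
      using aeY
    proof eventually_elim
      case (elim y)
      from tendsto_diff[OF tendsto_const[of "- snd y"] scaled_h_lim[OF elim]] show ?case by simp
    qed
  qed measurable
  have lim: "AE p in coll_space Z'. (\<lambda>n. F1 n p) \<longlonglongrightarrow> L1 (drop_s p)"
    using AE_good_coll gl[of "\<lambda>s. s", simplified] gl[of "\<lambda>s. 1 + s", simplified]
  proof eventually_elim
    case (elim p)
    obtain s z w \<xi> where p: "p = (((s, z), w), \<xi>)" by (metis prod.exhaust)
    have z: "good z" and s: "0 \<le> s" "s \<le> 1" using elim(1) by (auto simp: p)
    have d: "(\<lambda>n. (c *\<^sub>R h n z w) /\<^sub>R \<theta> n z) \<longlonglongrightarrow> c *\<^sub>R dir z w" for c
      using tendsto_scaleR[OF tendsto_const[of c] h_direction_lim[OF z, of w]]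
      by (simp add: dir_def mult.commute)
    have "(\<lambda>n. kern n z w * ((\<phi> (shift ((1 - s) *\<^sub>R h n z w) \<xi>) - \<phi> (shift (- s *\<^sub>R h n z w) \<xi>)) * (h n z w \<bullet> G \<xi>)))
      \<longlonglongrightarrow> norm w powr \<gamma> * ((D \<xi> \<bullet> ((1 - s) *\<^sub>R dir z w - (- s) *\<^sub>R dir z w)) * (dir z w \<bullet> G \<xi>))"
      by (rule kern_increment_lim[OF z d d])
    moreover have "(1 - s) *\<^sub>R dir z w - (- s) *\<^sub>R dir z w = dir z w" by (simp add: algebra_simps)
    ultimately have k: "(\<lambda>n. kern n z w * ((\<phi> (shift ((1 - s) *\<^sub>R h n z w) \<xi>) - \<phi> (shift (- s *\<^sub>R h n z w) \<xi>)) * (h n z w \<bullet> G \<xi>)))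
      \<longlonglongrightarrow> norm w powr \<gamma> * ((D \<xi> \<bullet> dir z w) * (dir z w \<bullet> G \<xi>))"
      by simp
    have g1: "(\<lambda>n. g (shift (- w - s *\<^sub>R h n z w) \<xi>)) \<longlonglongrightarrow> g (shift (- w) \<xi>)"
      and g2: "(\<lambda>n. g (shift (- w - (1 + s) *\<^sub>R h n z w) \<xi>)) \<longlonglongrightarrow> g (shift (- w) \<xi>)"
      using elim(2,3) by (auto simp: p)
    from tendsto_mult[OF tendsto_mult[OF g1 g2] k] show ?case
      unfolding p F1_def L1_def drop_s_def prod.case power2_eq_square .
  qed
  \<comment> \<open>The shift depends on the collision parameters alone, so the integrals of the shifted weights
    are those of the weights.\<close>
  define W where "W n = (\<lambda>(y, \<xi>). C * (dominating ?\<kappa> (\<lambda>s. 1) n (y, shift (b n y) \<xi>) + dominating ?\<kappa> (\<lambda>s. 0) n (y, shift (b n y) \<xi>)))" for n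
  define W' where "W' = (\<lambda>(y, \<xi>). C * (dominating_limit ?\<kappa> (y, shift (- snd y) \<xi>) + dominating_limit ?\<kappa> (y, shift (- snd y) \<xi>)))"
  have bound: "AE p in coll_space Z'. \<bar>F1 n p\<bar> \<le> W n p" for n
    using AE_good_coll
  proof eventually_elim
    case (elim p)
    obtain s z w \<xi> where p: "p = (((s, z), w), \<xi>)" by (metis prod.exhaust)
    have z: "good z" using elim by (simp add: p)
    define A where "A = kern n z w * \<bar>(\<phi> (shift ((1 - s) *\<^sub>R h n z w) \<xi>) - \<phi> (shift (- s *\<^sub>R h n z w) \<xi>)) * (h n z w \<bullet> G \<xi>)\<bar>"
    define B where "B = cut (snd \<xi> + (1 - s) *\<^sub>R h n z w) + cut (snd \<xi> + - s *\<^sub>R h n z w)"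
    define g1 where "g1 = g (shift (- w - s *\<^sub>R h n z w) \<xi>)"
    have k0: "0 \<le> kern n z w" by (simp add: kern_def)
    have B0: "0 \<le> B" using cut(2) by (simp add: B_def)
    have "A \<le> C * norm (G \<xi>) * norm w powr r * B"
      unfolding A_def B_def by (rule kern_increment_bound[OF z]) (simp add: algebra_simps)
    also have "\<dots> \<le> C * M (fst \<xi>) * norm w powr r * B"
      using C GM B0 by (intro mult_right_mono mult_left_mono) auto
    finally have A: "A \<le> C * M (fst \<xi>) * norm w powr r * B" .
    have "\<bar>F1 n p\<bar> = g1 * g (shift (- w - (1 + s) *\<^sub>R h n z w) \<xi>) * A"
      unfolding p F1_def prod.case A_def g1_def using k0 g0 by (simp add: abs_mult)
    also have "\<dots> \<le> g1 * M (fst \<xi>) * A"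
      using gM[of "shift (- w - (1 + s) *\<^sub>R h n z w) \<xi>"] g0 M0 k0
      by (intro mult_right_mono mult_left_mono) (auto simp: A_def g1_def)
    also have "\<dots> \<le> g1 * M (fst \<xi>) * (C * M (fst \<xi>) * norm w powr r * B)"
      using A M0 g0 by (intro mult_left_mono) (auto simp: g1_def)
    also have "\<dots> = W n p"
    proof -
      have "snd (shift (- w - s *\<^sub>R h n z w) \<xi>) + w + 1 *\<^sub>R h n z w = snd \<xi> + (1 - s) *\<^sub>R h n z w"
        "snd (shift (- w - s *\<^sub>R h n z w) \<xi>) + w + 0 *\<^sub>R h n z w = snd \<xi> + - s *\<^sub>R h n z w"
        by (simp_all add: algebra_simps)
      then have "W n p = C * ((M (fst \<xi>))\<^sup>2 * g1 * norm w powr r * cut (snd \<xi> + (1 - s) *\<^sub>R h n z w) +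
          (M (fst \<xi>))\<^sup>2 * g1 * norm w powr r * cut (snd \<xi> + - s *\<^sub>R h n z w))"
        unfolding p W_def b_def dominating_def prod.case g1_def fst_shift by (simp only:)
      then show ?thesis by (simp add: B_def power2_eq_square algebra_simps)
    qed
    finally show ?case .
  qed
  have Wlim: "AE p in coll_space Z'. (\<lambda>n. W n p) \<longlonglongrightarrow> W' p"
    using AE_good_coll gl[of "\<lambda>s. s", simplified]
  proof eventually_elim
    case (elim p)
    obtain s z w \<xi> where p: "p = (((s, z), w), \<xi>)" by (metis prod.exhaust)
    have z: "good z" and g1: "(\<lambda>n. g (shift (- w - s *\<^sub>R h n z w) \<xi>)) \<longlonglongrightarrow> g (shift (- w) \<xi>)"
      using elim by (auto simp: p)
    have c: "(\<lambda>n. cut (snd (shift (- w - s *\<^sub>R h n z w) \<xi>) + w + c *\<^sub>R h n z w)) \<longlonglongrightarrow> cut (snd (shift (- w) \<xi>) + w)" for c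
    proof -
      have "(\<lambda>n. snd (shift (- w - s *\<^sub>R h n z w) \<xi>) + w + c *\<^sub>R h n z w) \<longlonglongrightarrow> (snd \<xi> + (- w - 0)) + w + 0"
        unfolding snd_add snd_conv by (intro tendsto_intros scaled_h_lim[OF z])
      then show ?thesis
        using cut(1) by (intro continuous_on_tendsto_compose[OF cut(1)]) auto
    qed
    show ?case
      unfolding p W_def W'_def b_def dominating_def dominating_limit_def prod.case snd_conv fst_shift
      by (intro tendsto_mult tendsto_add tendsto_const g1 c)
  qed
  have Wi: "integrable (coll_space Z') (W n)" "(LINT p|coll_space Z'. W n p) =
      C * ((LINT p|coll_space Z'. dominating ?\<kappa> (\<lambda>s. 1) n p) + (LINT p|coll_space Z'. dominating ?\<kappa> (\<lambda>s. 0) n p))" for n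
    unfolding W_def
    using integral_shift[OF bm[of n] Y W1(1)[of n]] integral_shift[OF bm[of n] Y W0(1)[of n]]
    by (auto simp: case_prod_unfold)
  have W'i: "integrable (coll_space Z') W'" "(LINT p|coll_space Z'. W' p) =
      C * ((LINT p|coll_space Z'. dominating_limit ?\<kappa> p) + (LINT p|coll_space Z'. dominating_limit ?\<kappa> p))"
    unfolding W'_def
    using integral_shift[of "\<lambda>y. - snd y", OF _ Y W0(2)] by (auto simp: case_prod_unfold)
  have WL: "(\<lambda>n. LINT p|coll_space Z'. W n p) \<longlonglongrightarrow> (LINT p|coll_space Z'. W' p)"
    unfolding Wi(2) W'i(2) using W0(3) W1(3) by (intro tendsto_intros) auto
  have mL: "(\<lambda>p. L1 (drop_s p)) \<in> borel_measurable (coll_space Z')" by measurable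
  note conv = integral_dominated_convergence_converging_bounds[OF measurable_F(1) mL Wi(1) W'i(1) WL lim Wlim bound]
  show "integrable (coll_space Z') (F1 n)" "integrable (coll_space Z') (\<lambda>p. L1 (drop_s p))"
    "(\<lambda>n. LINT p|coll_space Z'. F1 n p) \<longlonglongrightarrow> (LINT p|coll_space Z'. L1 (drop_s p))"
    by (rule conv)+
qed

lemma integral_drop_s:
  fixes F :: "('z \<times> 'a) \<times> ('a \<times> 'a) \<Rightarrow> real"
  assumes "integrable (coll_space Z') (\<lambda>p. F (drop_s p))"
  shows "integrable (coll_space Z) F" "(LINT p|coll_space Z'. F (drop_s p)) = (LINT p|coll_space Z. F p)"
  using integral_segment[OF sigma_finite_Z assms]
  by (auto simp: drop_s_def case_prod_unfold U.prob_space[simplified])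

lemma L_integrable: "integrable (coll_space Z) L1" "integrable (coll_space Z) L2"
  using integral_drop_s[OF F1_lim(2)] integral_drop_s[OF F2_lim(2)] by auto

text \<open>The product of \<open>f f\<^sub>* (f' + f'\<^sub>*) - (f + f\<^sub>*) f' f'\<^sub>*\<close> with the increment \<open>\<phi>' - \<phi>\<close> of the first
  particle is \<open>- T1 - T2\<close>, up to the kernel.\<close>

definition T1 :: "nat \<Rightarrow> ('z \<times> 'a) \<times> ('a \<times> 'a) \<Rightarrow> real" where
  "T1 n = (\<lambda>((z, w), \<xi>). kern n z w * (g (shift (- w) \<xi>) * g (shift (- w - h n z w) \<xi>) *
     (g (shift (h n z w) \<xi>) - g \<xi>) * (\<phi> (shift (h n z w) \<xi>) - \<phi> \<xi>)))"

definition T2 :: "nat \<Rightarrow> ('z \<times> 'a) \<times> ('a \<times> 'a) \<Rightarrow> real" where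
  "T2 n = (\<lambda>((z, w), \<xi>). kern n z w * (g \<xi> * g (shift (h n z w) \<xi>) *
     (g (shift (- w - h n z w) \<xi>) - g (shift (- w) \<xi>)) * (\<phi> (shift (h n z w) \<xi>) - \<phi> \<xi>)))"

lemma measurable_T[measurable]:
  "T1 n \<in> borel_measurable (coll_space Z)" "T2 n \<in> borel_measurable (coll_space Z)"
  unfolding T1_def T2_def case_prod_unfold kern_def by measurable

text \<open>Undoing the shift in \<open>F1\<close> and integrating along the segment restores the increment of the
  density.\<close>

lemma T1_lim:
  shows "integrable (coll_space Z) (T1 n)"
    and "(\<lambda>n. LINT p|coll_space Z. T1 n p) \<longlonglongrightarrow> (LINT p|coll_space Z. L1 p)"
proof -
  define c where "c n = (\<lambda>y. fst (fst y) *\<^sub>R h n (snd (fst y)) (snd y))" for n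
  have [measurable]: "c n \<in> borel_measurable (Z' \<Otimes>\<^sub>M lborel)" for n unfolding c_def by measurable
  note S = integral_shift[OF _ sigma_finite_Y' F1_lim(1), of "c n" n for n]
  have eq: "AE p in coll_space Z. (case p of ((z, w), \<xi>) \<Rightarrow> LINT s|unit_uniform.
      (case (((s, z), w), \<xi>) of (y, \<xi>) \<Rightarrow> F1 n (y, shift (c n y) \<xi>))) = T1 n p" for n
  proof -
    have m: "(\<lambda>y. h n (fst y) (snd y)) \<in> borel_measurable (Z \<Otimes>\<^sub>M lborel)" by measurable
    show ?thesis
      using segment_AE[OF m sigma_finite_Y]
    proof eventually_elim
      case (elim p)
      obtain z w \<xi> where p: "p = ((z, w), \<xi>)" by (metis prod.exhaust)
      have "F1 n (((s, z), w), shift (c n ((s, z), w)) \<xi>) =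
        g (shift (- w) \<xi>) * g (shift (- w - h n z w) \<xi>) * (kern n z w * (\<phi> (shift (h n z w) \<xi>) - \<phi> \<xi>)) *
         (h n z w \<bullet> G (shift (s *\<^sub>R h n z w) \<xi>))" for s
      proof -
        have e1: "- w - s *\<^sub>R h n z w + s *\<^sub>R h n z w = - w"
          "- w - (1 + s) *\<^sub>R h n z w + s *\<^sub>R h n z w = - w - h n z w"
          "(1 - s) *\<^sub>R h n z w + s *\<^sub>R h n z w = h n z w"
          "- s *\<^sub>R h n z w + s *\<^sub>R h n z w = 0"
          by (simp_all add: algebra_simps)
        show ?thesis
          unfolding F1_def prod.case c_def fst_conv snd_conv shift_shift e1
          by (simp add: zero_prod_def[symmetric] mult_ac)
      qed
      then show ?case
        using elim unfolding p prod.case T1_def by (simp add: mult_ac)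
    qed
  qed
  note seg = integral_segment[OF sigma_finite_Z S(1)]
  show int: "integrable (coll_space Z) (T1 n)" for n
    by (rule integrable_cong_AE_imp[OF seg(1)[of n] measurable_T(1)]) (use eq[of n] in \<open>auto simp: eq_commute case_prod_unfold\<close>)
  have "(LINT p|coll_space Z. T1 n p) = (LINT p|coll_space Z'. F1 n p)" for n
  proof -
    have "(LINT p|coll_space Z. T1 n p) = (LINT p|coll_space Z. (case p of ((z, w), \<xi>) \<Rightarrow> LINT s|unit_uniform.
      (case (((s, z), w), \<xi>) of (y, \<xi>) \<Rightarrow> F1 n (y, shift (c n y) \<xi>))))"
      using eq[of n] borel_measurable_integrable[OF seg(1)[of n]]
      by (intro integral_cong_AE) (auto simp: eq_commute case_prod_unfold)
    then show ?thesis using seg(2)[of n] S(2)[of n] by (simp add: case_prod_unfold)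
  qed
  then show "(\<lambda>n. LINT p|coll_space Z. T1 n p) \<longlonglongrightarrow> (LINT p|coll_space Z. L1 p)"
    using F1_lim(3) integral_drop_s(2)[OF F1_lim(2)] by simp
qed

lemma T2_lim:
  shows "integrable (coll_space Z) (T2 n)"
    and "(\<lambda>n. LINT p|coll_space Z. T2 n p) \<longlonglongrightarrow> (LINT p|coll_space Z. L2 p)"
proof -
  define c where "c n = (\<lambda>y. - snd y - fst (fst y) *\<^sub>R h n (snd (fst y)) (snd y))" for n
  have [measurable]: "c n \<in> borel_measurable (Z' \<Otimes>\<^sub>M lborel)" for n unfolding c_def by measurable
  note S = integral_shift[OF _ sigma_finite_Y' F2_lim(1), of "c n" n for n]
  have eq: "AE p in coll_space Z. (case p of ((z, w), \<xi>) \<Rightarrow> LINT s|unit_uniform.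
      (case (((s, z), w), \<xi>) of (y, \<xi>) \<Rightarrow> F2 n (y, shift (c n y) \<xi>))) = T2 n p" for n
  proof -
    have m: "(\<lambda>y. - h n (fst y) (snd y)) \<in> borel_measurable (Z \<Otimes>\<^sub>M lborel)"
      "(\<lambda>y. - snd y) \<in> borel_measurable (Z \<Otimes>\<^sub>M (lborel :: 'a measure))" by measurable
    show ?thesis
      using AE_shift[OF m(2) sigma_finite_Y segment_AE[OF m(1) sigma_finite_Y]]
    proof eventually_elim
      case (elim p)
      obtain z w \<xi> where p: "p = ((z, w), \<xi>)" by (metis prod.exhaust)
      have "F2 n (((s, z), w), shift (c n ((s, z), w)) \<xi>) =
        g \<xi> * g (shift (h n z w) \<xi>) * (kern n z w * (\<phi> (shift (h n z w) \<xi>) - \<phi> \<xi>)) *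
         (- h n z w \<bullet> G (shift (s *\<^sub>R - h n z w + - w) \<xi>))" for s
      proof -
        have e1: "w + s *\<^sub>R h n z w + (- w - s *\<^sub>R h n z w) = 0"
          "w + (1 + s) *\<^sub>R h n z w + (- w - s *\<^sub>R h n z w) = h n z w"
          "s *\<^sub>R - h n z w + - w = - w - s *\<^sub>R h n z w"
          by (simp_all add: algebra_simps)
        show ?thesis
          unfolding F2_def prod.case c_def fst_conv snd_conv shift_shift e1
          by (simp add: zero_prod_def[symmetric] mult_ac)
      qed
      moreover have e2: "- w - h n z w = - h n z w + - w" by simp
      ultimately show ?case
        using elim unfolding p prod.case T2_def fst_conv snd_conv shift_shift e2 by simp
    qed
  qed
  note seg = integral_segment[OF sigma_finite_Z S(1)]
  show int: "integrable (coll_space Z) (T2 n)" for n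
    by (rule integrable_cong_AE_imp[OF seg(1)[of n] measurable_T(2)]) (use eq[of n] in \<open>auto simp: eq_commute case_prod_unfold\<close>)
  have "(LINT p|coll_space Z. T2 n p) = (LINT p|coll_space Z'. F2 n p)" for n
  proof -
    have "(LINT p|coll_space Z. T2 n p) = (LINT p|coll_space Z. (case p of ((z, w), \<xi>) \<Rightarrow> LINT s|unit_uniform.
      (case (((s, z), w), \<xi>) of (y, \<xi>) \<Rightarrow> F2 n (y, shift (c n y) \<xi>))))"
      using eq[of n] borel_measurable_integrable[OF seg(1)[of n]]
      by (intro integral_cong_AE) (auto simp: eq_commute case_prod_unfold)
    then show ?thesis using seg(2)[of n] S(2)[of n] by (simp add: case_prod_unfold)
  qed
  then show "(\<lambda>n. LINT p|coll_space Z. T2 n p) \<longlonglongrightarrow> (LINT p|coll_space Z. L2 p)"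
    using F2_lim(3) integral_drop_s(2)[OF F2_lim(2)] by simp
qed

text \<open>Off this hyperplane the frame is odd in \<open>w\<close>.\<close>

lemma AE_off_hyperplane: "AE ((z, w), \<xi>) in (coll_space Z :: (('z \<times> 'a) \<times> ('a \<times> 'a)) measure). w \<bullet> e \<noteq> 0"
proof -
  have "e \<noteq> 0" using e by auto
  then have "negligible {w. e \<bullet> w = 0}" by (intro negligible_hyperplane) auto
  moreover have "{w. e \<bullet> w = 0} \<in> sets borel" by measurable
  ultimately have "{w. e \<bullet> w = 0} \<in> null_sets lborel"
    by (simp add: negligible_iff_null_sets null_sets_def)
  then have "AE w in lborel. w \<bullet> e \<noteq> 0"
    using AE_not_in by (fastforce simp: inner_commute)
  from AE_pair_fst[OF lborel.sigma_finite_measure_axioms AE_pair_snd[OF lborel.sigma_finite_measure_axioms this]]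
  show ?thesis by (simp add: case_prod_unfold)
qed

text \<open>The collision integrand and its limit. Both split into a term and the image of that term
  under the exchange of the two particles, so their integrals are twice those of the terms.\<close>

definition coll :: "nat \<Rightarrow> ('z \<times> 'a) \<times> ('a \<times> 'a) \<Rightarrow> real" where
  "coll n = (\<lambda>((z, w), \<xi>). kern n z w *
     ((g \<xi> * g (shift (- w) \<xi>) * (g (shift (h n z w) \<xi>) + g (shift (- w - h n z w) \<xi>))
       - (g \<xi> + g (shift (- w) \<xi>)) * (g (shift (h n z w) \<xi>) * g (shift (- w - h n z w) \<xi>))) *
      (\<phi> (shift (h n z w) \<xi>) + \<phi> (shift (- w - h n z w) \<xi>) - \<phi> (shift (- w) \<xi>) - \<phi> \<xi>)))"

definition grazing_limit :: "('z \<times> 'a) \<times> ('a \<times> 'a) \<Rightarrow> real" where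
  "grazing_limit = (\<lambda>((z, w), \<xi>). norm w powr \<gamma> *
     ((dir z w \<bullet> (- ((g (shift (- w) \<xi>))\<^sup>2 *\<^sub>R G \<xi>) + (g \<xi>)\<^sup>2 *\<^sub>R G (shift (- w) \<xi>))) *
      (dir z w \<bullet> (D \<xi> - D (shift (- w) \<xi>)))))"

lemma coll_lim:
  shows "integrable (coll_space Z) (coll n)" "integrable (coll_space Z) grazing_limit"
    and "(\<lambda>n. LINT p|coll_space Z. coll n p) \<longlonglongrightarrow> (LINT p|coll_space Z. grazing_limit p)"
proof -
  define H where "H n p = - T1 n p - T2 n p" for n p
  have Hint: "integrable (coll_space Z) (H n)" for n unfolding H_def using T1_lim(1) T2_lim(1) by auto
  have Hlim: "(\<lambda>n. LINT p|coll_space Z. H n p) \<longlonglongrightarrow> - (LINT p|coll_space Z. L1 p) - (LINT p|coll_space Z. L2 p)"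
  proof -
    have "(LINT p|coll_space Z. H n p) = - (LINT p|coll_space Z. T1 n p) - (LINT p|coll_space Z. T2 n p)" for n
      unfolding H_def using T1_lim(1) T2_lim(1) by simp
    then show ?thesis using T1_lim(2) T2_lim(2) by (auto intro!: tendsto_intros)
  qed
  have [measurable]: "coll n \<in> borel_measurable (coll_space Z)" "grazing_limit \<in> borel_measurable (coll_space Z)" for n
    unfolding coll_def grazing_limit_def case_prod_unfold kern_def dir_def by measurable
  note HE = integral_exchange[OF sigma_finite_Z Hint]
  have split: "AE p in coll_space Z. H n p + (\<lambda>((z, w), \<xi>). H n ((z, - w), shift (- w) \<xi>)) p = coll n p" for n
    using AE_off_hyperplane
  proof eventually_elim
    case (elim p)
    obtain z w \<xi> where p: "p = ((z, w), \<xi>)" by (metis prod.exhaust)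
    have hm: "h n z (- w) = - h n z w" using elim by (intro dev_minus) (simp add: p)
    have km: "kern n z (- w) = kern n z w" by (simp add: kern_def)
    have e1: "- (- w) + - w = 0" "- (- w) - - h n z w + - w = h n z w" "- h n z w + - w = - w - h n z w" by simp_all
    show ?case
      unfolding p prod.case H_def T1_def T2_def coll_def hm km shift_shift e1
      by (simp add: zero_prod_def[symmetric]) (simp add: algebra_simps)
  qed
  show "integrable (coll_space Z) (coll n)" for n
    by (rule integrable_cong_AE_imp[OF Bochner_Integration.integrable_add[OF Hint HE(1)[of n]]])
       (use split[of n] in \<open>auto simp: eq_commute\<close>)
  have I1: "(LINT p|coll_space Z. coll n p) = 2 * (LINT p|coll_space Z. H n p)" for n
  proof -
    have "(LINT p|coll_space Z. coll n p) = (LINT p|coll_space Z. H n p + (\<lambda>((z, w), \<xi>). H n ((z, - w), shift (- w) \<xi>)) p)"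
      using split[of n] borel_measurable_integrable[OF Hint[of n]] borel_measurable_integrable[OF HE(1)[of n]]
      by (intro integral_cong_AE) (auto simp: eq_commute)
    also have "\<dots> = (LINT p|coll_space Z. H n p) + (LINT p|coll_space Z. H n p)"
      using Bochner_Integration.integral_add[OF Hint[of n] HE(1)[of n]] HE(2)[of n] by simp
    finally show ?thesis by simp
  qed
  define K where "K = (\<lambda>(y, \<xi>). - L1 (y, \<xi>) - L2 (y, shift (- snd y) \<xi>))"
  have m: "(\<lambda>y. - snd y) \<in> borel_measurable (Z \<Otimes>\<^sub>M (lborel :: 'a measure))" by measurable
  note LS = integral_shift[OF m sigma_finite_Y L_integrable(2)]
  have Kint: "integrable (coll_space Z) K"
    unfolding K_def using LS(1) L_integrable(1) by (auto simp: case_prod_unfold)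
  have KI: "(LINT p|coll_space Z. K p) = - (LINT p|coll_space Z. L1 p) - (LINT p|coll_space Z. L2 p)"
    unfolding K_def using LS L_integrable(1) by (simp add: case_prod_unfold)
  note KE = integral_exchange[OF sigma_finite_Z Kint]
  have split': "AE p in coll_space Z. K p + (\<lambda>((z, w), \<xi>). K ((z, - w), shift (- w) \<xi>)) p = grazing_limit p"
    using AE_off_hyperplane
  proof eventually_elim
    case (elim p)
    obtain z w \<xi> where p: "p = ((z, w), \<xi>)" by (metis prod.exhaust)
    have dm: "dir z (- w) = - dir z w" using elim by (simp add: dir_def frame_minus p)
    have e1: "- (- w) + - w = 0" "w + - w = 0" "- w + (- (- w) + - w) = - w" by simp_all
    show ?case
      unfolding p prod.case K_def L1_def L2_def grazing_limit_def dm shift_shift snd_conv e1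
      by (simp add: zero_prod_def[symmetric] inner_add_right inner_diff_right inner_commute[of "D _"])
         (simp add: algebra_simps)
  qed
  show "integrable (coll_space Z) grazing_limit"
    by (rule integrable_cong_AE_imp[OF Bochner_Integration.integrable_add[OF Kint KE(1)]])
       (use split' in \<open>auto simp: eq_commute\<close>)
  have I2: "(LINT p|coll_space Z. grazing_limit p) = 2 * (LINT p|coll_space Z. K p)"
  proof -
    have "(LINT p|coll_space Z. grazing_limit p) = (LINT p|coll_space Z. K p + (\<lambda>((z, w), \<xi>). K ((z, - w), shift (- w) \<xi>)) p)"
      using split' borel_measurable_integrable[OF Kint] borel_measurable_integrable[OF KE(1)]
      by (intro integral_cong_AE) (auto simp: eq_commute)
    also have "\<dots> = (LINT p|coll_space Z. K p) + (LINT p|coll_space Z. K p)"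
      using Bochner_Integration.integral_add[OF Kint KE(1)] KE(2) by simp
    finally show ?thesis by simp
  qed
  show "(\<lambda>n. LINT p|coll_space Z. coll n p) \<longlonglongrightarrow> (LINT p|coll_space Z. grazing_limit p)"
    unfolding I1 I2 KI by (intro tendsto_intros Hlim)
qed

end

section \<open>Test functions on phase space\<close>

text \<open>An increment of a test function vanishes unless one of its two endpoints has velocity in a fixed
  ball. The cutoff is continuous, so that it passes to the limit together with its argument.\<close>

lemma test_function_data:
  fixes \<phi> :: "'a::euclidean_space \<times> 'a \<Rightarrow> real"
  assumes \<phi>: "\<phi> \<in> Cc_infty"
  obtains C R :: real and cut :: "'a \<Rightarrow> real" where
    "0 \<le> C" "0 \<le> R" "continuous_on UNIV cut" "\<And>v. 0 \<le> cut v \<and> cut v \<le> 1" "\<And>v. cut v \<noteq> 0 \<Longrightarrow> norm v \<le> R"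
    "\<And>\<xi> a b. \<bar>\<phi> (shift a \<xi>) - \<phi> (shift b \<xi>)\<bar> \<le> C * norm (a - b) * (cut (snd \<xi> + a) + cut (snd \<xi> + b))"
proof -
  obtain B where B: "B \<ge> 0" "\<And>z. norm (grad \<phi> z) \<le> B"
    using continuous_bounded_support_bound[OF C_k_grad(1)[OF Cc_inftyD(1)[OF \<phi>]] grad_test_support[OF \<phi>]] by blast
  obtain R where R: "\<And>z. \<phi> z \<noteq> 0 \<Longrightarrow> norm z \<le> R"
    using Cc_inftyD(2)[OF \<phi>] unfolding bounded_iff by blast
  have lip: "\<bar>\<phi> y - \<phi> x\<bar> \<le> B * norm (y - x)" for x y
  proof -
    have "norm (\<phi> y - \<phi> x) \<le> B * norm (y - x)"
    proof (rule differentiable_bound[of UNIV \<phi> "\<lambda>z y. grad \<phi> z \<bullet> y"])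
      show "(\<phi> has_derivative (\<lambda>y. grad \<phi> z \<bullet> y)) (at z within UNIV)" for z
        using C_k_grad(2)[OF Cc_inftyD(1)[OF \<phi>]] by simp
      show "onorm (\<lambda>y. grad \<phi> z \<bullet> y) \<le> B" for z
      proof (rule onorm_le)
        fix y
        have "norm (grad \<phi> z \<bullet> y) \<le> norm (grad \<phi> z) * norm y" using Cauchy_Schwarz_ineq2 by simp
        also have "\<dots> \<le> B * norm y" using B by (intro mult_right_mono) auto
        finally show "norm (grad \<phi> z \<bullet> y) \<le> B * norm y" .
      qed
    qed auto
    then show ?thesis by simp
  qed
  define cut :: "'a \<Rightarrow> real" where "cut v = max 0 (min 1 (\<bar>R\<bar> + 1 - norm v))" for v
  have c1: "cut v = 1" if "\<phi> (x, v) \<noteq> 0" for x v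
  proof -
    have "norm v \<le> norm (x, v)" using norm_snd_le[of v x] by simp
    then show ?thesis using R[OF that] by (simp add: cut_def)
  qed
  show ?thesis
  proof (rule that[of B "\<bar>R\<bar> + 1" cut])
    show "continuous_on UNIV cut" unfolding cut_def by (intro continuous_intros)
    show c01: "0 \<le> cut v \<and> cut v \<le> 1" for v by (simp add: cut_def)
    show "norm v \<le> \<bar>R\<bar> + 1" if "cut v \<noteq> 0" for v using that by (auto simp: cut_def max_def min_def split: if_splits)
    fix \<xi> :: "'a \<times> 'a" and a b
    obtain x v where \<xi>: "\<xi> = (x, v)" by (cases \<xi>)
    show "\<bar>\<phi> (shift a \<xi>) - \<phi> (shift b \<xi>)\<bar> \<le> B * norm (a - b) * (cut (snd \<xi> + a) + cut (snd \<xi> + b))"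
    proof (cases "\<phi> (shift a \<xi>) = 0 \<and> \<phi> (shift b \<xi>) = 0")
      case True
      then show ?thesis using B c01 by (simp add: add_nonneg_nonneg)
    next
      case False
      then have "cut (snd \<xi> + a) = 1 \<or> cut (snd \<xi> + b) = 1" using c1 by (auto simp: \<xi>)
      then have c: "1 \<le> cut (snd \<xi> + a) + cut (snd \<xi> + b)" using c01[of "snd \<xi> + a"] c01[of "snd \<xi> + b"] by auto
      have "\<bar>\<phi> (shift a \<xi>) - \<phi> (shift b \<xi>)\<bar> \<le> B * norm (a - b)"
        using lip[of "shift a \<xi>" "shift b \<xi>"] by (simp add: \<xi> norm_Pair)
      also have "\<dots> \<le> B * norm (a - b) * (cut (snd \<xi> + a) + cut (snd \<xi> + b))"
        using mult_left_mono[OF c, of "B * norm (a - b)"] B by simp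
      finally show ?thesis .
    qed
  qed (use B(1) in auto)
qed

lemma test_function_velocity_derivative:
  fixes \<phi> :: "'a::euclidean_space \<times> 'a \<Rightarrow> real"
  assumes \<phi>: "\<phi> \<in> Cc_infty"
  shows "((\<lambda>v. \<phi> (shift v \<xi>)) has_derivative (\<lambda>v. snd (grad \<phi> \<xi>) \<bullet> v)) (at 0)"
    and "grad (\<lambda>u. \<phi> (x, u)) v = snd (grad \<phi> (x, v))"
proof -
  have d: "(\<phi> has_derivative (\<lambda>y. grad \<phi> z \<bullet> y)) (at z)" for z
    by (rule C_k_grad(2)[OF Cc_inftyD(1)[OF \<phi>]])
  have i: "grad \<phi> z \<bullet> (0, y) = snd (grad \<phi> z) \<bullet> y" for z y by (simp add: inner_prod_def)
  have "((\<lambda>v. \<phi> (shift v \<xi>)) has_derivative (\<lambda>v. grad \<phi> (shift 0 \<xi>) \<bullet> (0, v))) (at 0)"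
    by (rule has_derivative_compose[OF _ d]) (auto intro!: derivative_eq_intros)
  then show "((\<lambda>v. \<phi> (shift v \<xi>)) has_derivative (\<lambda>v. snd (grad \<phi> \<xi>) \<bullet> v)) (at 0)"
    by (simp add: i zero_prod_def[symmetric])
  have "((\<lambda>u. \<phi> (x, u)) has_derivative (\<lambda>u. grad \<phi> (x, v) \<bullet> (0, u))) (at v)"
    by (rule has_derivative_compose[OF _ d]) (auto intro!: derivative_eq_intros)
  note D = grad_eq(2)[OF this]
  have "grad (\<lambda>u. \<phi> (x, u)) v \<bullet> y = snd (grad \<phi> (x, v)) \<bullet> y" for y
    by (subst D) (rule i)
  then show "grad (\<lambda>u. \<phi> (x, u)) v = snd (grad \<phi> (x, v))" using vector_eq_rdot by blast
qed

section \<open>Borel data of a density\<close>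

lemma completion_ex_borel_measurable_euclidean:
  fixes G :: "'x \<Rightarrow> 'b::euclidean_space"
  assumes "G \<in> borel_measurable (completion M)"
  shows "\<exists>G'\<in>borel_measurable M. AE x in M. G x = G' x"
proof -
  have "\<forall>b\<in>Basis. \<exists>c. c \<in> borel_measurable M \<and> (AE x in M. G x \<bullet> b = c x)"
    using assms by (auto intro!: completion_ex_borel_measurable_real[unfolded Bex_def])
  then obtain c where c: "\<And>b. b \<in> Basis \<Longrightarrow> c b \<in> borel_measurable M \<and> (AE x in M. G x \<bullet> b = c b x)"
    by metis
  have "AE x in M. \<forall>b\<in>Basis. G x \<bullet> b = c b x"
    using c by (simp add: AE_finite_all)
  then have "AE x in M. G x = (\<Sum>b\<in>Basis. c b x *\<^sub>R b)"
    by eventually_elim (metis (no_types, lifting) euclidean_representation sum.cong)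
  moreover have "(\<lambda>x. \<Sum>b\<in>Basis. c b x *\<^sub>R b) \<in> borel_measurable M"
    using c by (intro borel_measurable_sum borel_measurable_scaleR) auto
  ultimately show ?thesis by (rule bexI)
qed

lemma AE_lborel_pair:
  fixes P :: "'a::euclidean_space \<Rightarrow> 'b::euclidean_space \<Rightarrow> bool"
  assumes "AE \<xi> in lborel. P (fst \<xi>) (snd \<xi>)"
  shows "AE x in lborel. AE v in lborel. P x v"
proof -
  have "AE \<xi> in (lborel :: 'a measure) \<Otimes>\<^sub>M (lborel :: 'b measure). P (fst \<xi>) (snd \<xi>)"
    using assms by (simp only: lborel_prod)
  from lborel_pair.AE_pair[OF this] show ?thesis by simp
qed

lemma AE_lborel_pairI:
  fixes P :: "'a::euclidean_space \<Rightarrow> 'b::euclidean_space \<Rightarrow> bool"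
  assumes m: "{\<xi>. P (fst \<xi>) (snd \<xi>)} \<in> sets borel"
    and ae: "AE x in lborel. AE v in lborel. P x v"
  shows "AE \<xi> in lborel. P (fst \<xi>) (snd \<xi>)"
proof -
  have "AE \<xi> in (lborel :: 'a measure) \<Otimes>\<^sub>M (lborel :: 'b measure). P (fst \<xi>) (snd \<xi>)"
  proof (rule lborel_pair.AE_pair_measure)
    show "{\<xi> \<in> space ((lborel :: 'a measure) \<Otimes>\<^sub>M (lborel :: 'b measure)). P (fst \<xi>) (snd \<xi>)}
        \<in> sets (lborel \<Otimes>\<^sub>M lborel)"
      unfolding lborel_prod using m by simp
  qed (use ae in simp)
  then show ?thesis by (simp only: lborel_prod)
qed

text \<open>The product rule transfers the weighted bound from \<open>\<nabla> (\<langle>v\<rangle>\<^sup>s u)\<close> to \<open>\<langle>v\<rangle>\<^sup>s \<nabla> u\<close>.\<close>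

lemma weighted_gradient_bound:
  fixes u :: "'a::euclidean_space \<Rightarrow> real"
  assumes w: "has_weak_grad u G" and s: "0 \<le> s"
  shows "(\<integral>\<^sup>+v. ennreal (jap v powr s * \<bar>u v\<bar>) \<partial>lebesgue) \<le> W11w_norm s u"
    and "(\<integral>\<^sup>+v. ennreal (jap v powr s * norm (G v)) \<partial>lebesgue) \<le> ennreal (1 + s) * W11w_norm s u"
proof -
  have [measurable]: "u \<in> borel_measurable lebesgue" "G \<in> borel_measurable lebesgue"
    using w by (auto simp: has_weak_grad_def intro: locally_integrable_measurable)
  have ja: "continuous_on UNIV (\<lambda>v :: 'a. jap v powr s)" by (rule C_k_continuous[OF C_k_jap_powr])
  have jm[measurable]: "(\<lambda>v :: 'a. jap v powr s) \<in> borel_measurable lebesgue"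
    by (rule borel_measurable_lebesgueI[OF borel_measurable_continuous_onI[OF ja]])
  let ?H = "weak_grad (\<lambda>v. jap v powr s * u v)"
  have W: "has_weak_grad (\<lambda>v. jap v powr s * u v) (\<lambda>v. jap v powr s *\<^sub>R G v + u v *\<^sub>R grad (\<lambda>v. jap v powr s) v)"
    by (rule has_weak_grad_smooth_mult[OF w C_k_jap_powr])
  have Hm[measurable]: "?H \<in> borel_measurable lebesgue"
    using has_weak_grad_weak_grad[OF W] by (auto simp: has_weak_grad_def intro: locally_integrable_measurable)
  have N: "W11w_norm s u = (\<integral>\<^sup>+v. ennreal (jap v powr s * \<bar>u v\<bar>) \<partial>lebesgue) + (\<integral>\<^sup>+v. ennreal (norm (?H v)) \<partial>lebesgue)"
    by (simp add: W11w_norm_def W11_norm_def abs_mult)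
  then show le: "(\<integral>\<^sup>+v. ennreal (jap v powr s * \<bar>u v\<bar>) \<partial>lebesgue) \<le> W11w_norm s u" by simp
  have "AE v in lebesgue. ennreal (jap v powr s * norm (G v)) \<le> ennreal (norm (?H v)) + ennreal s * ennreal (jap v powr s * \<bar>u v\<bar>)"
    using weak_grad_eq_AE[OF W]
  proof eventually_elim
    case (elim v)
    have "jap v powr s * norm (G v) = norm (?H v - u v *\<^sub>R grad (\<lambda>v. jap v powr s) v)"
      by (simp add: elim)
    also have "\<dots> \<le> norm (?H v) + \<bar>u v\<bar> * norm (grad (\<lambda>v. jap v powr s) v)"
      using norm_triangle_ineq4[of "?H v" "u v *\<^sub>R grad (\<lambda>v. jap v powr s) v"] by simp
    also have "\<dots> \<le> norm (?H v) + \<bar>u v\<bar> * (s * jap v powr s)"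
      using norm_grad_jap_powr[of s v] s by (intro add_left_mono mult_left_mono) auto
    finally have "jap v powr s * norm (G v) \<le> norm (?H v) + s * (jap v powr s * \<bar>u v\<bar>)" by (simp add: mult_ac)
    then have "ennreal (jap v powr s * norm (G v)) \<le> ennreal (norm (?H v) + s * (jap v powr s * \<bar>u v\<bar>))"
      by (rule ennreal_leI)
    then show ?case using s by (simp add: ennreal_plus ennreal_mult)
  qed
  then have "(\<integral>\<^sup>+v. ennreal (jap v powr s * norm (G v)) \<partial>lebesgue) \<le>
      (\<integral>\<^sup>+v. ennreal (norm (?H v)) + ennreal s * ennreal (jap v powr s * \<bar>u v\<bar>) \<partial>lebesgue)"
    by (rule nn_integral_mono_AE)
  also have "\<dots> = (\<integral>\<^sup>+v. ennreal (norm (?H v)) \<partial>lebesgue) + ennreal s * (\<integral>\<^sup>+v. ennreal (jap v powr s * \<bar>u v\<bar>) \<partial>lebesgue)"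
    by (simp add: nn_integral_add nn_integral_cmult)
  also have "\<dots> \<le> W11w_norm s u + ennreal s * W11w_norm s u"
    using le N by (intro add_mono mult_left_mono) auto
  also have "\<dots> = ennreal (1 + s) * W11w_norm s u"
    using s by (simp add: distrib_right ennreal_plus)
  finally show "(\<integral>\<^sup>+v. ennreal (jap v powr s * norm (G v)) \<partial>lebesgue) \<le> ennreal (1 + s) * W11w_norm s u" .
qed

text \<open>Take \<open>M(x)\<close> to be the norm of the slice \<open>f(x, \<cdot>)\<close>. The density and its gradient are replaced by
  Borel functions that are set to zero where they violate the bound by \<open>M(x)\<close>; this changes them on a
  null set. In each slice the weighted integrals are at most \<open>(1 + r) M(x)\<close>, which multiplied by
  \<open>M(x)\<^sup>2\<close> is integrable in \<open>x\<close> because \<open>M\<close> is in \<open>L\<^sup>3\<close>.\<close>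

lemma L3_W_data:
  fixes f :: "'a::euclidean_space \<times> 'a \<Rightarrow> real"
  assumes f: "f \<in> L3_W r" and r: "0 \<le> r" and f0: "AE z in lebesgue. f z \<ge> 0"
  obtains g G M where "g \<in> borel_measurable borel" "G \<in> borel_measurable borel" "M \<in> borel_measurable borel"
    "AE \<xi> in lborel. f \<xi> = g \<xi>" "AE \<xi> in lborel. grad_v f \<xi> = G \<xi>"
    "\<And>\<xi>. 0 \<le> g \<xi>" "\<And>\<xi>. g \<xi> \<le> M (fst \<xi>)" "\<And>\<xi>. norm (G \<xi>) \<le> M (fst \<xi>)"
    "\<And>d. AE \<xi> in lborel. g (shift d \<xi>) - g \<xi> = (LINT s|unit_uniform. d \<bullet> G (shift (s *\<^sub>R d) \<xi>))"
    "(\<integral>\<^sup>+\<xi>. ennreal ((M (fst \<xi>))\<^sup>2 * g \<xi> * jap (snd \<xi>) powr r) \<partial>lborel) < \<infinity>"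
    "(\<integral>\<^sup>+\<xi>. ennreal ((M (fst \<xi>))\<^sup>2 * norm (G \<xi>) * jap (snd \<xi>) powr r) \<partial>lborel) < \<infinity>"
proof -
  interpret U: prob_space unit_uniform by (rule prob_space_unit_uniform)
  define N where "N = (\<lambda>x. W11w_norm r (\<lambda>v. f (x, v)) + W1inf_norm (\<lambda>v. f (x, v)))"
  have fm: "f \<in> borel_measurable lebesgue" and Nm: "N \<in> borel_measurable lebesgue"
    and W: "AE x in lebesgue. (\<lambda>v. f (x, v)) \<in> W11w r \<inter> W1inf"
    and N3: "(\<integral>\<^sup>+x. N x ^ 3 \<partial>lebesgue) < \<infinity>" and ex: "\<exists>G. has_grad_v f G"
    using f by (auto simp: L3_W_def N_def)
  have hg: "has_grad_v f (grad_v f)" unfolding grad_v_def using ex by (rule someI_ex)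
  obtain f' where f'[measurable]: "f' \<in> borel_measurable borel" and ff': "AE \<xi> in lborel. f \<xi> = f' \<xi>"
    using completion_ex_borel_measurable_real[OF fm] by auto
  obtain G' where G'[measurable]: "G' \<in> borel_measurable borel" and GG': "AE \<xi> in lborel. grad_v f \<xi> = G' \<xi>"
    using completion_ex_borel_measurable_euclidean[of "grad_v f" lborel] hg by (auto simp: has_grad_v_def)
  obtain N' where N'[measurable]: "N' \<in> borel_measurable borel" and NN': "AE x in lborel. N x = N' x"
    using completion_ex_borel_measurable[OF Nm] by auto
  have N'3: "(\<integral>\<^sup>+x. N' x ^ 3 \<partial>lborel) < \<infinity>"
  proof -
    have "(\<integral>\<^sup>+x. N' x ^ 3 \<partial>lborel) = (\<integral>\<^sup>+x. N x ^ 3 \<partial>lborel)"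
      using NN' by (intro nn_integral_cong_AE) auto
    then show ?thesis using N3 by (simp add: nn_integral_completion)
  qed
  have N'fin: "AE x in lborel. N' x < \<infinity>"
  proof -
    have "AE x in lborel. N' x ^ 3 \<noteq> \<infinity>" using N'3 by (intro nn_integral_PInf_AE) auto
    then show ?thesis by eventually_elim (auto simp: less_top power3_eq_cube ennreal_mult_eq_top_iff)
  qed
  define M where "M x = enn2real (N' x)" for x
  have [measurable]: "M \<in> borel_measurable borel" unfolding M_def by measurable
  have M0: "0 \<le> M x" for x by (simp add: M_def)
  have MN: "AE x in lborel. ennreal (M x) = N x"
    using NN' N'fin by eventually_elim (simp add: M_def)
  define g where "g \<xi> = (if 0 \<le> f' \<xi> \<and> f' \<xi> \<le> M (fst \<xi>) then f' \<xi> else 0)" for \<xi>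
  define G where "G \<xi> = (if norm (G' \<xi>) \<le> M (fst \<xi>) then G' \<xi> else 0)" for \<xi>
  have gm[measurable]: "g \<in> borel_measurable borel" and Gm[measurable]: "G \<in> borel_measurable borel"
    unfolding g_def G_def by measurable
  have g0: "0 \<le> g \<xi>" and gM: "g \<xi> \<le> M (fst \<xi>)" and GM: "norm (G \<xi>) \<le> M (fst \<xi>)" for \<xi>
    using M0 by (auto simp: g_def G_def)
  \<comment> \<open>Almost every slice satisfies the bounds and has the slice of the gradient as its weak gradient.\<close>
  have slice: "AE x in lborel. (AE v in lborel. \<bar>f' (x, v)\<bar> \<le> M x) \<and> (AE v in lborel. norm (G' (x, v)) \<le> M x)"
  proof -
    have "AE x in lborel. (\<lambda>v. f (x, v)) \<in> W11w r \<inter> W1inf" using W by (simp add: AE_completion_iff)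
    moreover have "AE x in lborel. has_weak_grad (\<lambda>v. f (x, v)) (\<lambda>v. grad_v f (x, v))"
      using hg by (simp add: has_grad_v_def AE_completion_iff)
    moreover have "AE x in lborel. AE v in lborel. f (x, v) = f' (x, v)"
      using ff' by (intro AE_lborel_pair) simp
    moreover have "AE x in lborel. AE v in lborel. grad_v f (x, v) = G' (x, v)"
      using GG' by (intro AE_lborel_pair) simp
    ultimately show ?thesis using MN
    proof eventually_elim
      case (elim x)
      have e1: "AE v in lebesgue. ennreal \<bar>f (x, v)\<bar> \<le> W1inf_norm (\<lambda>v. f (x, v))"
        using esssup_AE[where M = lebesgue and f = "\<lambda>v. ennreal \<bar>f (x, v)\<bar>"]
        by eventually_elim (auto simp: W1inf_norm_def intro: order_trans)
      have e2: "AE v in lebesgue. ennreal (norm (weak_grad (\<lambda>v. f (x, v)) v)) \<le> W1inf_norm (\<lambda>v. f (x, v))"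
        using esssup_AE[where M = lebesgue and f = "\<lambda>v. ennreal (norm (weak_grad (\<lambda>v. f (x, v)) v))"]
        by eventually_elim (auto simp: W1inf_norm_def intro: order_trans)
      have le: "W1inf_norm (\<lambda>v. f (x, v)) \<le> ennreal (M x)" using elim(5) by (simp add: N_def)
      have "AE v in lebesgue. \<bar>f' (x, v)\<bar> \<le> M x"
        using e1 AE_completion[OF elim(3)]
        by eventually_elim (use le M0 in \<open>metis order_trans ennreal_le_iff\<close>)
      moreover have "AE v in lebesgue. norm (G' (x, v)) \<le> M x"
        using e2 weak_grad_eq_AE[OF elim(2)] AE_completion[OF elim(4)]
        by eventually_elim (use le M0 in \<open>metis order_trans ennreal_le_iff\<close>)
      ultimately show ?case by (simp add: AE_completion_iff)
    qed
  qed
  have f'M: "AE \<xi> in lborel. \<bar>f' (fst \<xi>, snd \<xi>)\<bar> \<le> M (fst \<xi>)"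
    by (rule AE_lborel_pairI[where P = "\<lambda>x v. \<bar>f' (x, v)\<bar> \<le> M x"]) (use slice in \<open>auto elim!: eventually_mono\<close>)
  have G'M: "AE \<xi> in lborel. norm (G' (fst \<xi>, snd \<xi>)) \<le> M (fst \<xi>)"
    by (rule AE_lborel_pairI[where P = "\<lambda>x v. norm (G' (x, v)) \<le> M x"]) (use slice in \<open>auto elim!: eventually_mono\<close>)
  have f0': "AE \<xi> in lborel. 0 \<le> f \<xi>" using f0 by (simp add: AE_completion_iff)
  have fg: "AE \<xi> in lborel. f \<xi> = g \<xi>"
    using ff' f0' f'M by eventually_elim (auto simp: g_def)
  have GG: "AE \<xi> in lborel. grad_v f \<xi> = G \<xi>"
    using GG' G'M by eventually_elim (auto simp: G_def)
  have wg: "AE x in lborel. has_weak_grad (\<lambda>v. g (x, v)) (\<lambda>v. G (x, v)) \<and>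
      W11w_norm r (\<lambda>v. f (x, v)) \<le> ennreal (M x) \<and> has_weak_grad (\<lambda>v. f (x, v)) (\<lambda>v. grad_v f (x, v)) \<and>
      (AE v in lborel. f (x, v) = g (x, v)) \<and> (AE v in lborel. grad_v f (x, v) = G (x, v))"
  proof -
    have "AE x in lborel. has_weak_grad (\<lambda>v. f (x, v)) (\<lambda>v. grad_v f (x, v))"
      using hg by (simp add: has_grad_v_def AE_completion_iff)
    moreover have "AE x in lborel. AE v in lborel. f (x, v) = g (x, v)"
      using fg by (intro AE_lborel_pair) simp
    moreover have "AE x in lborel. AE v in lborel. grad_v f (x, v) = G (x, v)"
      using GG by (intro AE_lborel_pair) simp
    ultimately show ?thesis using MN
    proof eventually_elim
      case (elim x)
      have "has_weak_grad (\<lambda>v. g (x, v)) (\<lambda>v. G (x, v))"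
        by (rule has_weak_grad_cong_AE[OF elim(1)])
           (use elim(2,3) in \<open>auto intro!: borel_measurable_lebesgueI AE_completion\<close>)
      then show ?case using elim by (simp add: N_def)
    qed
  qed
  show ?thesis
  proof (rule that[OF gm Gm \<open>M \<in> borel_measurable borel\<close> fg GG g0 gM GM])
    fix d :: 'a
    have seg: "AE x in lborel. AE v in lborel. g (x, v + d) - g (x, v) = (LINT s|unit_uniform. d \<bullet> G (x, v + s *\<^sub>R d))"
      using wg
    proof eventually_elim
      case (elim x)
      then show ?case
        by (intro weak_grad_segment[where M = "M x"]) (use g0 gM[of "(x, _)"] GM[of "(x, _)"] in auto)
    qed
    have "AE \<xi> in lborel. g (fst \<xi>, snd \<xi> + d) - g (fst \<xi>, snd \<xi>) = (LINT s|unit_uniform. d \<bullet> G (fst \<xi>, snd \<xi> + s *\<^sub>R d))"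
    proof (rule AE_lborel_pairI[where P = "\<lambda>x v. g (x, v + d) - g (x, v) = (LINT s|unit_uniform. d \<bullet> G (x, v + s *\<^sub>R d))"])
      have "(\<lambda>\<xi>. LINT s|unit_uniform. d \<bullet> G (fst \<xi>, snd \<xi> + s *\<^sub>R d)) \<in> borel_measurable borel"
        by measurable
      then show "{\<xi>. g (fst \<xi>, snd \<xi> + d) - g (fst \<xi>, snd \<xi>) = (LINT s|unit_uniform. d \<bullet> G (fst \<xi>, snd \<xi> + s *\<^sub>R d))} \<in> sets borel"
        by measurable
    qed (fact seg)
    moreover have "shift c \<xi> = (fst \<xi>, snd \<xi> + c)" for c :: 'a and \<xi> :: "'a \<times> 'a" by (cases \<xi>) simp
    ultimately show "AE \<xi> in lborel. g (shift d \<xi>) - g \<xi> = (LINT s|unit_uniform. d \<bullet> G (shift (s *\<^sub>R d) \<xi>))"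
      by simp
  next
    have [measurable]: "(\<lambda>v :: 'a. jap v powr r) \<in> borel_measurable borel"
      by (rule borel_measurable_continuous_onI[OF C_k_continuous[OF C_k_jap_powr]])
    have gen: "(\<integral>\<^sup>+\<xi>. ennreal ((M (fst \<xi>))\<^sup>2 * k \<xi> * jap (snd \<xi>) powr r) \<partial>lborel) < \<infinity>"
      if [measurable]: "k \<in> borel_measurable borel" and k0: "\<And>\<xi>. 0 \<le> k \<xi>"
        and le: "AE x in lborel. (\<integral>\<^sup>+v. ennreal (jap v powr r * k (x, v)) \<partial>lborel) \<le> ennreal (1 + r) * ennreal (M x)"
      for k :: "'a \<times> 'a \<Rightarrow> real"
    proof -
      have "(\<integral>\<^sup>+\<xi>. ennreal ((M (fst \<xi>))\<^sup>2 * k \<xi> * jap (snd \<xi>) powr r) \<partial>lborel) =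
          (\<integral>\<^sup>+x. \<integral>\<^sup>+v. ennreal ((M x)\<^sup>2 * k (x, v) * jap v powr r) \<partial>lborel \<partial>lborel)"
        by (subst nn_integral_lborel_prod) auto
      also have "\<dots> = (\<integral>\<^sup>+x. ennreal ((M x)\<^sup>2) * (\<integral>\<^sup>+v. ennreal (jap v powr r * k (x, v)) \<partial>lborel) \<partial>lborel)"
        using k0 by (intro nn_integral_cong) (simp add: nn_integral_cmult[symmetric] ennreal_mult[symmetric] mult_ac)
      also have "\<dots> \<le> (\<integral>\<^sup>+x. ennreal ((M x)\<^sup>2) * (ennreal (1 + r) * ennreal (M x)) \<partial>lborel)"
        using le by (intro nn_integral_mono_AE) (auto elim!: eventually_mono intro!: mult_left_mono)
      also have "\<dots> = (\<integral>\<^sup>+x. ennreal (1 + r) * ennreal (M x ^ 3) \<partial>lborel)"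
      proof (intro nn_integral_cong)
        fix x
        have "ennreal (M x ^ 3) = ennreal ((M x)\<^sup>2) * ennreal (M x)"
          using M0 by (simp add: ennreal_mult[symmetric] power2_eq_square power3_eq_cube)
        then show "ennreal ((M x)\<^sup>2) * (ennreal (1 + r) * ennreal (M x)) = ennreal (1 + r) * ennreal (M x ^ 3)"
          by (simp only: mult_ac)
      qed
      also have "\<dots> = ennreal (1 + r) * (\<integral>\<^sup>+x. ennreal (M x ^ 3) \<partial>lborel)"
        by (rule nn_integral_cmult) measurable
      also have "(\<integral>\<^sup>+x. ennreal (M x ^ 3) \<partial>lborel) = (\<integral>\<^sup>+x. N' x ^ 3 \<partial>lborel)"
        using N'fin by (intro nn_integral_cong_AE) (auto elim!: eventually_mono simp: M_def ennreal_power[symmetric])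
      also have "ennreal (1 + r) * \<dots> < \<infinity>" using N'3 by (simp add: ennreal_mult_less_top)
      finally show ?thesis .
    qed
    show "(\<integral>\<^sup>+\<xi>. ennreal ((M (fst \<xi>))\<^sup>2 * g \<xi> * jap (snd \<xi>) powr r) \<partial>lborel) < \<infinity>"
    proof (rule gen[OF gm g0])
      show "AE x in lborel. (\<integral>\<^sup>+v. ennreal (jap v powr r * g (x, v)) \<partial>lborel) \<le> ennreal (1 + r) * ennreal (M x)"
        using wg
      proof eventually_elim
        case (elim x)
        then have "AE v in lborel. f (x, v) = g (x, v)" by simp
        then have "(\<integral>\<^sup>+v. ennreal (jap v powr r * g (x, v)) \<partial>lborel) = (\<integral>\<^sup>+v. ennreal (jap v powr r * \<bar>f (x, v)\<bar>) \<partial>lborel)"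
          using g0 by (intro nn_integral_cong_AE) (auto elim!: eventually_mono)
        also have "\<dots> \<le> W11w_norm r (\<lambda>v. f (x, v))"
          using elim weighted_gradient_bound(1)[of "\<lambda>v. f (x, v)" _ r] r by (auto simp: nn_integral_completion)
        also have "\<dots> \<le> ennreal (M x)" using elim by simp
        also have "\<dots> \<le> ennreal (1 + r) * ennreal (M x)"
          using r by (simp add: distrib_right)
        finally show ?case .
      qed
    qed
    show "(\<integral>\<^sup>+\<xi>. ennreal ((M (fst \<xi>))\<^sup>2 * norm (G \<xi>) * jap (snd \<xi>) powr r) \<partial>lborel) < \<infinity>"
    proof (rule gen)
      show "AE x in lborel. (\<integral>\<^sup>+v. ennreal (jap v powr r * norm (G (x, v))) \<partial>lborel) \<le> ennreal (1 + r) * ennreal (M x)"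
        using wg
      proof eventually_elim
        case (elim x)
        then have "AE v in lborel. grad_v f (x, v) = G (x, v)" by simp
        then have "(\<integral>\<^sup>+v. ennreal (jap v powr r * norm (G (x, v))) \<partial>lborel) = (\<integral>\<^sup>+v. ennreal (jap v powr r * norm (grad_v f (x, v))) \<partial>lborel)"
          by (intro nn_integral_cong_AE) (auto elim!: eventually_mono)
        also have "\<dots> \<le> ennreal (1 + r) * W11w_norm r (\<lambda>v. f (x, v))"
          using elim weighted_gradient_bound(2)[of "\<lambda>v. f (x, v)" "\<lambda>v. grad_v f (x, v)" r] r by (auto simp: nn_integral_completion)
        also have "\<dots> \<le> ennreal (1 + r) * ennreal (M x)" using elim by (intro mult_left_mono) auto
        finally show ?case .
      qed
    qed auto
  qed
qed

section \<open>The collision operators as integrals over collision space\<close>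

text \<open>The factor \<open>t\<^sup>2\<close> is absorbed in the measure: \<open>\<beta>\<close> itself is not integrable, but
  \<open>t\<^sup>2 \<beta>(t) dt\<close> is a finite measure.\<close>

lemma angular_density:
  assumes "angular_kernel d \<beta>"
  obtains b where "b \<in> borel_measurable borel" "\<And>t. 0 \<le> b t" "\<And>t. b t \<noteq> 0 \<Longrightarrow> 0 < t \<and> t \<le> pi / 2"
    "AE t in lborel. indicator {0..pi/2} t * (t\<^sup>2 * \<beta> t) = b t"
    "integrable lborel b" "(LINT t|lborel. b t) = 8 * real (d - 1) / sphere_area d"
proof -
  let ?F = "\<lambda>t. indicator {0..pi/2} t * (t\<^sup>2 * \<beta> t)"
  have \<beta>0: "0 \<le> \<beta> t" for t using assms by (simp add: angular_kernel_def)
  have "integrable (lebesgue_on {0..pi/2}) (\<lambda>t. t\<^sup>2 * \<beta> t)"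
    "(LINT t|lebesgue_on {0..pi/2}. t\<^sup>2 * \<beta> t) = 8 * real (d - 1) / sphere_area d"
    using assms by (auto simp: angular_kernel_def has_bochner_integral_iff)
  then have F: "integrable lebesgue ?F" "(LINT t|lebesgue. ?F t) = 8 * real (d - 1) / sphere_area d"
    by (simp_all add: integrable_restrict_space integral_restrict_space)
  obtain b0 where b0[measurable]: "b0 \<in> borel_measurable borel" and ae: "AE t in lborel. ?F t = b0 t"
    using completion_ex_borel_measurable_real[OF borel_measurable_integrable[OF F(1)]] by auto
  \<comment> \<open>Excluding \<open>t = 0\<close> makes all collision angles positive.\<close>
  define b where "b t = (if 0 < t \<and> t \<le> pi / 2 then max 0 (b0 t) else 0)" for t
  have bm[measurable]: "b \<in> borel_measurable borel" unfolding b_def by measurable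
  have "AE t in lborel. t \<noteq> (0 :: real)" by (rule AE_lborel_singleton)
  then have ae': "AE t in lborel. ?F t = b t"
    using ae
  proof eventually_elim
    case (elim t)
    have F0: "0 \<le> ?F t" using \<beta>0[of t] by simp
    show ?case
    proof (cases "0 < t \<and> t \<le> pi / 2")
      case True
      then show ?thesis using elim F0 by (simp add: b_def)
    next
      case False
      then have "?F t = 0" using elim(1) by (auto simp: indicator_def)
      moreover have "b t = 0" using False by (auto simp: b_def)
      ultimately show ?thesis by (simp only:)
    qed
  qed
  have ae'': "AE t in lebesgue. ?F t = b t" by (rule AE_completion[OF ae'])
  have "integrable lebesgue b"
    by (rule integrable_cong_AE_imp[OF F(1) borel_measurable_lebesgueI[OF bm]]) (use ae'' in \<open>auto simp: eq_commute\<close>)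
  then have bi: "integrable lborel b" by (simp add: integrable_completion)
  have bF: "(LINT t|lborel. b t) = (LINT t|lebesgue. ?F t)"
    by (rule integral_completion_AE[OF _ ae', symmetric]) (use bm in simp)
  show ?thesis
  proof (rule that[OF bm _ _ ae' bi])
    show "0 \<le> b t" for t by (simp add: b_def)
    show "0 < t \<and> t \<le> pi / 2" if "b t \<noteq> 0" for t
      using that unfolding b_def by (simp only: split: if_splits)
    show "(LINT t|lborel. b t) = 8 * real (d - 1) / sphere_area d" using bF F(2) by (simp only:)
  qed
qed

lemma AE_particles:
  fixes P :: "'a::euclidean_space \<times> 'a \<Rightarrow> bool"
  assumes "AE \<xi> in lborel. P \<xi>"
  shows "AE (x, v, vs) in lborel. P (x, v) \<and> P (x, vs)"
proof -
  obtain N where N: "{\<xi> \<in> space lborel. \<not> P \<xi>} \<subseteq> N" "emeasure lborel N = 0" "N \<in> sets lborel"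
    using assms by (rule AE_E)
  have "N \<in> null_sets lborel" using N by (simp add: null_sets_def)
  from AE_not_in[OF this] have "AE \<xi> in lborel. (fst \<xi>, snd \<xi>) \<notin> N" by simp
  then have "AE x in lborel. AE v in lborel. (x, v) \<notin> N"
    by (intro AE_lborel_pair) simp
  then have "AE x in lborel. AE vv in lborel. (x, fst vv) \<notin> N \<and> (x, snd vv) \<notin> N"
  proof eventually_elim
    case (elim x)
    have "AE vv in (lborel :: 'a measure) \<Otimes>\<^sub>M (lborel :: 'a measure). (x, fst vv) \<notin> N \<and> (x, snd vv) \<notin> N"
      using AE_pair_fst[OF lborel.sigma_finite_measure_axioms elim] AE_pair_snd[OF lborel.sigma_finite_measure_axioms elim]
      by eventually_elim simp
    then show ?case by (simp only: lborel_prod)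
  qed
  then have "AE X in lborel. (fst X, fst (snd X)) \<notin> N \<and> (fst X, snd (snd X)) \<notin> N"
  proof (rule AE_lborel_pairI[where P = "\<lambda>x vv. (x, fst vv) \<notin> N \<and> (x, snd vv) \<notin> N", rotated])
    have [measurable]: "N \<in> sets borel" using N by simp
    show "{X :: 'a \<times> 'a \<times> 'a. (fst X, fst (snd X)) \<notin> N \<and> (fst X, snd (snd X)) \<notin> N} \<in> sets borel"
      by measurable
  qed
  then show ?thesis
    by eventually_elim (use N(1) in auto)
qed

lemma post_eq_dev:
  fixes v vs :: "'a::euclidean_space"
  assumes "v \<noteq> vs"
  shows "post v vs \<theta> (frame e (rel_dir v vs) q) = v + dev e \<theta> q (v - vs)"
    and "posts v vs \<theta> (frame e (rel_dir v vs) q) = vs - dev e \<theta> q (v - vs)"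
proof -
  have "frame e (rel_dir v vs) q = frame e (v - vs) q"
    unfolding rel_dir_def using assms by (intro frame_scale) simp
  moreover have "(norm (v - vs) / 2) *\<^sub>R scat v vs \<theta> p = (cos \<theta> / 2) *\<^sub>R (v - vs) + (sin \<theta> / 2 * norm (v - vs)) *\<^sub>R p" for p
  proof -
    have "(norm (v - vs) / 2) *\<^sub>R scat v vs \<theta> p =
        (cos \<theta> / 2) *\<^sub>R (norm (v - vs) *\<^sub>R rel_dir v vs) + (sin \<theta> / 2 * norm (v - vs)) *\<^sub>R p"
      by (simp add: scat_def scaleR_add_right mult.commute)
    also have "norm (v - vs) *\<^sub>R rel_dir v vs = v - vs" using assms by (simp add: rel_dir_def)
    finally show ?thesis .
  qed
  moreover have half: "x = (1/2) *\<^sub>R x + (1/2) *\<^sub>R x" for x :: 'a by (simp add: scaleR_add_left[symmetric])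
  ultimately show "post v vs \<theta> (frame e (rel_dir v vs) q) = v + dev e \<theta> q (v - vs)"
    "posts v vs \<theta> (frame e (rel_dir v vs) q) = vs - dev e \<theta> q (v - vs)"
    using half[of v] half[of vs]
    by (simp_all add: post_def posts_def dev_def algebra_simps diff_divide_distrib)
qed

lemma measurable_post[measurable]:
  "post v vs \<theta> \<in> borel_measurable borel" "posts v vs \<theta> \<in> borel_measurable (borel :: 'a::euclidean_space measure)"
  unfolding post_def posts_def scat_def by measurable

text \<open>The grazing sequence of the kernel: the parameter is \<open>z = (t, q)\<close> and the angle is
  \<open>\<epsilon>\<^sub>n t / \<pi>\<close>.\<close>

locale kernel_collisions =
  grazing_collisions "density lborel (\<lambda>t. ennreal (b t)) \<Otimes>\<^sub>M sph e" e "\<lambda>n z. X n * fst z / pi" snd \<gamma> r R C g G M \<phi> D cut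
  for b :: "real \<Rightarrow> real" and e :: "'a::euclidean_space" and X :: "nat \<Rightarrow> real" and \<gamma> r R C g G M \<phi> D cut +
  fixes \<beta> :: "real \<Rightarrow> real" and f :: "'a \<times> 'a \<Rightarrow> real" and B :: real
  assumes eB: "e \<in> Basis" and dim: "DIM('a) \<ge> 2" and X: "\<And>n. 0 < X n"
    and b_measurable[measurable]: "b \<in> borel_measurable borel" and b0: "\<And>t. 0 \<le> b t"
    and b_support: "\<And>t. b t \<noteq> 0 \<Longrightarrow> 0 < t \<and> t \<le> pi / 2"
    and b_eq: "AE t in lborel. indicator {0..pi/2} t * (t\<^sup>2 * \<beta> t) = b t"
    and b_int: "integrable lborel b" "(LINT t|lborel. b t) = 8 * real (DIM('a) - 1) / sphere_area DIM('a)"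
    and f_eq: "AE \<xi> in lborel. f \<xi> = g \<xi>" and grad_eq: "AE \<xi> in lborel. grad_v f \<xi> = G \<xi>"
    and D_eq: "\<And>x v. grad (\<lambda>u. \<phi> (x, u)) v = D (x, v)" and \<phi>_bound: "\<And>\<xi>. \<bar>\<phi> \<xi>\<bar> \<le> B"
begin

abbreviation Bm :: "real measure" where "Bm \<equiv> density lborel (\<lambda>t. ennreal (b t))"

abbreviation Zm :: "(real \<times> 'a) measure" where "Zm \<equiv> Bm \<Otimes>\<^sub>M sph e"

sublocale S: finite_measure "sph e" by (rule finite_measure_sph[OF eB dim])

sublocale Bm: finite_measure Bm
  by (rule finite_measureI)
     (use integrableD(2)[OF b_int(1)] b0 in \<open>simp add: emeasure_density less_top real_integrable_def\<close>)

sublocale BS: pair_sigma_finite Bm "sph e" ..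

lemma AE_Bm: "(AE t in Bm. P t) \<longleftrightarrow> (AE t in lborel. b t \<noteq> 0 \<longrightarrow> P t)"
  using b0 by (subst AE_density) (auto simp: less_le)

lemma norm_e: "norm e = 1"
  using eB by simp

text \<open>The integrand of the weak formulation of \<open>Q\<^sup>\<epsilon>\<close> at the angle \<open>\<theta> = \<epsilon> t / \<pi>\<close>.\<close>

definition gain_loss :: "real \<Rightarrow> real \<Rightarrow> 'a \<times> 'a \<times> 'a \<Rightarrow> real" where
  "gain_loss \<epsilon> t = (\<lambda>(x, v, vs).
    (let \<theta> = \<epsilon> * t / pi; S = sphere_perp (rel_dir v vs) in
           norm (v - vs) powr \<gamma> * \<beta> t * (pi\<^sup>2 / \<epsilon>\<^sup>2) *
           (f (x, v) * f (x, vs) *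
              (LINT p|S. (f (x, post v vs \<theta> p) + f (x, posts v vs \<theta> p)) * nabla_bar \<phi> x v vs \<theta> p)
            - (f (x, v) + f (x, vs)) *
              (LINT p|S. f (x, post v vs \<theta> p) * f (x, posts v vs \<theta> p) * nabla_bar \<phi> x v vs \<theta> p))))"

lemma Q_eps_gain_loss:
  "Q_eps_pairing \<gamma> \<beta> \<epsilon> f \<phi> = pi * (LINT x|lebesgue. (LINT t:{0..pi/2}|lebesgue. gain_loss \<epsilon> t x))"
  unfolding Q_eps_pairing_def gain_loss_def by (simp add: case_prod_unfold)

text \<open>For fixed collision parameters and relative velocity the points with post-collisional velocities
  are translates of \<open>(x, v)\<close>, so almost all of them avoid a given null set. This allows to replace the
  density by its Borel version inside the integral over the azimuth.\<close>

lemma AE_post_collisional: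
  assumes N: "N \<in> null_sets (lborel :: ('a \<times> 'a) measure)"
  shows "AE (x, v, vs) in lborel. AE t in Bm. AE q in sph e.
    (x, v + h n (t, q) (v - vs)) \<notin> N \<and> (x, vs - h n (t, q) (v - vs)) \<notin> N"
proof -
  interpret XZ: pair_sigma_finite "lborel :: ('a \<times> 'a \<times> 'a) measure" Zm ..
  have base: "AE (y, \<xi>) in (Zm \<Otimes>\<^sub>M (lborel :: 'a measure)) \<Otimes>\<^sub>M lborel. \<xi> \<notin> N"
    using AE_pair_snd[OF lborel.sigma_finite_measure_axioms AE_not_in[OF N]] by (simp add: case_prod_unfold)
  have m: "(\<lambda>y. h n (fst y) (snd y)) \<in> borel_measurable (Zm \<Otimes>\<^sub>M lborel)"
    "(\<lambda>y. - snd y - h n (fst y) (snd y)) \<in> borel_measurable (Zm \<Otimes>\<^sub>M lborel)"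
    by measurable
  have "AE p in coll_space Zm. shift (h n (fst (fst p)) (snd (fst p))) (snd p) \<notin> N \<and>
     shift (- snd (fst p) - h n (fst (fst p)) (snd (fst p))) (snd p) \<notin> N"
    using AE_shift[OF m(1) sigma_finite_Y base] AE_shift[OF m(2) sigma_finite_Y base]
    by eventually_elim auto
  then have *: "AE p in distr (lborel \<Otimes>\<^sub>M Zm) (coll_space Zm) (\<lambda>((x, v, vs), z). ((z, v - vs), (x, v))).
      shift (h n (fst (fst p)) (snd (fst p))) (snd p) \<notin> N \<and>
      shift (- snd (fst p) - h n (fst (fst p)) (snd (fst p))) (snd p) \<notin> N"
    by (subst distr_relative_velocity[OF sigma_finite_Z])
  have E: "(\<lambda>((x :: 'a, v :: 'a, vs), z). ((z, v - vs), (x, v))) \<in> measurable (lborel \<Otimes>\<^sub>M Zm) (coll_space Zm)"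
    unfolding case_prod_unfold by measurable
  have "AE p in lborel \<Otimes>\<^sub>M Zm. case p of ((x, v, vs), z) \<Rightarrow>
     (x, v + h n z (v - vs)) \<notin> N \<and> (x, vs - h n z (v - vs)) \<notin> N"
    using AE_distrD[OF E *] by (simp add: case_prod_unfold)
  from XZ.AE_pair[OF this]
  have "AE X in lborel. AE z in Zm. (fst X, fst (snd X) + h n z (fst (snd X) - snd (snd X))) \<notin> N \<and>
      (fst X, snd (snd X) - h n z (fst (snd X) - snd (snd X))) \<notin> N"
    by (simp add: case_prod_unfold)
  then show ?thesis
    by eventually_elim (use BS.AE_pair in \<open>force simp: case_prod_unfold\<close>)
qed

lemma gain_loss_eq:
  assumes N: "N \<in> null_sets lborel" "\<And>\<xi>. \<xi> \<notin> N \<Longrightarrow> f \<xi> = g \<xi>"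
    and xv: "(x, v) \<notin> N" "(x, vs) \<notin> N" and ne: "v \<noteq> vs"
    and ae: "AE q in sph e. (x, v + h n (t, q) (v - vs)) \<notin> N \<and> (x, vs - h n (t, q) (v - vs)) \<notin> N"
    and t: "0 < t"
  shows "gain_loss (X n) t (x, v, vs) = t\<^sup>2 * \<beta> t * (LINT q|sph e. coll n (((t, q), v - vs), (x, v)))"
proof -
  define \<theta> where "\<theta> = X n * t / pi"
  define k where "k = rel_dir v vs"
  have k1: "norm k = 1" using ne by (simp add: k_def rel_dir_def)
  have [measurable]: "N \<in> sets borel" using N by auto
  have post: "post v vs \<theta> (frame e k q) = v + h n (t, q) (v - vs)" "posts v vs \<theta> (frame e k q) = vs - h n (t, q) (v - vs)" for q
    using post_eq_dev[OF ne] by (simp_all add: k_def \<theta>_def)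
  have good_p: "AE p in sph k. (x, post v vs \<theta> p) \<notin> N \<and> (x, posts v vs \<theta> p) \<notin> N"
  proof (subst AE_sphere_frame[OF norm_e k1])
    show "{q. (x, post v vs \<theta> q) \<notin> N \<and> (x, posts v vs \<theta> q) \<notin> N} \<in> sets borel" by measurable
    show "AE q in sph e. (x, post v vs \<theta> (frame e k q)) \<notin> N \<and> (x, posts v vs \<theta> (frame e k q)) \<notin> N"
      using ae by (simp add: post)
  qed
  define a1 where "a1 q = g (x, v + h n (t, q) (v - vs))" for q
  define b1 where "b1 q = g (x, vs - h n (t, q) (v - vs))" for q
  define nab where "nab q = \<phi> (x, v + h n (t, q) (v - vs)) + \<phi> (x, vs - h n (t, q) (v - vs)) - \<phi> (x, vs) - \<phi> (x, v)" for q
  have [measurable]: "a1 \<in> borel_measurable borel" "b1 \<in> borel_measurable borel" "nab \<in> borel_measurable borel"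
    unfolding a1_def b1_def nab_def fst_conv snd_conv by measurable
  have nb: "\<bar>nab q\<bar> \<le> 4 * B" for q
    unfolding nab_def using \<phi>_bound[of "(x, v + h n (t, q) (v - vs))"] \<phi>_bound[of "(x, vs - h n (t, q) (v - vs))"]
      \<phi>_bound[of "(x, vs)"] \<phi>_bound[of "(x, v)"] by linarith
  have ab: "0 \<le> a1 q" "a1 q \<le> M x" "0 \<le> b1 q" "b1 q \<le> M x" for q
    using g0 gM[of "(x, _)"] by (auto simp: a1_def b1_def)
  have i1: "integrable (sph e) (\<lambda>q. (a1 q + b1 q) * nab q)"
  proof (rule S.integrable_const_bound[where B = "(M x + M x) * (4 * B)"])
    show "AE q in sph e. norm ((a1 q + b1 q) * nab q) \<le> (M x + M x) * (4 * B)"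
    proof (intro always_eventually allI)
      fix q
      have "\<bar>a1 q + b1 q\<bar> \<le> M x + M x" using ab[of q] by linarith
      from mult_mono[OF this nb[of q]] show "norm ((a1 q + b1 q) * nab q) \<le> (M x + M x) * (4 * B)"
        using M0[of x] unfolding real_norm_def abs_mult by simp
    qed
  qed measurable
  have i2: "integrable (sph e) (\<lambda>q. a1 q * b1 q * nab q)"
  proof (rule S.integrable_const_bound[where B = "(M x * M x) * (4 * B)"])
    show "AE q in sph e. norm (a1 q * b1 q * nab q) \<le> (M x * M x) * (4 * B)"
    proof (intro always_eventually allI)
      fix q
      have "\<bar>a1 q * b1 q\<bar> \<le> M x * M x" using ab[of q] M0[of x] unfolding abs_mult by (intro mult_mono) auto
      from mult_mono[OF this nb[of q]] show "norm (a1 q * b1 q * nab q) \<le> (M x * M x) * (4 * B)"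
        using M0[of x] unfolding real_norm_def abs_mult by simp
    qed
  qed measurable
  have nabla: "(\<lambda>p. nabla_bar \<phi> x v vs \<theta> p) \<in> borel_measurable borel"
    unfolding nabla_bar_def by measurable
  note [measurable] = nabla
  have I1: "(LINT p|sphere_perp k. (f (x, post v vs \<theta> p) + f (x, posts v vs \<theta> p)) * nabla_bar \<phi> x v vs \<theta> p) =
      (LINT q|sph e. (a1 q + b1 q) * nab q)"
  proof (subst integral_sphere_perp[OF norm_e k1, where F = "\<lambda>p. (g (x, post v vs \<theta> p) + g (x, posts v vs \<theta> p)) * nabla_bar \<phi> x v vs \<theta> p"])
    show "AE p in sph k. (f (x, post v vs \<theta> p) + f (x, posts v vs \<theta> p)) * nabla_bar \<phi> x v vs \<theta> p =
        (g (x, post v vs \<theta> p) + g (x, posts v vs \<theta> p)) * nabla_bar \<phi> x v vs \<theta> p"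
      using good_p by eventually_elim (simp add: N(2))
  qed (measurable, simp add: nabla_bar_def post a1_def b1_def nab_def)
  have I2: "(LINT p|sphere_perp k. f (x, post v vs \<theta> p) * f (x, posts v vs \<theta> p) * nabla_bar \<phi> x v vs \<theta> p) =
      (LINT q|sph e. a1 q * b1 q * nab q)"
  proof (subst integral_sphere_perp[OF norm_e k1, where F = "\<lambda>p. g (x, post v vs \<theta> p) * g (x, posts v vs \<theta> p) * nabla_bar \<phi> x v vs \<theta> p"])
    show "AE p in sph k. f (x, post v vs \<theta> p) * f (x, posts v vs \<theta> p) * nabla_bar \<phi> x v vs \<theta> p =
        g (x, post v vs \<theta> p) * g (x, posts v vs \<theta> p) * nabla_bar \<phi> x v vs \<theta> p"
      using good_p by eventually_elim (simp add: N(2))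
  qed (measurable, simp add: nabla_bar_def post a1_def b1_def nab_def)
  have fg: "f (x, v) = g (x, v)" "f (x, vs) = g (x, vs)" using N(2) xv by auto
  have coll: "coll n (((t, q), v - vs), (x, v)) = kern n (t, q) (v - vs) *
      (g (x, v) * g (x, vs) * ((a1 q + b1 q) * nab q) - (g (x, v) + g (x, vs)) * (a1 q * b1 q * nab q))" for q
  proof -
    have sh: "shift (h n (t, q) (v - vs)) (x, v) = (x, v + h n (t, q) (v - vs))"
      "shift (- (v - vs) - h n (t, q) (v - vs)) (x, v) = (x, vs - h n (t, q) (v - vs))"
      "shift (- (v - vs)) (x, v) = (x, vs)"
      by simp_all
    show ?thesis
      unfolding coll_def prod.case sh a1_def[symmetric] b1_def[symmetric] nab_def[symmetric]
      by (simp add: left_diff_distrib mult.assoc)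
  qed
  have kern: "kern n (t, q) (v - vs) = norm (v - vs) powr \<gamma> * (pi\<^sup>2 / (X n)\<^sup>2) / t\<^sup>2" for q
    by (simp add: kern_def power_divide power_mult_distrib)
  define E where "E = g (x, v) * g (x, vs) * (LINT q|sph e. (a1 q + b1 q) * nab q) -
      (g (x, v) + g (x, vs)) * (LINT q|sph e. a1 q * b1 q * nab q)"
  have rhs: "(LINT q|sph e. coll n (((t, q), v - vs), (x, v))) = norm (v - vs) powr \<gamma> * (pi\<^sup>2 / (X n)\<^sup>2) / t\<^sup>2 * E"
    unfolding coll kern E_def using i1 i2 by simp
  have lhs: "gain_loss (X n) t (x, v, vs) = norm (v - vs) powr \<gamma> * \<beta> t * (pi\<^sup>2 / (X n)\<^sup>2) * E"
    unfolding gain_loss_def prod.case Let_def \<theta>_def[symmetric] k_def[symmetric] I1 I2 fg E_def by (rule refl)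
  have cancel: "t\<^sup>2 * c * (a * d / t\<^sup>2 * E) = a * c * d * E" for a c d :: real using t by simp
  show ?thesis unfolding lhs rhs by (rule cancel[symmetric])
qed

lemma Q_eps_eq: "Q_eps_pairing \<gamma> \<beta> (X n) f \<phi> = pi * (LINT p|coll_space Zm. coll n p)"
proof -
  obtain N where N: "{\<xi> \<in> space lborel. \<not> f \<xi> = g \<xi>} \<subseteq> N" "emeasure lborel N = 0" "N \<in> sets lborel"
    using f_eq by (rule AE_E)
  have N0: "N \<in> null_sets lborel" and fg: "\<xi> \<notin> N \<Longrightarrow> f \<xi> = g \<xi>" for \<xi> using N by (auto simp: null_sets_def)
  note C = integral_coll_space[OF sigma_finite_Z coll_lim(1)[of n]]
  have cm[measurable]: "coll n \<in> borel_measurable (coll_space Zm)"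
    by (rule borel_measurable_integrable[OF coll_lim(1)])
  have ne: "AE (x, v, vs) in (lborel :: ('a \<times> 'a \<times> 'a) measure). v \<noteq> vs"
  proof -
    have "AE v in lborel. AE vs in lborel. v \<noteq> (vs :: 'a)"
    proof (rule AE_I2)
      fix v :: 'a
      show "AE vs in lborel. v \<noteq> vs" proof -
        have "AE vs in lborel. vs \<noteq> v" by (rule AE_lborel_singleton)
        then show ?thesis by eventually_elim auto
      qed
    qed
    then have "AE vv in lborel. fst vv \<noteq> (snd vv :: 'a)"
      by (rule AE_lborel_pairI[rotated]) measurable
    then have "AE x in (lborel :: 'a measure). AE vv in lborel. fst vv \<noteq> (snd vv :: 'a)" by simp
    then have "AE X in (lborel :: ('a \<times> 'a \<times> 'a) measure). fst (snd X) \<noteq> snd (snd X)"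
      by (rule AE_lborel_pairI[rotated]) measurable
    then show ?thesis by (simp add: case_prod_unfold)
  qed
  have "AE Y in lborel. (LINT t:{0..pi/2}|lebesgue. gain_loss (X n) t Y) =
      (case Y of (x, v, vs) \<Rightarrow> LINT z|Zm. coll n ((z, v - vs), (x, v)))"
    using AE_post_collisional[OF N0, of n] AE_particles[OF AE_not_in[OF N0]] ne C(2)
  proof eventually_elim
    case (elim Y)
    obtain x v vs where Y: "Y = (x, v, vs)" by (metis prod.exhaust)
    define J where "J t = (LINT q|sph e. coll n (((t, q), v - vs), (x, v)))" for t
    have [measurable]: "J \<in> borel_measurable borel" unfolding J_def by measurable
    have aet: "AE t in lborel. b t \<noteq> 0 \<longrightarrow> (AE q in sph e.
        (x, v + h n (t, q) (v - vs)) \<notin> N \<and> (x, vs - h n (t, q) (v - vs)) \<notin> N)"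
      using elim(1) unfolding Y prod.case AE_Bm .
    have t0: "AE t in lborel. t \<noteq> (0 :: real)" by (rule AE_lborel_singleton)
    have "AE t in lborel. indicator {0..pi/2} t *\<^sub>R gain_loss (X n) t Y = b t * J t"
      using aet b_eq t0
    proof eventually_elim
      case (elim t)
      show ?case
      proof (cases "b t = 0")
        case True
        then have "indicator {0..pi/2} t * \<beta> t = 0" using elim by (auto simp: indicator_def)
        then have "indicator {0..pi/2} t *\<^sub>R gain_loss (X n) t Y = 0"
          by (auto simp: gain_loss_def Y Let_def indicator_def)
        then show ?thesis using True by simp
      next
        case False
        then have t: "0 < t" "t \<le> pi / 2" using b_support by auto
        have "gain_loss (X n) t (x, v, vs) = t\<^sup>2 * \<beta> t * (LINT q|sph e. coll n (((t, q), v - vs), (x, v)))"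
          using elim False t \<open>case Y of (x, v, vs) \<Rightarrow> v \<noteq> vs\<close> \<open>case Y of (x, v, vs) \<Rightarrow> (x, v) \<notin> N \<and> (x, vs) \<notin> N\<close>
          by (intro gain_loss_eq[OF N0 fg]) (auto simp: Y)
        then show ?thesis using elim t by (simp add: Y J_def)
      qed
    qed
    then have "(LINT t|lebesgue. indicator {0..pi/2} t *\<^sub>R gain_loss (X n) t Y) = (LINT t|lborel. b t * J t)"
      by (rule integral_completion_AE[rotated]) measurable
    also have "\<dots> = (LINT t|Bm. J t)" using b0 by (simp add: integral_density)
    also have "\<dots> = (LINT z|Zm. coll n ((z, v - vs), (x, v)))"
      unfolding J_def using elim by (intro BS.integral_fst'[where f = "\<lambda>z. coll n ((z, v - vs), (x, v))"]) (simp add: Y)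
    finally show ?case by (simp add: Y set_lebesgue_integral_def)
  qed
  then have "(LINT Y|lebesgue. (LINT t:{0..pi/2}|lebesgue. gain_loss (X n) t Y)) =
      (LINT Y|lborel. (case Y of (x, v, vs) \<Rightarrow> LINT z|Zm. coll n ((z, v - vs), (x, v))))"
    using C(3) by (intro integral_completion_AE) auto
  then show ?thesis by (simp add: Q_eps_gain_loss C(1))
qed

text \<open>The constant is the product of the mass \<open>8 (d - 1) / |S\<^sup>d\<^sup>-\<^sup>2|\<close> of \<open>t\<^sup>2 \<beta>(t) dt\<close>, of \<open>|w|\<^sup>2 / 4\<close> from the
  two factors \<open>dir\<close>, and of the second moment \<open>|S\<^sup>d\<^sup>-\<^sup>2| / (d - 1)\<close> of the sphere.\<close>

lemma integral_grazing_parameters: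
  assumes "w \<noteq> 0"
  shows "(LINT z|Zm. (dir z w \<bullet> U) * (dir z w \<bullet> V)) = 2 * (norm w)\<^sup>2 * (U \<bullet> proj_perp w V)"
proof -
  have S0: "sphere_area DIM('a) > 0" and d0: "real (DIM('a) - 1) > 0"
    using dim by (auto simp: sphere_area_def intro!: mult_pos_pos unit_ball_vol_pos)
  have bd: "\<bar>(dir z w \<bullet> U) * (dir z w \<bullet> V)\<bar> \<le> (norm w * norm U) * (norm w * norm V)" if "norm (snd z) = 1" for z
  proof -
    have "norm (dir z w) \<le> norm w" using that by (simp add: dir_def norm_frame)
    then have "\<bar>dir z w \<bullet> Y\<bar> \<le> norm w * norm Y" for Y
      using Cauchy_Schwarz_ineq2[of "dir z w" Y] by (meson mult_right_mono norm_ge_zero order_trans)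
    then show ?thesis by (auto simp: abs_mult intro!: mult_mono)
  qed
  have int: "integrable Zm (\<lambda>z. (dir z w \<bullet> U) * (dir z w \<bullet> V))"
  proof (rule integrable_const_bound)
    show "AE z in Zm. norm ((dir z w \<bullet> U) * (dir z w \<bullet> V)) \<le> (norm w * norm U) * (norm w * norm V)"
      using AE_q by eventually_elim (simp add: bd)
    show "(\<lambda>z. (dir z w \<bullet> U) * (dir z w \<bullet> V)) \<in> borel_measurable Zm"
      unfolding dir_def by measurable
  qed
  have "(LINT z|Zm. (dir z w \<bullet> U) * (dir z w \<bullet> V)) = (LINT t|Bm. LINT q|sph e. (dir (t, q) w \<bullet> U) * (dir (t, q) w \<bullet> V))"
    by (rule BS.integral_fst'[OF int, symmetric])
  also have "\<dots> = (LINT t|Bm. (norm w)\<^sup>2 / 4 * (sphere_area DIM('a) / real (DIM('a) - 1) * (U \<bullet> proj_perp w V)))"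
  proof (rule Bochner_Integration.integral_cong[OF refl])
    fix t
    have "(LINT q|sph e. (dir (t, q) w \<bullet> U) * (dir (t, q) w \<bullet> V)) =
        (LINT q|sph e. (norm w)\<^sup>2 / 4 * ((frame e w q \<bullet> U) * (frame e w q \<bullet> V)))"
      by (simp add: dir_def power2_eq_square mult_ac)
    then show "(LINT q|sph e. (dir (t, q) w \<bullet> U) * (dir (t, q) w \<bullet> V)) =
        (norm w)\<^sup>2 / 4 * (sphere_area DIM('a) / real (DIM('a) - 1) * (U \<bullet> proj_perp w V))"
      by (simp add: sph_second_moment[OF eB dim assms])
  qed
  also have "\<dots> = (LINT t|Bm. 1) * ((norm w)\<^sup>2 / 4 * (sphere_area DIM('a) / real (DIM('a) - 1) * (U \<bullet> proj_perp w V)))"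
    by simp
  also have "(LINT t|Bm. 1) = 8 * real (DIM('a) - 1) / sphere_area DIM('a)"
    using b0 b_int by (subst integral_density) auto
  also have "\<dots> * ((norm w)\<^sup>2 / 4 * (sphere_area DIM('a) / real (DIM('a) - 1) * (U \<bullet> proj_perp w V))) =
      2 * (norm w)\<^sup>2 * (U \<bullet> proj_perp w V)"
    using S0 d0 by (simp add: field_simps del: of_nat_diff)
  finally show ?thesis .
qed

lemma Q_L_eq: "Q_L_pairing \<gamma> f \<phi> = pi * (LINT p|coll_space Zm. grazing_limit p)"
proof -
  note C = integral_coll_space[OF sigma_finite_Z coll_lim(2)]
  have "AE Y in lborel. (case Y of (x, v, vs) \<Rightarrow> norm (v - vs) powr (\<gamma> + 2) *
       ((- ((f (x, vs))\<^sup>2 *\<^sub>R grad_v f (x, v)) + (f (x, v))\<^sup>2 *\<^sub>R grad_v f (x, vs)) \<bullet>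
        proj_perp (v - vs) (grad (\<lambda>u. \<phi> (x, u)) v - grad (\<lambda>u. \<phi> (x, u)) vs))) =
      (case Y of (x, v, vs) \<Rightarrow> LINT z|Zm. grazing_limit ((z, v - vs), (x, v))) / 2"
    using AE_particles[OF f_eq] AE_particles[OF grad_eq]
  proof eventually_elim
    case (elim Y)
    obtain x v vs where Y: "Y = (x, v, vs)" by (metis prod.exhaust)
    define U where "U = - ((g (x, vs))\<^sup>2 *\<^sub>R G (x, v)) + (g (x, v))\<^sup>2 *\<^sub>R G (x, vs)"
    define V where "V = D (x, v) - D (x, vs)"
    have l: "grazing_limit ((z, v - vs), (x, v)) = norm (v - vs) powr \<gamma> * ((dir z (v - vs) \<bullet> U) * (dir z (v - vs) \<bullet> V))" for z
      by (simp add: grazing_limit_def U_def V_def)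
    show ?case
    proof (cases "v = vs")
      case False
      have "(LINT z|Zm. grazing_limit ((z, v - vs), (x, v))) = norm (v - vs) powr \<gamma> * (2 * (norm (v - vs))\<^sup>2 * (U \<bullet> proj_perp (v - vs) V))"
        unfolding l using integral_grazing_parameters[of "v - vs" U V] False by simp
      moreover have "norm (v - vs) powr (\<gamma> + 2) = norm (v - vs) powr \<gamma> * (norm (v - vs))\<^sup>2"
        using False by (simp add: powr_add)
      ultimately show ?thesis using elim by (simp add: Y U_def V_def D_eq)
    next
      case True
      have "grazing_limit ((z, v - vs), (x, v)) = 0" for z unfolding l using True by simp
      then show ?thesis by (simp add: Y) (simp add: True)
    qed
  qed
  then have "(LINT Y|lebesgue. (case Y of (x, v, vs) \<Rightarrow> norm (v - vs) powr (\<gamma> + 2) *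
       ((- ((f (x, vs))\<^sup>2 *\<^sub>R grad_v f (x, v)) + (f (x, v))\<^sup>2 *\<^sub>R grad_v f (x, vs)) \<bullet>
        proj_perp (v - vs) (grad (\<lambda>u. \<phi> (x, u)) v - grad (\<lambda>u. \<phi> (x, u)) vs)))) =
      (LINT Y|lborel. (case Y of (x, v, vs) \<Rightarrow> LINT z|Zm. grazing_limit ((z, v - vs), (x, v))) / 2)"
    using C(3) by (intro integral_completion_AE) auto
  then show ?thesis by (simp add: Q_L_pairing_def C(1))
qed

lemma Q_eps_limit: "(\<lambda>n. Q_eps_pairing \<gamma> \<beta> (X n) f \<phi>) \<longlonglongrightarrow> Q_L_pairing \<gamma> f \<phi>"
  unfolding Q_eps_eq Q_L_eq by (intro tendsto_intros coll_lim(3))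

end

section \<open>The grazing limit\<close>

text \<open>Angles below \<open>1/20\<close> are reached once \<open>\<epsilon> < 1/10\<close>, because \<open>t \<le> \<pi>/2\<close> on the support of the
  kernel.\<close>

lemma Q_eps_limit_sequentially:
  fixes f :: "'a::euclidean_space \<times> 'a \<Rightarrow> real" and \<phi> :: "'a \<times> 'a \<Rightarrow> real" and X :: "nat \<Rightarrow> real"
  assumes dim: "DIM('a) \<ge> 2" and \<gamma>: "- 2 \<le> \<gamma>" and \<beta>: "angular_kernel DIM('a) \<beta>"
    and f0: "AE z in lebesgue. f z \<ge> 0" and f: "f \<in> L3_W (\<gamma> + 2)" and \<phi>: "\<phi> \<in> Cc_infty"
    and X: "\<And>n. 0 < X n" "\<And>n. X n < 1 / 10" "X \<longlonglongrightarrow> 0"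
  shows "(\<lambda>n. Q_eps_pairing \<gamma> \<beta> (X n) f \<phi>) \<longlonglongrightarrow> Q_L_pairing \<gamma> f \<phi>"
proof -
  have r: "0 \<le> \<gamma> + 2" using \<gamma> by simp
  obtain g G M where d: "g \<in> borel_measurable borel" "G \<in> borel_measurable borel" "M \<in> borel_measurable borel"
    and fg: "AE \<xi> in lborel. f \<xi> = g \<xi>" "AE \<xi> in lborel. grad_v f \<xi> = G \<xi>"
    and gs: "\<And>\<xi>. 0 \<le> g \<xi>" "\<And>\<xi>. g \<xi> \<le> M (fst \<xi>)" "\<And>\<xi>. norm (G \<xi>) \<le> M (fst \<xi>)"
    and seg: "\<And>d. AE \<xi> in lborel. g (shift d \<xi>) - g \<xi> = (LINT s|unit_uniform. d \<bullet> G (shift (s *\<^sub>R d) \<xi>))"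
    and fin: "(\<integral>\<^sup>+\<xi>. ennreal ((M (fst \<xi>))\<^sup>2 * g \<xi> * jap (snd \<xi>) powr (\<gamma> + 2)) \<partial>lborel) < \<infinity>"
      "(\<integral>\<^sup>+\<xi>. ennreal ((M (fst \<xi>))\<^sup>2 * norm (G \<xi>) * jap (snd \<xi>) powr (\<gamma> + 2)) \<partial>lborel) < \<infinity>"
    by (rule L3_W_data[OF f r f0]) (rule that; simp)
  obtain C R cut where CR: "0 \<le> C" "0 \<le> R"
    and cut: "continuous_on UNIV cut" "\<And>v. 0 \<le> cut v \<and> cut v \<le> 1" "\<And>v :: 'a. cut v \<noteq> 0 \<Longrightarrow> norm v \<le> R"
    and lip: "\<And>\<xi> a b. \<bar>\<phi> (shift a \<xi>) - \<phi> (shift b \<xi>)\<bar> \<le> C * norm (a - b) * (cut (snd \<xi> + a) + cut (snd \<xi> + b))"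
    by (rule test_function_data[OF \<phi>]) (rule that; simp)
  obtain b where bm[measurable]: "b \<in> borel_measurable borel" and b0: "\<And>t. 0 \<le> b t"
    and bs: "\<And>t. b t \<noteq> 0 \<Longrightarrow> 0 < t \<and> t \<le> pi / 2"
    and be: "AE t in lborel. indicator {0..pi/2} t * (t\<^sup>2 * \<beta> t) = b t"
    and bi: "integrable lborel b" "(LINT t|lborel. b t) = 8 * real (DIM('a) - 1) / sphere_area DIM('a)"
    by (rule angular_density[OF \<beta>]) (rule that; simp)
  obtain e :: 'a where e: "e \<in> Basis" using nonempty_Basis by blast
  have ne: "norm e = 1" using e by simp
  obtain B where B: "\<And>\<xi>. \<bar>\<phi> \<xi>\<bar> \<le> B"
    using continuous_bounded_support_bound[OF Cc_inftyD(3)[OF \<phi>] Cc_inftyD(2)[OF \<phi>]] by (metis real_norm_def)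
  have \<phi>m: "\<phi> \<in> borel_measurable borel"
    by (rule borel_measurable_continuous_onI[OF Cc_inftyD(3)[OF \<phi>]])
  have "continuous_on UNIV (\<lambda>\<xi>. snd (grad \<phi> \<xi>))"
    by (rule continuous_on_snd[OF C_k_grad(1)[OF Cc_inftyD(1)[OF \<phi>]]])
  then have Dm: "(\<lambda>\<xi>. snd (grad \<phi> \<xi>)) \<in> borel_measurable borel"
    by (rule borel_measurable_continuous_onI)
  let ?B = "density lborel (\<lambda>t. ennreal (b t))"
  interpret S: finite_measure "sph e" by (rule finite_measure_sph[OF e dim])
  have "emeasure ?B (space ?B) = ennreal (LINT t|lborel. b t)"
    using nn_integral_eq_integral[OF bi(1)] b0 by (simp add: emeasure_density)
  then interpret Bm: finite_measure ?B by (intro finite_measureI) simp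
  interpret BS: pair_sigma_finite ?B "sph e" ..
  have fm: "finite_measure (?B \<Otimes>\<^sub>M sph e)"
  proof (rule finite_measureI)
    have "emeasure (?B \<Otimes>\<^sub>M sph e) (UNIV \<times> UNIV) = emeasure ?B UNIV * emeasure (sph e) UNIV"
      by (rule S.emeasure_pair_measure_Times) auto
    then show "emeasure (?B \<Otimes>\<^sub>M sph e) (space (?B \<Otimes>\<^sub>M sph e)) \<noteq> \<infinity>"
      using Bm.emeasure_finite[of UNIV] S.emeasure_finite[of UNIV]
      by (simp add: space_pair_measure ennreal_mult_eq_top_iff)
  qed
  have bt: "AE z in ?B \<Otimes>\<^sub>M sph e. 0 < fst z \<and> fst z \<le> pi / 2"
  proof (rule AE_pair_fst[OF S.sigma_finite_measure_axioms])
    show "AE t in ?B. 0 < t \<and> t \<le> pi / 2"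
    proof (subst AE_density)
      show "AE t in lborel. 0 < ennreal (b t) \<longrightarrow> 0 < t \<and> t \<le> pi / 2"
      proof (intro always_eventually allI impI)
        fix t assume "0 < ennreal (b t)"
        then have "b t \<noteq> 0" by auto
        then show "0 < t \<and> t \<le> pi / 2" by (rule bs)
      qed
    qed measurable
  qed
  interpret kernel_collisions b e X \<gamma> "\<gamma> + 2" R C g G M \<phi> "\<lambda>\<xi>. snd (grad \<phi> \<xi>)" cut \<beta> f B
  proof (intro kernel_collisions.intro grazing_collisions.intro grazing.intro fm
      grazing_axioms.intro grazing_collisions_axioms.intro kernel_collisions_axioms.intro)
    show "(\<lambda>z. X n * fst z / pi) \<in> borel_measurable (?B \<Otimes>\<^sub>M sph e)" for n by measurable
    show "snd \<in> ?B \<Otimes>\<^sub>M sph e \<rightarrow>\<^sub>M borel" using measurable_snd[of ?B "sph e"] by (simp cong: measurable_cong_sets)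
    show "AE z in ?B \<Otimes>\<^sub>M sph e. norm (snd z) = 1 \<and> snd z \<bullet> e = 0"
      by (rule AE_pair_snd[OF S.sigma_finite_measure_axioms AE_sph[OF ne]])
    show "AE z in ?B \<Otimes>\<^sub>M sph e. \<forall>n. 0 < X n * fst z / pi \<and> X n * fst z / pi \<le> 1 / 20"
      using bt
    proof eventually_elim
      case (elim z)
      have "X n * fst z / pi \<le> 1 / 20" for n
      proof -
        have "X n * fst z \<le> (1 / 10) * (pi / 2)" using elim X(1,2)[of n] by (intro mult_mono) auto
        then show ?thesis by (simp add: field_simps)
      qed
      then show ?case using elim X(1) by simp
    qed
    show "AE z in ?B \<Otimes>\<^sub>M sph e. (\<lambda>n. X n * fst z / pi) \<longlonglongrightarrow> 0"
    proof (intro always_eventually allI)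
      fix z :: "real \<times> 'a"
      have "(\<lambda>n. X n * fst z / pi) \<longlonglongrightarrow> 0 * fst z / pi" by (intro tendsto_intros X(3)) simp
      then show "(\<lambda>n. X n * fst z / pi) \<longlonglongrightarrow> 0" by simp
    qed
  qed (fact ne refl r d \<phi>m Dm gs seg fin CR lip test_function_velocity_derivative[OF \<phi>] cut e dim X(1) bm b0 bs be bi fg B)+
  show ?thesis by (rule Q_eps_limit)
qed

theorem theorem3p1:
  fixes f :: "(real ^ 'n) \<times> (real ^ 'n) \<Rightarrow> real"
    and \<beta> :: "real \<Rightarrow> real"
    and \<gamma> :: real
  assumes "CARD('n) \<ge> 2"
    and "- 2 \<le> \<gamma>" and "\<gamma> \<le> 1"
    and "angular_kernel CARD('n) \<beta>"
    and "AE z in lebesgue. f z \<ge> 0"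
    and "f \<in> L3_W (\<gamma> + 2)"
  shows "\<forall>\<phi>\<in>Cc_infty. ((\<lambda>\<epsilon>. Q_eps_pairing \<gamma> \<beta> \<epsilon> f \<phi>) \<longlongrightarrow> Q_L_pairing \<gamma> f \<phi>) (at_right 0)"
proof
  fix \<phi> :: "(real ^ 'n) \<times> (real ^ 'n) \<Rightarrow> real" assume \<phi>: "\<phi> \<in> Cc_infty"
  have "((\<lambda>\<epsilon>. Q_eps_pairing \<gamma> \<beta> \<epsilon> f \<phi>) \<longlongrightarrow> Q_L_pairing \<gamma> f \<phi>) (at 0 within {0<..<1/10})"
    unfolding tendsto_at_iff_sequentially
  proof (intro allI impI)
    fix X :: "nat \<Rightarrow> real" assume "\<forall>n. X n \<in> {0<..<1/10} - {0}" and X: "X \<longlonglongrightarrow> 0"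
    then have "0 < X n" "X n < 1 / 10" for n by auto
    then show "((\<lambda>\<epsilon>. Q_eps_pairing \<gamma> \<beta> \<epsilon> f \<phi>) \<circ> X) \<longlonglongrightarrow> Q_L_pairing \<gamma> f \<phi>"
      unfolding comp_def using assms X by (intro Q_eps_limit_sequentially \<phi>) auto
  qed
  moreover have "at 0 within {0<..<1/10} = at_right (0 :: real)"
    by (rule at_within_nhd[where S = "{..<1/10}"]) auto
  ultimately show "((\<lambda>\<epsilon>. Q_eps_pairing \<gamma> \<beta> \<epsilon> f \<phi>) \<longlongrightarrow> Q_L_pairing \<gamma> f \<phi>) (at_right 0)" by simp
qed

end
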